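(* Let $(Q,L_d,f_d)$ be a regular forced discrete mechanical system of Routh type with potential $\beta\in\Omega^2(Q)$. Then the flow $\mathbf F_{L_d,f_d}$ preserves the symplectic structures $$\omega^+=(\mathbb F^+_{f_d}L_d)^*(\omega_Q-\pi_Q^*\beta),\qquad \omega^-=(\mathbb F^-_{f_d}L_d)^*(\omega_Q-\pi_Q^*\beta);$$ that is, $\omega^\pm$ are symplectic structures on $Q\times Q$ and $(\mathbf F_{L_d,f_d})^*\omega^\pm=\omega^\pm$ on the domain of every local flow $\mathbf F_{L_d,f_d}:U\to V$.
   Context: $Q$ is a smooth $n$-dimensional manifold; $\mathrm{pr}_1,\mathrm{pr}_2:Q\times Q\to Q$ are the projections. For a smooth $H$ on $Q\times Q$, $D_1H(q_0,q_1)(\delta q_0):=TH(\delta q_0,0)$ and $D_2H(q_0,q_1)(\delta q_1):=TH(0,\delta q_1)$. A forced discrete mechanical system is a triple $(Q,L_d,f_d)$ with $L_d:Q\times Q\to\mathbb R$ smooth and $f_d$ a (smooth) 1-form on $Q\times Q$, written $f_d(q_0,q_1)(\delta q_0,\delta q_1)=f_d^-(q_0,q_1)(\delta q_0)+f_d^+(q_0,q_1)(\delta q_1)$ with $f_d^-(q_0,q_1)\in T^*_{q_0}Q$, $f_d^+(q_0,q_1)\in T^*_{q_1}Q$. A triple $(q_0,q_1,q_2)$ is a trajectory iff $D_2L_d(q_0,q_1)+D_1L_d(q_1,q_2)+f_d^+(q_0,q_1)+f_d^-(q_1,q_2)=0\in T^*_{q_1}Q$. The forced discrete Legendre transforms $Q\times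 Q\to T^*Q$ are $\mathbb F^+_{f_d}L_d(q_0,q_1):=(q_1,D_2L_d(q_0,q_1)+f_d^+(q_0,q_1))$ and $\mathbb F^-_{f_d}L_d(q_0,q_1):=(q_0,-D_1L_d(q_0,q_1)-f_d^-(q_0,q_1))$. The system is regular if both are local diffeomorphisms. $\pi_Q:T^*Q\to Q$ is the projection, $\theta_Q$ the canonical 1-form and $\omega_Q=-d\theta_Q$ the canonical symplectic form. A (local) flow is a diffeomorphism $\mathbf F_{L_d,f_d}:U\to V$ between open subsets of $Q\times Q$ such that for every $(q_0,q_1)\in U$ one has $\mathbf F_{L_d,f_d}(q_0,q_1)=(q_1,q_2)$ with $(q_0,q_1,q_2)$ a trajectory, and every trajectory $(q_0',q_1',q_2')$ with $(q_0',q_1')\in U$, $(q_1',q_2')\in V$ satisfies $\mathbf F_{L_d,f_d}(q_0',q_1')=(q_1',q_2')$. (For regular systems such flows exist around every length-2 trajectory.) The system is of Routh type with (Routh) potential $\beta\in\Omega^2(Q)$ if $-df_d=\mathrm{pr}_2^*\beta-\mathrm{pr}_1^*\beta$. *)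

theory Defs
  imports "HOL-Analysis.Analysis"
begin

section \<open>Smooth maps between open subsets of Euclidean spaces\<close>

text \<open>
  All iterated directional derivatives exist (as Frechet derivatives) and are continuous.
  Only used for open \<open>S\<close>.
\<close>

primrec Ck_on :: "nat \<Rightarrow> 'a::euclidean_space set \<Rightarrow> ('a \<Rightarrow> 'b::euclidean_space) \<Rightarrow> bool" where
  "Ck_on 0 S f \<longleftrightarrow> continuous_on S f"
| "Ck_on (Suc k) S f \<longleftrightarrow>
     (\<forall>x\<in>S. f differentiable (at x)) \<and>
     (\<forall>v. Ck_on k S (\<lambda>x. frechet_derivative f (at x) v))"

definition smooth_on :: "'a::euclidean_space set \<Rightarrow> ('a \<Rightarrow> 'b::euclidean_space) \<Rightarrow> bool" where
  "smooth_on S f \<longleftrightarrow> (\<forall>k. Ck_on k S f)"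


section \<open>Smooth manifolds\<close>

text \<open>
  A chart is a pair \<open>(U, \<phi>)\<close> of its domain and its coordinate map; values of \<open>\<phi>\<close> outside
  \<open>U\<close> are irrelevant. A manifold is given by an atlas (not necessarily maximal) on its set of
  points; the topology is the one induced by the atlas, and is required to be Hausdorff and
  second countable. The dimension is \<open>DIM('e)\<close>.
\<close>

type_synonym ('p, 'e) chart = "'p set \<times> ('p \<Rightarrow> 'e)"
type_synonym ('p, 'e) atlas = "('p, 'e) chart set"

definition chart_inv :: "('p, 'e) chart \<Rightarrow> 'e \<Rightarrow> 'p" where
  "chart_inv c = inv_into (fst c) (snd c)"

definition points :: "('p, 'e) atlas \<Rightarrow> 'p set" where
  "points A = (\<Union>c\<in>A. fst c)"

definition smooth_atlas :: "('p, 'e::euclidean_space) atlas \<Rightarrow> bool" where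
  "smooth_atlas A \<longleftrightarrow>
     (\<forall>c\<in>A. inj_on (snd c) (fst c) \<and> open (snd c ` fst c)) \<and>
     (\<forall>c\<in>A. \<forall>d\<in>A. open (snd c ` (fst c \<inter> fst d)) \<and>
        smooth_on (snd c ` (fst c \<inter> fst d)) (snd d \<circ> chart_inv c))"

definition manifold_topology :: "('p, 'e::euclidean_space) atlas \<Rightarrow> 'p topology" where
  "manifold_topology A =
     topology (\<lambda>W. W \<subseteq> points A \<and> (\<forall>c\<in>A. open (snd c ` (W \<inter> fst c))))"

definition smooth_manifold :: "('p, 'e::euclidean_space) atlas \<Rightarrow> bool" where
  "smooth_manifold A \<longleftrightarrow> smooth_atlas A \<and>
     Hausdorff_space (manifold_topology A) \<and> second_countable (manifold_topology A)"

lemma openin_manifold_topology: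
  assumes "smooth_atlas A"
  shows "openin (manifold_topology A) W \<longleftrightarrow>
           W \<subseteq> points A \<and> (\<forall>c\<in>A. open (snd c ` (W \<inter> fst c)))"
proof -
  have "istopology (\<lambda>W. W \<subseteq> points A \<and> (\<forall>c\<in>A. open (snd c ` (W \<inter> fst c))))"
    (is "istopology ?O")
    unfolding istopology_def
  proof (rule conjI; intro allI impI)
    fix S T
    assume S: "?O S" and T: "?O T"
    have "snd c ` (S \<inter> T \<inter> fst c) = snd c ` (S \<inter> fst c) \<inter> snd c ` (T \<inter> fst c)"
      if "c \<in> A" for c
    proof -
      have "inj_on (snd c) (fst c)" using assms that by (auto simp: smooth_atlas_def)
      then show ?thesis by (auto simp: inj_on_def)
    qed
    then show "?O (S \<inter> T)" using S T by (auto simp: open_Int)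
  next
    fix \<K>
    assume K: "\<forall>K\<in>\<K>. ?O K"
    have eq: "snd c ` (\<Union>\<K> \<inter> fst c) = (\<Union>K\<in>\<K>. snd c ` (K \<inter> fst c))" for c by blast
    have "open (snd c ` (\<Union>\<K> \<inter> fst c))" if "c \<in> A" for c
      unfolding eq using K that by (intro open_UN) blast
    then show "?O (\<Union>\<K>)" using K by blast
  qed
  then show ?thesis by (simp add: manifold_topology_def topology_inverse')
qed

definition smooth_map ::
    "('p, 'e::euclidean_space) atlas \<Rightarrow> ('q, 'f::euclidean_space) atlas \<Rightarrow> 'p set \<Rightarrow> ('p \<Rightarrow> 'q) \<Rightarrow> bool"
  where
  "smooth_map A B U f \<longleftrightarrow> f ` U \<subseteq> points B \<and>
     (\<forall>p\<in>U. \<exists>c\<in>A. \<exists>d\<in>B. \<exists>W.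
        openin (manifold_topology A) W \<and> p \<in> W \<and> W \<subseteq> U \<inter> fst c \<and> f ` W \<subseteq> fst d \<and>
        smooth_on (snd c ` W) (snd d \<circ> f \<circ> chart_inv c))"

definition smooth_fun :: "('p, 'e::euclidean_space) atlas \<Rightarrow> ('p \<Rightarrow> real) \<Rightarrow> bool" where
  "smooth_fun A h \<longleftrightarrow> (\<forall>c\<in>A. smooth_on (snd c ` fst c) (h \<circ> chart_inv c))"

definition diffeo ::
    "('p, 'e::euclidean_space) atlas \<Rightarrow> ('q, 'f::euclidean_space) atlas \<Rightarrow> ('p \<Rightarrow> 'q) \<Rightarrow>
     'p set \<Rightarrow> 'q set \<Rightarrow> bool" where
  "diffeo A B f U V \<longleftrightarrow>
     openin (manifold_topology A) U \<and> openin (manifold_topology B) V \<and> bij_betw f U V \<and>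
     smooth_map A B U f \<and> smooth_map B A V (inv_into U f)"

definition local_diffeo ::
    "('p, 'e::euclidean_space) atlas \<Rightarrow> ('q, 'f::euclidean_space) atlas \<Rightarrow> ('p \<Rightarrow> 'q) \<Rightarrow> bool" where
  "local_diffeo A B f \<longleftrightarrow> (\<forall>p\<in>points A. \<exists>U. p \<in> U \<and> diffeo A B f U (f ` U))"


section \<open>Tangent spaces and tangent maps\<close>

text \<open>
  A tangent vector at \<open>p\<close> is a family of coordinate vectors, one for each chart around \<open>p\<close>,
  related by the derivatives of the coordinate changes. The family is set to \<open>0\<close> at all
  other charts, so that tangent vectors are determined by the relevant coordinates.
\<close>

type_synonym ('p, 'e) tvec = "('p, 'e) chart \<Rightarrow> 'e"

definition tangent_space :: "('p, 'e::euclidean_space) atlas \<Rightarrow> 'p \<Rightarrow> ('p, 'e) tvec set" where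
  "tangent_space A p = {v.
     (\<forall>c\<in>A. \<forall>d\<in>A. p \<in> fst c \<and> p \<in> fst d \<longrightarrow>
        v d = frechet_derivative (snd d \<circ> chart_inv c) (at (snd c p)) (v c)) \<and>
     (\<forall>c. \<not> (c \<in> A \<and> p \<in> fst c) \<longrightarrow> v c = 0)}"

definition zero_tvec :: "('p, 'e::euclidean_space) tvec" where
  "zero_tvec = (\<lambda>c. 0)"

definition coord_vec ::
    "('p, 'e::euclidean_space) atlas \<Rightarrow> ('p, 'e) chart \<Rightarrow> 'p \<Rightarrow> 'e \<Rightarrow> ('p, 'e) tvec" where
    \<comment> \<open>the tangent vector at \<open>p\<close> whose coordinate vector in the chart \<open>c\<close> is \<open>a\<close>\<close>
  "coord_vec A c p a = (\<lambda>d. if d \<in> A \<and> p \<in> fst d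
     then frechet_derivative (snd d \<circ> chart_inv c) (at (snd c p)) a else 0)"

text \<open>
  Constructions below use one chosen chart around each point; by the chain rule (and, for the
  exterior derivative, the symmetry of second derivatives) they do not depend on it.
\<close>

definition chart_at :: "('p, 'e) atlas \<Rightarrow> 'p \<Rightarrow> ('p, 'e) chart" where
  "chart_at A p = (SOME c. c \<in> A \<and> p \<in> fst c)"

definition tangent_map ::
    "('p, 'e::euclidean_space) atlas \<Rightarrow> ('q, 'f::euclidean_space) atlas \<Rightarrow> ('p \<Rightarrow> 'q) \<Rightarrow> 'p \<Rightarrow>
     ('p, 'e) tvec \<Rightarrow> ('q, 'f) tvec" where
  "tangent_map A B f p v = (let c = chart_at A p in
     (\<lambda>d. if d \<in> B \<and> f p \<in> fst d
       then frechet_derivative (snd d \<circ> f \<circ> chart_inv c) (at (snd c p)) (v c) else 0))"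

definition differential ::
    "('p, 'e::euclidean_space) atlas \<Rightarrow> ('p \<Rightarrow> real) \<Rightarrow> 'p \<Rightarrow> ('p, 'e) tvec \<Rightarrow> real" where
  "differential A h p v = (let c = chart_at A p in
     frechet_derivative (h \<circ> chart_inv c) (at (snd c p)) (v c))"


section \<open>Differential forms of degree one and two\<close>

definition linear_on_tangent ::
    "('p, 'e::euclidean_space) atlas \<Rightarrow> 'p \<Rightarrow> (('p, 'e) tvec \<Rightarrow> real) \<Rightarrow> bool" where
  "linear_on_tangent A p \<alpha> \<longleftrightarrow>
     (\<forall>u\<in>tangent_space A p. \<forall>v\<in>tangent_space A p. \<forall>r s.
        \<alpha> (\<lambda>c. r *\<^sub>R u c + s *\<^sub>R v c) = r * \<alpha> u + s * \<alpha> v)"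

type_synonym ('p, 'e) form1 = "'p \<Rightarrow> ('p, 'e) tvec \<Rightarrow> real"
type_synonym ('p, 'e) form2 = "'p \<Rightarrow> ('p, 'e) tvec \<Rightarrow> ('p, 'e) tvec \<Rightarrow> real"

text \<open>
  Values of forms are only relevant at points of the manifold and on tangent vectors there.
\<close>

definition one_form :: "('p, 'e::euclidean_space) atlas \<Rightarrow> ('p, 'e) form1 \<Rightarrow> bool" where
  "one_form A \<alpha> \<longleftrightarrow>
     (\<forall>p\<in>points A. linear_on_tangent A p (\<alpha> p)) \<and>
     (\<forall>c\<in>A. \<forall>a. smooth_on (snd c ` fst c)
        (\<lambda>x. \<alpha> (chart_inv c x) (coord_vec A c (chart_inv c x) a)))"

definition two_form :: "('p, 'e::euclidean_space) atlas \<Rightarrow> ('p, 'e) form2 \<Rightarrow> bool" where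
  "two_form A \<omega> \<longleftrightarrow>
     (\<forall>p\<in>points A. \<forall>u\<in>tangent_space A p.
        linear_on_tangent A p (\<lambda>v. \<omega> p u v) \<and> linear_on_tangent A p (\<lambda>v. \<omega> p v u) \<and>
        \<omega> p u u = 0) \<and>
     (\<forall>c\<in>A. \<forall>a b. smooth_on (snd c ` fst c)
        (\<lambda>x. \<omega> (chart_inv c x) (coord_vec A c (chart_inv c x) a)
                               (coord_vec A c (chart_inv c x) b)))"

definition pullback2 ::
    "('p, 'e::euclidean_space) atlas \<Rightarrow> ('q, 'f::euclidean_space) atlas \<Rightarrow> ('p \<Rightarrow> 'q) \<Rightarrow>
     ('q, 'f) form2 \<Rightarrow> ('p, 'e) form2" where
  "pullback2 A B f \<omega> p u v = \<omega> (f p) (tangent_map A B f p u) (tangent_map A B f p v)"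

text \<open>
  In a chart, the exterior derivatives are \<open>d\<alpha>(u, v) = u(\<alpha>(v)) - v(\<alpha>(u))\<close> and
  \<open>d\<omega>(u, v, w) = u(\<omega>(v, w)) - v(\<omega>(u, w)) + w(\<omega>(u, v))\<close>, the vectors being extended to vector
  fields with constant coordinates.
\<close>

definition ext_deriv1 ::
    "('p, 'e::euclidean_space) atlas \<Rightarrow> ('p, 'e) form1 \<Rightarrow> ('p, 'e) form2" where
  "ext_deriv1 A \<alpha> p u v = (let c = chart_at A p;
       \<alpha>' = (\<lambda>a x. \<alpha> (chart_inv c x) (coord_vec A c (chart_inv c x) a)) in
     frechet_derivative (\<alpha>' (v c)) (at (snd c p)) (u c) -
     frechet_derivative (\<alpha>' (u c)) (at (snd c p)) (v c))"

definition ext_deriv2 ::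
    "('p, 'e::euclidean_space) atlas \<Rightarrow> ('p, 'e) form2 \<Rightarrow>
     'p \<Rightarrow> ('p, 'e) tvec \<Rightarrow> ('p, 'e) tvec \<Rightarrow> ('p, 'e) tvec \<Rightarrow> real" where
  "ext_deriv2 A \<omega> p u v w = (let c = chart_at A p;
       \<omega>' = (\<lambda>a b x. \<omega> (chart_inv c x) (coord_vec A c (chart_inv c x) a)
                                      (coord_vec A c (chart_inv c x) b)) in
     frechet_derivative (\<omega>' (v c) (w c)) (at (snd c p)) (u c) -
     frechet_derivative (\<omega>' (u c) (w c)) (at (snd c p)) (v c) +
     frechet_derivative (\<omega>' (u c) (v c)) (at (snd c p)) (w c))"

definition closed2 :: "('p, 'e::euclidean_space) atlas \<Rightarrow> ('p, 'e) form2 \<Rightarrow> bool" where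
  "closed2 A \<omega> \<longleftrightarrow> (\<forall>p\<in>points A. \<forall>u\<in>tangent_space A p. \<forall>v\<in>tangent_space A p.
     \<forall>w\<in>tangent_space A p. ext_deriv2 A \<omega> p u v w = 0)"

definition nondegenerate2 :: "('p, 'e::euclidean_space) atlas \<Rightarrow> ('p, 'e) form2 \<Rightarrow> bool" where
  "nondegenerate2 A \<omega> \<longleftrightarrow> (\<forall>p\<in>points A. \<forall>u\<in>tangent_space A p.
     (\<forall>v\<in>tangent_space A p. \<omega> p u v = 0) \<longrightarrow> u = zero_tvec)"

definition symplectic_form :: "('p, 'e::euclidean_space) atlas \<Rightarrow> ('p, 'e) form2 \<Rightarrow> bool" where
  "symplectic_form A \<omega> \<longleftrightarrow> two_form A \<omega> \<and> closed2 A \<omega> \<and> nondegenerate2 A \<omega>"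

definition forms2_eq_on ::
    "('p, 'e::euclidean_space) atlas \<Rightarrow> 'p set \<Rightarrow> ('p, 'e) form2 \<Rightarrow> ('p, 'e) form2 \<Rightarrow> bool" where
  "forms2_eq_on A U \<omega> \<eta> \<longleftrightarrow>
     (\<forall>p\<in>U. \<forall>u\<in>tangent_space A p. \<forall>v\<in>tangent_space A p. \<omega> p u v = \<eta> p u v)"


section \<open>Product manifolds\<close>

definition prod_chart :: "('p, 'e) chart \<Rightarrow> ('q, 'f) chart \<Rightarrow> ('p \<times> 'q, 'e \<times> 'f) chart" where
  "prod_chart c d = (fst c \<times> fst d, map_prod (snd c) (snd d))"

definition prod_atlas :: "('p, 'e) atlas \<Rightarrow> ('q, 'f) atlas \<Rightarrow> ('p \<times> 'q, 'e \<times> 'f) atlas" where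
  "prod_atlas A B = {prod_chart c d | c d. c \<in> A \<and> d \<in> B}"

text \<open>
  The identification of \<open>T\<^sub>pM \<times> T\<^sub>qN\<close> with \<open>T\<^bsub>(p,q)\<^esub>(M \<times> N)\<close>, inverse to the pair of tangent
  maps of the two projections.
\<close>

definition tvec_pair ::
    "('p, 'e::euclidean_space) atlas \<Rightarrow> ('q, 'f::euclidean_space) atlas \<Rightarrow> 'p \<Rightarrow> 'q \<Rightarrow>
     ('p, 'e) tvec \<Rightarrow> ('q, 'f) tvec \<Rightarrow> ('p \<times> 'q, 'e \<times> 'f) tvec" where
  "tvec_pair A B p q v w = (THE u. u \<in> tangent_space (prod_atlas A B) (p, q) \<and>
     tangent_map (prod_atlas A B) A fst (p, q) u = v \<and>
     tangent_map (prod_atlas A B) B snd (p, q) u = w)"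


section \<open>The cotangent bundle\<close>

type_synonym ('p, 'e) covec = "('p, 'e) tvec \<Rightarrow> real"

text \<open>
  Covectors at \<open>p\<close> are linear functionals on \<open>T\<^sub>pM\<close>, set to \<open>0\<close> outside \<open>T\<^sub>pM\<close>
  so that equality of covectors is equality on \<open>T\<^sub>pM\<close>.
\<close>

definition cotangent_space :: "('p, 'e::euclidean_space) atlas \<Rightarrow> 'p \<Rightarrow> ('p, 'e) covec set" where
  "cotangent_space A p =
     {\<alpha>. linear_on_tangent A p \<alpha> \<and> (\<forall>v. v \<notin> tangent_space A p \<longrightarrow> \<alpha> v = 0)}"

definition restrict_covec ::
    "('p, 'e::euclidean_space) atlas \<Rightarrow> 'p \<Rightarrow> ('p, 'e) covec \<Rightarrow> ('p, 'e) covec" where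
  "restrict_covec A p \<alpha> = (\<lambda>v. if v \<in> tangent_space A p then \<alpha> v else 0)"

definition cotangent_chart ::
    "('p, 'e::euclidean_space) atlas \<Rightarrow> ('p, 'e) chart \<Rightarrow> ('p \<times> ('p, 'e) covec, 'e \<times> 'e) chart" where
  "cotangent_chart A c =
     ({(p, \<alpha>). p \<in> fst c \<and> \<alpha> \<in> cotangent_space A p},
      (\<lambda>(p, \<alpha>). (snd c p, \<Sum>b\<in>Basis. \<alpha> (coord_vec A c p b) *\<^sub>R b)))"

definition cotangent_bundle ::
    "('p, 'e::euclidean_space) atlas \<Rightarrow> ('p \<times> ('p, 'e) covec, 'e \<times> 'e) atlas" where
  "cotangent_bundle A = cotangent_chart A ` A"

definition canonical_1form ::
    "('p, 'e::euclidean_space) atlas \<Rightarrow> ('p \<times> ('p, 'e) covec, 'e \<times> 'e) form1" where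
  "canonical_1form A z w = snd z (tangent_map (cotangent_bundle A) A fst z w)"

definition canonical_2form ::
    "('p, 'e::euclidean_space) atlas \<Rightarrow> ('p \<times> ('p, 'e) covec, 'e \<times> 'e) form2" where
  "canonical_2form A z u v = - ext_deriv1 (cotangent_bundle A) (canonical_1form A) z u v"


section \<open>Forced discrete mechanical systems\<close>

definition D1 ::
    "('q, 'e::euclidean_space) atlas \<Rightarrow> ('q \<times> 'q \<Rightarrow> real) \<Rightarrow> 'q \<Rightarrow> 'q \<Rightarrow> ('q, 'e) tvec \<Rightarrow> real" where
  "D1 Q h q\<^sub>0 q\<^sub>1 v = differential (prod_atlas Q Q) h (q\<^sub>0, q\<^sub>1) (tvec_pair Q Q q\<^sub>0 q\<^sub>1 v zero_tvec)"

definition D2 ::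
    "('q, 'e::euclidean_space) atlas \<Rightarrow> ('q \<times> 'q \<Rightarrow> real) \<Rightarrow> 'q \<Rightarrow> 'q \<Rightarrow> ('q, 'e) tvec \<Rightarrow> real" where
  "D2 Q h q\<^sub>0 q\<^sub>1 v = differential (prod_atlas Q Q) h (q\<^sub>0, q\<^sub>1) (tvec_pair Q Q q\<^sub>0 q\<^sub>1 zero_tvec v)"

definition force_minus ::
    "('q, 'e::euclidean_space) atlas \<Rightarrow> ('q \<times> 'q, 'e \<times> 'e) form1 \<Rightarrow> 'q \<Rightarrow> 'q \<Rightarrow> ('q, 'e) tvec \<Rightarrow> real"
  where
  "force_minus Q f q\<^sub>0 q\<^sub>1 v = f (q\<^sub>0, q\<^sub>1) (tvec_pair Q Q q\<^sub>0 q\<^sub>1 v zero_tvec)"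

definition force_plus ::
    "('q, 'e::euclidean_space) atlas \<Rightarrow> ('q \<times> 'q, 'e \<times> 'e) form1 \<Rightarrow> 'q \<Rightarrow> 'q \<Rightarrow> ('q, 'e) tvec \<Rightarrow> real"
  where
  "force_plus Q f q\<^sub>0 q\<^sub>1 v = f (q\<^sub>0, q\<^sub>1) (tvec_pair Q Q q\<^sub>0 q\<^sub>1 zero_tvec v)"

definition forced_discrete_system ::
    "('q, 'e::euclidean_space) atlas \<Rightarrow> ('q \<times> 'q \<Rightarrow> real) \<Rightarrow> ('q \<times> 'q, 'e \<times> 'e) form1 \<Rightarrow> bool" where
  "forced_discrete_system Q L f \<longleftrightarrow>
     smooth_manifold Q \<and> smooth_fun (prod_atlas Q Q) L \<and> one_form (prod_atlas Q Q) f"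

definition trajectory ::
    "('q, 'e::euclidean_space) atlas \<Rightarrow> ('q \<times> 'q \<Rightarrow> real) \<Rightarrow> ('q \<times> 'q, 'e \<times> 'e) form1 \<Rightarrow>
     'q \<Rightarrow> 'q \<Rightarrow> 'q \<Rightarrow> bool" where
  "trajectory Q L f q\<^sub>0 q\<^sub>1 q\<^sub>2 \<longleftrightarrow>
     q\<^sub>0 \<in> points Q \<and> q\<^sub>1 \<in> points Q \<and> q\<^sub>2 \<in> points Q \<and>
     (\<forall>v\<in>tangent_space Q q\<^sub>1.
        D2 Q L q\<^sub>0 q\<^sub>1 v + D1 Q L q\<^sub>1 q\<^sub>2 v + force_plus Q f q\<^sub>0 q\<^sub>1 v + force_minus Q f q\<^sub>1 q\<^sub>2 v = 0)"

definition legendre_plus ::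
    "('q, 'e::euclidean_space) atlas \<Rightarrow> ('q \<times> 'q \<Rightarrow> real) \<Rightarrow> ('q \<times> 'q, 'e \<times> 'e) form1 \<Rightarrow>
     'q \<times> 'q \<Rightarrow> 'q \<times> ('q, 'e) covec" where
  "legendre_plus Q L f = (\<lambda>(q\<^sub>0, q\<^sub>1).
     (q\<^sub>1, restrict_covec Q q\<^sub>1 (\<lambda>v. D2 Q L q\<^sub>0 q\<^sub>1 v + force_plus Q f q\<^sub>0 q\<^sub>1 v)))"

definition legendre_minus ::
    "('q, 'e::euclidean_space) atlas \<Rightarrow> ('q \<times> 'q \<Rightarrow> real) \<Rightarrow> ('q \<times> 'q, 'e \<times> 'e) form1 \<Rightarrow>
     'q \<times> 'q \<Rightarrow> 'q \<times> ('q, 'e) covec" where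
  "legendre_minus Q L f = (\<lambda>(q\<^sub>0, q\<^sub>1).
     (q\<^sub>0, restrict_covec Q q\<^sub>0 (\<lambda>v. - D1 Q L q\<^sub>0 q\<^sub>1 v - force_minus Q f q\<^sub>0 q\<^sub>1 v)))"

definition regular_system ::
    "('q, 'e::euclidean_space) atlas \<Rightarrow> ('q \<times> 'q \<Rightarrow> real) \<Rightarrow> ('q \<times> 'q, 'e \<times> 'e) form1 \<Rightarrow> bool" where
  "regular_system Q L f \<longleftrightarrow>
     local_diffeo (prod_atlas Q Q) (cotangent_bundle Q) (legendre_plus Q L f) \<and>
     local_diffeo (prod_atlas Q Q) (cotangent_bundle Q) (legendre_minus Q L f)"

definition local_flow ::
    "('q, 'e::euclidean_space) atlas \<Rightarrow> ('q \<times> 'q \<Rightarrow> real) \<Rightarrow> ('q \<times> 'q, 'e \<times> 'e) form1 \<Rightarrow>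
     ('q \<times> 'q \<Rightarrow> 'q \<times> 'q) \<Rightarrow> ('q \<times> 'q) set \<Rightarrow> ('q \<times> 'q) set \<Rightarrow> bool" where
  "local_flow Q L f F U V \<longleftrightarrow>
     diffeo (prod_atlas Q Q) (prod_atlas Q Q) F U V \<and>
     (\<forall>q\<^sub>0 q\<^sub>1. (q\<^sub>0, q\<^sub>1) \<in> U \<longrightarrow> (\<exists>q\<^sub>2. F (q\<^sub>0, q\<^sub>1) = (q\<^sub>1, q\<^sub>2) \<and> trajectory Q L f q\<^sub>0 q\<^sub>1 q\<^sub>2)) \<and>
     (\<forall>q\<^sub>0 q\<^sub>1 q\<^sub>2. trajectory Q L f q\<^sub>0 q\<^sub>1 q\<^sub>2 \<and> (q\<^sub>0, q\<^sub>1) \<in> U \<and> (q\<^sub>1, q\<^sub>2) \<in> V \<longrightarrow>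
        F (q\<^sub>0, q\<^sub>1) = (q\<^sub>1, q\<^sub>2))"

definition routh_type ::
    "('q, 'e::euclidean_space) atlas \<Rightarrow> ('q \<times> 'q, 'e \<times> 'e) form1 \<Rightarrow> ('q, 'e) form2 \<Rightarrow> bool" where
  "routh_type Q f \<beta> \<longleftrightarrow> two_form Q \<beta> \<and>
     forms2_eq_on (prod_atlas Q Q) (points (prod_atlas Q Q))
       (\<lambda>p u v. - ext_deriv1 (prod_atlas Q Q) f p u v)
       (\<lambda>p u v. pullback2 (prod_atlas Q Q) Q snd \<beta> p u v - pullback2 (prod_atlas Q Q) Q fst \<beta> p u v)"

definition magnetic_2form ::
    "('q, 'e::euclidean_space) atlas \<Rightarrow> ('q, 'e) form2 \<Rightarrow> ('q \<times> ('q, 'e) covec, 'e \<times> 'e) form2" where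
    \<comment> \<open>\<open>\<omega>\<^sub>Q - \<pi>\<^sub>Q\<^sup>*\<beta>\<close>\<close>
  "magnetic_2form Q \<beta> z u v =
     canonical_2form Q z u v - pullback2 (cotangent_bundle Q) Q fst \<beta> z u v"

definition omega_plus ::
    "('q, 'e::euclidean_space) atlas \<Rightarrow> ('q \<times> 'q \<Rightarrow> real) \<Rightarrow> ('q \<times> 'q, 'e \<times> 'e) form1 \<Rightarrow>
     ('q, 'e) form2 \<Rightarrow> ('q \<times> 'q, 'e \<times> 'e) form2" where
  "omega_plus Q L f \<beta> =
     pullback2 (prod_atlas Q Q) (cotangent_bundle Q) (legendre_plus Q L f) (magnetic_2form Q \<beta>)"

definition omega_minus ::
    "('q, 'e::euclidean_space) atlas \<Rightarrow> ('q \<times> 'q \<Rightarrow> real) \<Rightarrow> ('q \<times> 'q, 'e \<times> 'e) form1 \<Rightarrow>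
     ('q, 'e) form2 \<Rightarrow> ('q \<times> 'q, 'e \<times> 'e) form2" where
  "omega_minus Q L f \<beta> =
     pullback2 (prod_atlas Q Q) (cotangent_bundle Q) (legendre_minus Q L f) (magnetic_2form Q \<beta>)"

end

theory Submission
  imports Defs
begin

text \<open>
  Write \<open>\<gamma> = dL + f\<close>, a one-form on \<open>Q \<times> Q\<close>, and let \<open>\<theta>\<close> be the canonical one-form of the cotangent
  bundle. By definition of the Legendre transforms, the pullback of \<open>\<theta>\<close> along the plus transform is
  \<open>\<gamma>\<close> evaluated on the second component of a tangent vector, and the pullback along the minus
  transform is minus \<open>\<gamma>\<close> evaluated on the first component. Hence the two pullbacks differ by \<open>\<gamma>\<close>
  (\<open>legendre_canonical_difference\<close>).

  The base point of the plus transform is \<open>q\<^sub>1\<close> and that of the minus transform is \<open>q\<^sub>0\<close>. As pullback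
  commutes with the exterior derivative, and \<open>d(dL) = 0\<close>, it follows that
  \<open>\<omega>\<^sup>+ - \<omega>\<^sup>- = - df - (pr\<^sub>2\<^sup>*\<beta> - pr\<^sub>1\<^sup>*\<beta>)\<close>, and this vanishes for systems of Routh type
  (\<open>omega_plus_eq_omega_minus\<close>).

  The trajectory equation says that following a flow map by the minus transform gives the plus transform
  (\<open>legendre_flow\<close>). Therefore every local flow pulls \<open>\<omega>\<^sup>-\<close> back to \<open>\<omega>\<^sup>+\<close>, and since the two
  forms coincide, it preserves both.

  For the forms to be symplectic they must be non-degenerate and closed. In a chart of the cotangent bundle
  the magnetic form is the standard symplectic form plus a term that involves only base components, so it is
  non-degenerate (\<open>nondegenerate2_magnetic\<close>), and regularity transports this to \<open>Q \<times> Q\<close>. Each of the two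
  forms is, up to sign, the sum of an exact form and a pullback of \<open>\<beta>\<close>. The Routh condition forces these
  pullbacks to be closed: the derivatives of \<open>pr\<^sub>1\<^sup>*\<beta>\<close> and \<open>pr\<^sub>2\<^sup>*\<beta>\<close> are equal, but one of them only sees
  the first components of tangent vectors and the other only the second ones
  (\<open>closed2_pullback_difference_imp\<close>).

  Tangent maps and exterior derivatives are computed in a chosen chart at each point, and the chosen charts
  at neighbouring points are unrelated. So every identity that is to be differentiated is first proved for all
  pairs of charts (\<open>tangent_map_chart\<close>, \<open>ext_deriv1_chart\<close>). Chart independence of the exterior derivative is
  the case of the identity map in its compatibility with pullbacks, which in turn rests on the
  symmetry of second derivatives.
\<close>


section \<open>Calculus of smooth maps\<close>

abbreviation der :: "('a::euclidean_space \<Rightarrow> 'b::euclidean_space) \<Rightarrow> 'a \<Rightarrow> 'a \<Rightarrow> 'b" where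
  "der f x \<equiv> frechet_derivative f (at x)"

lemma has_derivative_der: "f differentiable (at x) \<Longrightarrow> (f has_derivative der f x) (at x)"
  by (simp add: frechet_derivative_works)

lemma der_eqI: "(f has_derivative f') (at x) \<Longrightarrow> der f x = f'"
  using frechet_derivative_at by metis

lemma has_derivative_cong_open:
  assumes "open S" "x \<in> S" "\<And>y. y \<in> S \<Longrightarrow> f y = g y"
  shows "(f has_derivative f') (at x) \<longleftrightarrow> (g has_derivative f') (at x)"
  using has_derivative_transform_within_open[of f f' x UNIV S g]
    has_derivative_transform_within_open[of g f' x UNIV S f] assms by auto

lemma differentiable_cong_open:
  assumes "open S" "x \<in> S" "\<And>y. y \<in> S \<Longrightarrow> f y = g y"
  shows "f differentiable (at x) \<longleftrightarrow> g differentiable (at x)"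
  unfolding differentiable_def using has_derivative_cong_open[OF assms] by simp

lemma der_cong_open:
  assumes "open S" "x \<in> S" "\<And>y. y \<in> S \<Longrightarrow> f y = g y"
  shows "der f x = der g x"
  unfolding frechet_derivative_def using has_derivative_cong_open[OF assms] by simp

lemma Ck_on_cong:
  assumes "open S" "\<And>y. y \<in> S \<Longrightarrow> f y = g y"
  shows "Ck_on k S f \<longleftrightarrow> Ck_on k S g"
  using assms(2)
proof (induction k arbitrary: f g)
  case 0
  then show ?case by (simp cong: continuous_on_cong)
next
  case (Suc k)
  have 1: "der f x = der g x" if "x \<in> S" for x
    using der_cong_open[OF assms(1) that] Suc.prems by blast
  have 2: "f differentiable (at x) \<longleftrightarrow> g differentiable (at x)" if "x \<in> S" for x
    using differentiable_cong_open[OF assms(1) that] Suc.prems by blast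
  have "Ck_on k S (\<lambda>x. der f x v) \<longleftrightarrow> Ck_on k S (\<lambda>x. der g x v)" for v
    using 1 by (intro Suc.IH) simp
  then show ?case using 2 by simp
qed

lemma smooth_on_cong:
  assumes "open S" "\<And>y. y \<in> S \<Longrightarrow> f y = g y"
  shows "smooth_on S f \<longleftrightarrow> smooth_on S g"
  using Ck_on_cong[OF assms] by (simp add: smooth_on_def)

lemma Ck_on_subset: "Ck_on k S f \<Longrightarrow> T \<subseteq> S \<Longrightarrow> Ck_on k T f"
  by (induction k arbitrary: f) (auto intro: continuous_on_subset)

lemma smooth_on_subset: "smooth_on S f \<Longrightarrow> T \<subseteq> S \<Longrightarrow> smooth_on T f"
  by (auto simp: smooth_on_def intro: Ck_on_subset)

lemma Ck_on_local:
  assumes "\<And>x. x \<in> S \<Longrightarrow> \<exists>T. open T \<and> x \<in> T \<and> Ck_on k T f"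
  shows "Ck_on k S f"
  using assms
proof (induction k arbitrary: f)
  case 0
  have "continuous (at x) f" if "x \<in> S" for x
    using 0[OF that] continuous_on_eq_continuous_at by auto
  then show ?case by (simp add: continuous_at_imp_continuous_on)
next
  case (Suc k)
  have "f differentiable (at x)" if "x \<in> S" for x
    using Suc.prems[OF that] by auto
  moreover have "Ck_on k S (\<lambda>x. der f x v)" for v
    using Suc.prems by (intro Suc.IH) fastforce
  ultimately show ?case by simp
qed

lemma smooth_on_local:
  assumes "\<And>x. x \<in> S \<Longrightarrow> \<exists>T. open T \<and> x \<in> T \<and> smooth_on T f"
  shows "smooth_on S f"
  using Ck_on_local assms unfolding smooth_on_def by metis

lemma Ck_on_Suc_imp_Ck_on: "Ck_on (Suc k) S f \<Longrightarrow> Ck_on k S f"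
proof (induction k arbitrary: f)
  case 0
  then show ?case
    by (auto intro!: continuous_at_imp_continuous_on differentiable_imp_continuous_within)
next
  case (Suc k)
  then have "Ck_on k S (\<lambda>x. der f x v)" for v by auto
  with Suc.prems show ?case by simp
qed

lemma smooth_on_differentiable: "smooth_on S f \<Longrightarrow> x \<in> S \<Longrightarrow> f differentiable (at x)"
  unfolding smooth_on_def using Ck_on.simps(2) by blast

lemma smooth_on_has_derivative: "smooth_on S f \<Longrightarrow> x \<in> S \<Longrightarrow> (f has_derivative der f x) (at x)"
  by (simp add: has_derivative_der smooth_on_differentiable)

lemma smooth_on_continuous_on: "smooth_on S f \<Longrightarrow> continuous_on S f"
  unfolding smooth_on_def using Ck_on.simps(1) by blast

lemma smooth_on_der: "smooth_on S f \<Longrightarrow> smooth_on S (\<lambda>x. der f x v)"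
  unfolding smooth_on_def using Ck_on.simps(2) by blast

lemma linear_der: "f differentiable (at x) \<Longrightarrow> linear (der f x)"
  by (rule linear_frechet_derivative)

lemma smooth_on_linear_der: "smooth_on S f \<Longrightarrow> x \<in> S \<Longrightarrow> linear (der f x)"
  by (simp add: linear_der smooth_on_differentiable)

lemma Ck_on_const: "Ck_on k S (\<lambda>x. c)"
  by (induction k arbitrary: c) auto

lemma smooth_on_const: "smooth_on S (\<lambda>x. c)"
  by (simp add: smooth_on_def Ck_on_const)

lemma smooth_on_linear:
  fixes f :: "'a::euclidean_space \<Rightarrow> 'b::euclidean_space"
  assumes "linear f"
  shows "smooth_on S f"
proof -
  have d: "(f has_derivative f) (at x)" for x
    using assms by (simp add: bounded_linear_imp_has_derivative linear_conv_bounded_linear)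
  have "Ck_on k S f" for k
  proof (cases k)
    case 0
    then show ?thesis using assms by (simp add: linear_continuous_on linear_conv_bounded_linear)
  next
    case (Suc n)
    have "f differentiable (at x)" for x using d by (auto simp: differentiable_def)
    then show ?thesis using Suc by (simp add: der_eqI[OF d] Ck_on_const)
  qed
  then show ?thesis by (simp add: smooth_on_def)
qed

lemma Ck_on_add:
  assumes "open S" "Ck_on k S f" "Ck_on k S g"
  shows "Ck_on k S (\<lambda>x. f x + g x)"
  using assms(2,3)
proof (induction k arbitrary: f g)
  case 0
  then show ?case by (simp add: continuous_on_add)
next
  case (Suc k)
  have d: "((\<lambda>x. f x + g x) has_derivative (\<lambda>v. der f x v + der g x v)) (at x)" if "x \<in> S" for x
    using Suc.prems that by (intro has_derivative_add has_derivative_der) auto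
  have "Ck_on k S (\<lambda>x. der f x v + der g x v)" for v using Suc by simp
  then have "Ck_on k S (\<lambda>x. der (\<lambda>x. f x + g x) x v)" for v
    by (simp add: der_eqI[OF d] cong: Ck_on_cong[OF assms(1)])
  then show ?case using d by (auto simp: differentiable_def)
qed

lemma Ck_on_scaleR:
  fixes u :: "'a::euclidean_space \<Rightarrow> real"
  assumes "open S" "Ck_on k S u" "Ck_on k S g"
  shows "Ck_on k S (\<lambda>x. u x *\<^sub>R g x)"
  using assms(2,3)
proof (induction k arbitrary: u g)
  case 0
  then show ?case by (simp add: continuous_on_scaleR)
next
  case (Suc k)
  have d: "((\<lambda>x. u x *\<^sub>R g x) has_derivative (\<lambda>v. u x *\<^sub>R der g x v + der u x v *\<^sub>R g x)) (at x)"
    if "x \<in> S" for x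
    using Suc.prems that by (intro has_derivative_scaleR has_derivative_der) auto
  have "Ck_on k S (\<lambda>x. u x *\<^sub>R der g x v + der u x v *\<^sub>R g x)" for v
    using Ck_on_Suc_imp_Ck_on[OF Suc.prems(1)] Ck_on_Suc_imp_Ck_on[OF Suc.prems(2)] Suc.prems
    by (intro Ck_on_add[OF assms(1)] Suc.IH) auto
  then have "Ck_on k S (\<lambda>x. der (\<lambda>x. u x *\<^sub>R g x) x v)" for v
    by (simp add: der_eqI[OF d] cong: Ck_on_cong[OF assms(1)])
  then show ?case using d by (auto simp: differentiable_def)
qed

lemma Ck_on_sum:
  assumes "open S" "\<And>i. i \<in> I \<Longrightarrow> Ck_on k S (f i)"
  shows "Ck_on k S (\<lambda>x. \<Sum>i\<in>I. f i x)"
  using assms(2)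
  by (induction I rule: infinite_finite_induct) (auto intro!: Ck_on_const Ck_on_add[OF assms(1)])

lemma smooth_on_add: "open S \<Longrightarrow> smooth_on S f \<Longrightarrow> smooth_on S g \<Longrightarrow> smooth_on S (\<lambda>x. f x + g x)"
  by (simp add: smooth_on_def Ck_on_add)

lemma smooth_on_scaleR:
  fixes u :: "'a::euclidean_space \<Rightarrow> real"
  shows "open S \<Longrightarrow> smooth_on S u \<Longrightarrow> smooth_on S g \<Longrightarrow> smooth_on S (\<lambda>x. u x *\<^sub>R g x)"
  by (simp add: smooth_on_def Ck_on_scaleR)

lemma smooth_on_mult:
  fixes u :: "'a::euclidean_space \<Rightarrow> real"
  shows "open S \<Longrightarrow> smooth_on S u \<Longrightarrow> smooth_on S g \<Longrightarrow> smooth_on S (\<lambda>x. u x * g x)"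
  using smooth_on_scaleR[of S u g] by simp

lemma smooth_on_sum:
  "open S \<Longrightarrow> (\<And>i. i \<in> I \<Longrightarrow> smooth_on S (f i)) \<Longrightarrow> smooth_on S (\<lambda>x. \<Sum>i\<in>I. f i x)"
  by (simp add: smooth_on_def Ck_on_sum)

lemma linear_sum_Basis:
  fixes h :: "'a::euclidean_space \<Rightarrow> 'b::real_vector"
  assumes "linear h"
  shows "h v = (\<Sum>b\<in>Basis. (v \<bullet> b) *\<^sub>R h b)"
proof -
  have "h v = h (\<Sum>b\<in>Basis. (v \<bullet> b) *\<^sub>R b)" by (simp add: euclidean_representation)
  then show ?thesis using assms by (simp add: linear_sum linear_cmul)
qed

text \<open>
  The chain rule alone does not fit the recursion of \<open>Ck_on\<close>, since in \<open>der g (f x) (der f x v)\<close> the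
  direction varies with \<open>x\<close>. Expanding that direction in the standard basis leaves derivatives of \<open>g\<close> in
  fixed directions, multiplied by components of \<open>der f x v\<close>. The induction then closes by the product rule.
\<close>

lemma Ck_on_compose:
  fixes f :: "'a::euclidean_space \<Rightarrow> 'b::euclidean_space" and g :: "'b \<Rightarrow> 'c::euclidean_space"
  assumes "open S" "open T" "f ` S \<subseteq> T" "smooth_on S f" "Ck_on k T g"
  shows "Ck_on k S (\<lambda>x. g (f x))"
  using assms(5)
proof (induction k arbitrary: g)
  case 0
  then show ?case using assms smooth_on_continuous_on
    by (metis Ck_on.simps(1) continuous_on_compose2)
next
  case (Suc k)
  have d: "((\<lambda>x. g (f x)) has_derivative (\<lambda>v. der g (f x) (der f x v))) (at x)" if "x \<in> S" for x
  proof -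
    have "g differentiable (at (f x))" using Suc.prems that assms(3) by auto
    then show ?thesis
      using diff_chain_at[OF smooth_on_has_derivative[OF assms(4) that] has_derivative_der]
      by (simp add: o_def)
  qed
  have eq: "der g (f x) (der f x v) = (\<Sum>b\<in>Basis. (der f x v \<bullet> b) *\<^sub>R der g (f x) b)"
    if "x \<in> S" for x v
    using Suc.prems that assms(3) by (intro linear_sum_Basis linear_der) auto
  have "Ck_on k S (\<lambda>x. \<Sum>b\<in>Basis. (der f x v \<bullet> b) *\<^sub>R der g (f x) b)" for v
  proof (intro Ck_on_sum Ck_on_scaleR assms(1))
    fix b :: 'b
    show "Ck_on k S (\<lambda>x. der g (f x) b)"
      using Suc.prems by (intro Suc.IH[where g = "\<lambda>y. der g y b"]) simp
    have "smooth_on S (\<lambda>x. der f x v)" using assms(4) by (rule smooth_on_der)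
    moreover have "Ck_on j S (\<lambda>x. h x \<bullet> b)" if "Ck_on j S h" for j and h :: "'a \<Rightarrow> 'b"
      using that
    proof (induction j arbitrary: h)
      case 0
      then show ?case by (auto intro: continuous_intros)
    next
      case (Suc j)
      have d: "((\<lambda>x. h x \<bullet> b) has_derivative (\<lambda>v. der h x v \<bullet> b)) (at x)" if "x \<in> S" for x
        using Suc.prems that by (intro has_derivative_inner_left has_derivative_der) auto
      have "Ck_on j S (\<lambda>x. der (\<lambda>x. h x \<bullet> b) x v)" for v
        using Suc by (simp add: der_eqI[OF d] cong: Ck_on_cong[OF assms(1)])
      then show ?case using d by (auto simp: differentiable_def)
    qed
    ultimately show "Ck_on k S (\<lambda>x. der f x v \<bullet> b)" by (simp add: smooth_on_def)
  qed
  then have "Ck_on k S (\<lambda>x. der (\<lambda>x. g (f x)) x v)" for v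
    by (simp add: der_eqI[OF d] eq cong: Ck_on_cong[OF assms(1)])
  then show ?case using d by (auto simp: differentiable_def)
qed

lemma smooth_on_compose:
  assumes "open S" "open T" "f ` S \<subseteq> T" "smooth_on S f" "smooth_on T g"
  shows "smooth_on S (\<lambda>x. g (f x))"
  using assms(5) by (auto simp: smooth_on_def intro!: Ck_on_compose[OF assms(1-4)])

lemma smooth_on_linear_compose:
  fixes h :: "'b::euclidean_space \<Rightarrow> 'c::euclidean_space"
  assumes "open S" "linear h" "smooth_on S f"
  shows "smooth_on S (\<lambda>x. h (f x))"
  using smooth_on_compose[OF assms(1) open_UNIV _ assms(3) smooth_on_linear[OF assms(2)]] by simp

lemma smooth_on_inner:
  "open S \<Longrightarrow> smooth_on S f \<Longrightarrow> smooth_on S g \<Longrightarrow> smooth_on S (\<lambda>x. f x \<bullet> g x)"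
proof -
  assume a: "open S" "smooth_on S f" "smooth_on S g"
  have i: "linear (\<lambda>y. y \<bullet> (b::'b))" for b by (simp add: bounded_linear.linear bounded_linear_inner_left)
  have "smooth_on S (\<lambda>x. \<Sum>b\<in>Basis. (f x \<bullet> b) * (g x \<bullet> b))"
    using a by (intro smooth_on_sum smooth_on_mult smooth_on_linear_compose[OF _ i])
  then show ?thesis by (simp add: euclidean_inner[symmetric])
qed

lemma smooth_on_diff:
  assumes "open S" "smooth_on S f" "smooth_on S g"
  shows "smooth_on S (\<lambda>x. f x - g x)"
proof -
  have "linear (\<lambda>y::'b. - y)" by (simp add: bounded_linear.linear bounded_linear_minus)
  from smooth_on_add[OF assms(1,2) smooth_on_linear_compose[OF assms(1) this assms(3)]]
  show ?thesis by simp
qed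

lemma smooth_on_Pair:
  fixes f :: "'a::euclidean_space \<Rightarrow> 'b::euclidean_space" and g :: "'a \<Rightarrow> 'c::euclidean_space"
  assumes "open S" "smooth_on S f" "smooth_on S g"
  shows "smooth_on S (\<lambda>x. (f x, g x))"
proof -
  have 1: "linear (\<lambda>y::'b. (y, 0::'c))" by (simp add: linear_iff)
  have 2: "linear (\<lambda>y::'c. (0::'b, y))" by (simp add: linear_iff)
  from smooth_on_add[OF assms(1) smooth_on_linear_compose[OF assms(1) 1 assms(2)]
      smooth_on_linear_compose[OF assms(1) 2 assms(3)]]
  show ?thesis by simp
qed

lemma smooth_on_fst: "smooth_on S fst" and smooth_on_snd: "smooth_on S snd"
  by (auto intro!: smooth_on_linear linear_fst linear_snd)


section \<open>Symmetry of second derivatives\<close>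

text \<open>
  The left-hand side is \<open>h\<close> summed with alternating signs over the vertices of a parallelogram. It is the
  increment of \<open>y \<mapsto> h (y + s b) - h y\<close> along \<open>s a\<close>. One mean value theorem in the direction \<open>a\<close> and a second
  one in the direction \<open>b\<close> turn it into a mixed second derivative at an intermediate point.
\<close>

lemma second_difference_mean_value:
  fixes h :: "'a::euclidean_space \<Rightarrow> real"
  assumes "s > 0"
    and A: "\<And>\<sigma> \<tau>. 0 \<le> \<sigma> \<Longrightarrow> \<sigma> \<le> s \<Longrightarrow> 0 \<le> \<tau> \<Longrightarrow> \<tau> \<le> s \<Longrightarrow> x + \<sigma> *\<^sub>R a + \<tau> *\<^sub>R b \<in> S"
    and h: "\<And>y. y \<in> S \<Longrightarrow> h differentiable (at y)"
    and ha: "\<And>y. y \<in> S \<Longrightarrow> (\<lambda>y. der h y a) differentiable (at y)"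
  shows "\<exists>\<sigma> \<tau>. 0 < \<sigma> \<and> \<sigma> < s \<and> 0 < \<tau> \<and> \<tau> < s \<and>
    h (x + s *\<^sub>R a + s *\<^sub>R b) - h (x + s *\<^sub>R a) - h (x + s *\<^sub>R b) + h x =
      s * s * der (\<lambda>y. der h y a) (x + \<sigma> *\<^sub>R a + \<tau> *\<^sub>R b) b"
proof -
  have d1: "((\<lambda>\<sigma>. h (x + \<sigma> *\<^sub>R a + t *\<^sub>R b)) has_derivative
      (\<lambda>r. der h (x + \<sigma> *\<^sub>R a + t *\<^sub>R b) (r *\<^sub>R a))) (at \<sigma>)"
    if "0 \<le> \<sigma>" "\<sigma> \<le> s" "0 \<le> t" "t \<le> s" for \<sigma> t
  proof -
    have "((\<lambda>\<sigma>. x + \<sigma> *\<^sub>R a + t *\<^sub>R b) has_derivative (\<lambda>r. r *\<^sub>R a)) (at \<sigma>)"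
      by (auto intro!: derivative_eq_intros)
    from diff_chain_at[OF this has_derivative_der[OF h[OF A[OF that]]]]
    show ?thesis by (simp add: o_def)
  qed
  have "\<exists>\<sigma>\<in>{0<..<s}. (h (x + s *\<^sub>R a + s *\<^sub>R b) - h (x + s *\<^sub>R a + 0 *\<^sub>R b)) -
      (h (x + 0 *\<^sub>R a + s *\<^sub>R b) - h (x + 0 *\<^sub>R a + 0 *\<^sub>R b)) =
      der h (x + \<sigma> *\<^sub>R a + s *\<^sub>R b) ((s - 0) *\<^sub>R a) - der h (x + \<sigma> *\<^sub>R a + 0 *\<^sub>R b) ((s - 0) *\<^sub>R a)"
    using \<open>s > 0\<close>
    by (intro mvt_simple[where f = "\<lambda>\<sigma>. h (x + \<sigma> *\<^sub>R a + s *\<^sub>R b) - h (x + \<sigma> *\<^sub>R a + 0 *\<^sub>R b)"]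
        has_derivative_diff has_derivative_at_withinI[OF d1]) auto
  then obtain \<sigma> where \<sigma>: "0 < \<sigma>" "\<sigma> < s"
    "h (x + s *\<^sub>R a + s *\<^sub>R b) - h (x + s *\<^sub>R a) - h (x + s *\<^sub>R b) + h x =
      der h (x + \<sigma> *\<^sub>R a + s *\<^sub>R b) (s *\<^sub>R a) - der h (x + \<sigma> *\<^sub>R a) (s *\<^sub>R a)"
    by auto
  have "x + \<sigma> *\<^sub>R a + s *\<^sub>R b \<in> S" "x + \<sigma> *\<^sub>R a \<in> S" using A[of \<sigma> s] A[of \<sigma> 0] \<sigma> \<open>s > 0\<close> by auto
  then have l: "der h (x + \<sigma> *\<^sub>R a + s *\<^sub>R b) (s *\<^sub>R a) = s * der h (x + \<sigma> *\<^sub>R a + s *\<^sub>R b) a"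
    "der h (x + \<sigma> *\<^sub>R a) (s *\<^sub>R a) = s * der h (x + \<sigma> *\<^sub>R a) a"
    using linear_der[OF h] by (simp_all add: linear_cmul)
  have d2: "((\<lambda>\<tau>. der h (x + \<sigma> *\<^sub>R a + \<tau> *\<^sub>R b) a) has_derivative
      (\<lambda>r. der (\<lambda>y. der h y a) (x + \<sigma> *\<^sub>R a + t *\<^sub>R b) (r *\<^sub>R b))) (at t)"
    if "0 \<le> t" "t \<le> s" for t
  proof -
    have "((\<lambda>\<tau>. x + \<sigma> *\<^sub>R a + \<tau> *\<^sub>R b) has_derivative (\<lambda>r. r *\<^sub>R b)) (at t)"
      by (auto intro!: derivative_eq_intros)
    from diff_chain_at[OF this has_derivative_der[OF ha[OF A[OF _ _ that]]]] \<sigma>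
    show ?thesis by (simp add: o_def)
  qed
  have "\<exists>\<tau>\<in>{0<..<s}. der h (x + \<sigma> *\<^sub>R a + s *\<^sub>R b) a - der h (x + \<sigma> *\<^sub>R a + 0 *\<^sub>R b) a =
      der (\<lambda>y. der h y a) (x + \<sigma> *\<^sub>R a + \<tau> *\<^sub>R b) ((s - 0) *\<^sub>R b)"
    using \<open>s > 0\<close>
    by (intro mvt_simple[where f = "\<lambda>\<tau>. der h (x + \<sigma> *\<^sub>R a + \<tau> *\<^sub>R b) a"]
        has_derivative_at_withinI[OF d2]) auto
  then obtain \<tau> where \<tau>: "0 < \<tau>" "\<tau> < s" "der h (x + \<sigma> *\<^sub>R a + s *\<^sub>R b) a - der h (x + \<sigma> *\<^sub>R a) a =
      der (\<lambda>y. der h y a) (x + \<sigma> *\<^sub>R a + \<tau> *\<^sub>R b) (s *\<^sub>R b)"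
    by auto
  have "x + \<sigma> *\<^sub>R a + \<tau> *\<^sub>R b \<in> S" using A \<sigma> \<tau> by auto
  then have "der (\<lambda>y. der h y a) (x + \<sigma> *\<^sub>R a + \<tau> *\<^sub>R b) (s *\<^sub>R b) =
      s * der (\<lambda>y. der h y a) (x + \<sigma> *\<^sub>R a + \<tau> *\<^sub>R b) b"
    using linear_der[OF ha] by (simp add: linear_cmul)
  then have "der h (x + \<sigma> *\<^sub>R a + s *\<^sub>R b) a - der h (x + \<sigma> *\<^sub>R a) a =
      s * der (\<lambda>y. der h y a) (x + \<sigma> *\<^sub>R a + \<tau> *\<^sub>R b) b"
    using \<tau>(3) by simp
  then have "der h (x + \<sigma> *\<^sub>R a + s *\<^sub>R b) (s *\<^sub>R a) - der h (x + \<sigma> *\<^sub>R a) (s *\<^sub>R a) =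
      s * s * der (\<lambda>y. der h y a) (x + \<sigma> *\<^sub>R a + \<tau> *\<^sub>R b) b"
    unfolding l by (simp add: right_diff_distrib[symmetric])
  then show ?thesis using \<sigma> \<tau>(1,2) by (intro exI[of _ \<sigma>] exI[of _ \<tau>]) simp
qed

text \<open>
  The alternating sum over the vertices of a small parallelogram does not change when its two edges are
  exchanged. Hence the two mixed derivatives take a common value at points arbitrarily near \<open>x\<close> (though not
  at the same points), and their continuity makes them agree at \<open>x\<close>.
\<close>

lemma symmetric_second_derivative_real:
  fixes h :: "'a::euclidean_space \<Rightarrow> real"
  assumes "open S" "x \<in> S" "smooth_on S h"
  shows "der (\<lambda>y. der h y a) x b = der (\<lambda>y. der h y b) x a"
proof (rule ccontr)
  define F where "F = (\<lambda>y. der (\<lambda>y. der h y a) y b)"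
  define G where "G = (\<lambda>y. der (\<lambda>y. der h y b) y a)"
  assume "der (\<lambda>y. der h y a) x b \<noteq> der (\<lambda>y. der h y b) x a"
  then have pos: "\<bar>F x - G x\<bar> / 2 > 0" by (simp add: F_def G_def)
  have sm: "smooth_on S F" "smooth_on S G"
    unfolding F_def G_def using assms(3) by (auto intro!: smooth_on_der)
  then have "isCont F x" "isCont G x"
    using assms smooth_on_continuous_on continuous_on_eq_continuous_at by blast+
  then obtain e1 e2 where e: "e1 > 0" "\<And>y. dist y x < e1 \<Longrightarrow> dist (F y) (F x) < \<bar>F x - G x\<bar> / 2"
    "e2 > 0" "\<And>y. dist y x < e2 \<Longrightarrow> dist (G y) (G x) < \<bar>F x - G x\<bar> / 2"
    using pos unfolding continuous_at_eps_delta by metis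
  obtain e3 where e3: "e3 > 0" "ball x e3 \<subseteq> S" using assms open_contains_ball by blast
  define e where "e = min e1 (min e2 e3)"
  have "e > 0" using e e3 by (simp add: e_def)
  \<comment> \<open>a size for which the parallelogram with edges \<open>s a\<close> and \<open>s b\<close> stays within distance \<open>e\<close> of \<open>x\<close>; the summand \<open>1\<close> covers \<open>a = b = 0\<close>\<close>
  define s where "s = e / (2 * (norm a + norm b + 1))"
  have N: "norm a + norm b + 1 > 0" by (smt (verit) norm_ge_zero)
  then have "s > 0" using \<open>e > 0\<close> by (simp add: s_def)
  have halve: "e / (2 * M) * M = e / 2" if "M > 0" for M :: real using that by simp
  have small: "dist (x + \<sigma> *\<^sub>R a + \<tau> *\<^sub>R b) x < e" if "0 \<le> \<sigma>" "\<sigma> \<le> s" "0 \<le> \<tau>" "\<tau> \<le> s" for \<sigma> \<tau>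
  proof -
    have "dist (x + \<sigma> *\<^sub>R a + \<tau> *\<^sub>R b) x \<le> norm (\<sigma> *\<^sub>R a) + norm (\<tau> *\<^sub>R b)"
      by (simp add: dist_norm) (metis norm_triangle_ineq norm_scaleR)
    also have "\<dots> \<le> s * norm a + s * norm b"
      using that by (simp add: add_mono mult_right_mono)
    also have "\<dots> \<le> s * (norm a + norm b + 1)" using \<open>s > 0\<close> by (simp add: algebra_simps)
    also have "\<dots> = e / 2" unfolding s_def using N by (rule halve)
    finally show ?thesis using \<open>e > 0\<close> by simp
  qed
  have inS: "x + \<sigma> *\<^sub>R a + \<tau> *\<^sub>R b \<in> S" if "0 \<le> \<sigma>" "\<sigma> \<le> s" "0 \<le> \<tau>" "\<tau> \<le> s" for \<sigma> \<tau>
    using small[OF that] e3 by (auto simp: e_def dist_commute subset_eq)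
  have inS': "x + \<sigma> *\<^sub>R b + \<tau> *\<^sub>R a \<in> S" if "0 \<le> \<sigma>" "\<sigma> \<le> s" "0 \<le> \<tau>" "\<tau> \<le> s" for \<sigma> \<tau>
    using inS[of \<tau> \<sigma>] that by (simp add: algebra_simps)
  have dif: "h differentiable (at y)" "(\<lambda>y. der h y v) differentiable (at y)" if "y \<in> S" for y v
    using assms(3) that smooth_on_differentiable smooth_on_der by blast+
  have "\<exists>\<sigma> \<tau>. 0 < \<sigma> \<and> \<sigma> < s \<and> 0 < \<tau> \<and> \<tau> < s \<and>
    h (x + s *\<^sub>R a + s *\<^sub>R b) - h (x + s *\<^sub>R a) - h (x + s *\<^sub>R b) + h x =
      s * s * F (x + \<sigma> *\<^sub>R a + \<tau> *\<^sub>R b)"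
    unfolding F_def
    by (rule second_difference_mean_value[OF \<open>s > 0\<close>, where S = S]) (use inS dif in auto)
  then obtain \<sigma> \<tau> where 1: "0 < \<sigma>" "\<sigma> < s" "0 < \<tau>" "\<tau> < s"
    "h (x + s *\<^sub>R a + s *\<^sub>R b) - h (x + s *\<^sub>R a) - h (x + s *\<^sub>R b) + h x =
      s * s * F (x + \<sigma> *\<^sub>R a + \<tau> *\<^sub>R b)"
    by blast
  have "\<exists>\<sigma>' \<tau>'. 0 < \<sigma>' \<and> \<sigma>' < s \<and> 0 < \<tau>' \<and> \<tau>' < s \<and>
    h (x + s *\<^sub>R b + s *\<^sub>R a) - h (x + s *\<^sub>R b) - h (x + s *\<^sub>R a) + h x =
      s * s * G (x + \<sigma>' *\<^sub>R b + \<tau>' *\<^sub>R a)"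
    unfolding G_def
    by (rule second_difference_mean_value[OF \<open>s > 0\<close>, where S = S]) (use inS' dif in auto)
  then obtain \<sigma>' \<tau>' where 2: "0 < \<sigma>'" "\<sigma>' < s" "0 < \<tau>'" "\<tau>' < s"
    "h (x + s *\<^sub>R b + s *\<^sub>R a) - h (x + s *\<^sub>R b) - h (x + s *\<^sub>R a) + h x =
      s * s * G (x + \<sigma>' *\<^sub>R b + \<tau>' *\<^sub>R a)"
    by blast
  have sw: "x + s *\<^sub>R b + s *\<^sub>R a = x + s *\<^sub>R a + s *\<^sub>R b" by (simp add: algebra_simps)
  have "s * s * F (x + \<sigma> *\<^sub>R a + \<tau> *\<^sub>R b) = s * s * G (x + \<sigma>' *\<^sub>R b + \<tau>' *\<^sub>R a)"
    using 1(5) 2(5) unfolding sw by linarith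
  then have FG: "F (x + \<sigma> *\<^sub>R a + \<tau> *\<^sub>R b) = G (x + \<tau>' *\<^sub>R a + \<sigma>' *\<^sub>R b)"
    using \<open>s > 0\<close> by (simp add: algebra_simps)
  have "dist (F (x + \<sigma> *\<^sub>R a + \<tau> *\<^sub>R b)) (F x) < \<bar>F x - G x\<bar> / 2"
    using e(2) small[of \<sigma> \<tau>] 1 by (simp add: e_def)
  moreover have "dist (G (x + \<tau>' *\<^sub>R a + \<sigma>' *\<^sub>R b)) (G x) < \<bar>F x - G x\<bar> / 2"
    using e(4) small[of \<tau>' \<sigma>'] 2 by (simp add: e_def)
  ultimately show False using FG by (auto simp: dist_real_def field_simps abs_if split: if_splits)
qed

lemma der_inner:
  assumes "f differentiable (at x)"
  shows "der (\<lambda>y. f y \<bullet> c) x v = der f x v \<bullet> c"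
  by (simp add: der_eqI[OF has_derivative_inner_left[OF has_derivative_der[OF assms]]])

lemma symmetric_second_derivative:
  assumes "open S" "x \<in> S" "smooth_on S f"
  shows "der (\<lambda>y. der f y a) x b = der (\<lambda>y. der f y b) x a"
proof (rule euclidean_eqI)
  fix i :: 'b
  have l: "linear (\<lambda>y::'b. y \<bullet> i)" by (simp add: bounded_linear.linear bounded_linear_inner_left)
  have "der (\<lambda>y. der f y a) x b \<bullet> i = der (\<lambda>y. der f y a \<bullet> i) x b" for a b
    by (intro der_inner[symmetric] smooth_on_differentiable[OF smooth_on_der[OF assms(3)] assms(2)])
  moreover have "der (\<lambda>y. der f y a \<bullet> i) x = der (\<lambda>y. der (\<lambda>y. f y \<bullet> i) y a) x" for a
    by (intro der_cong_open[OF assms(1,2)] der_inner[symmetric] smooth_on_differentiable[OF assms(3)])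
  ultimately show "der (\<lambda>y. der f y a) x b \<bullet> i = der (\<lambda>y. der f y b) x a \<bullet> i"
    using symmetric_second_derivative_real[OF assms(1,2) smooth_on_linear_compose[OF assms(1) l assms(3)]]
    by simp
qed

lemma der_compose:
  assumes "f differentiable (at x)" "g differentiable (at (f x))"
  shows "der (\<lambda>x. g (f x)) x v = der g (f x) (der f x v)"
  using frechet_derivative_compose[OF assms] by (simp add: o_def fun_eq_iff)


section \<open>Smooth maps in charts\<close>

lemma chart_inv_chart:
  "smooth_atlas A \<Longrightarrow> c \<in> A \<Longrightarrow> p \<in> fst c \<Longrightarrow> chart_inv c (snd c p) = p"
  by (simp add: smooth_atlas_def chart_inv_def)

lemma chart_chart_inv: "x \<in> snd c ` fst c \<Longrightarrow> snd c (chart_inv c x) = x"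
  by (simp add: chart_inv_def f_inv_into_f)

lemma chart_inv_in: "x \<in> snd c ` fst c \<Longrightarrow> chart_inv c x \<in> fst c"
  by (simp add: chart_inv_def inv_into_into)

lemma open_chart_image: "smooth_atlas A \<Longrightarrow> c \<in> A \<Longrightarrow> open (snd c ` fst c)"
  by (simp add: smooth_atlas_def)

lemma points_chart: "c \<in> A \<Longrightarrow> p \<in> fst c \<Longrightarrow> p \<in> points A"
  by (auto simp: points_def)

lemma chart_at_mem: "p \<in> points A \<Longrightarrow> chart_at A p \<in> A \<and> p \<in> fst (chart_at A p)"
  unfolding chart_at_def points_def by (rule someI_ex) auto

lemma transition_open: "smooth_atlas A \<Longrightarrow> c \<in> A \<Longrightarrow> d \<in> A \<Longrightarrow> open (snd c ` (fst c \<inter> fst d))"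
  and transition_smooth: "smooth_atlas A \<Longrightarrow> c \<in> A \<Longrightarrow> d \<in> A \<Longrightarrow>
    smooth_on (snd c ` (fst c \<inter> fst d)) (\<lambda>x. snd d (chart_inv c x))"
  by (auto simp: smooth_atlas_def o_def)

text \<open>
  Smoothness on a neighbourhood of \<open>p\<close>, demanded for all pairs of charts around \<open>p\<close> and \<open>f p\<close>, so that
  any convenient charts may be used; \<open>smooth_atI\<close> shows that one pair suffices.
\<close>

definition smooth_at ::
    "('p, 'e::euclidean_space) atlas \<Rightarrow> ('q, 'f::euclidean_space) atlas \<Rightarrow> ('p \<Rightarrow> 'q) \<Rightarrow> 'p \<Rightarrow> bool"
  where
  "smooth_at A B f p \<longleftrightarrow> p \<in> points A \<and> f p \<in> points B \<and>
     (\<forall>c\<in>A. \<forall>d\<in>B. p \<in> fst c \<and> f p \<in> fst d \<longrightarrow>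
        (\<exists>S. open S \<and> snd c p \<in> S \<and> S \<subseteq> snd c ` fst c \<and>
           (\<forall>x\<in>S. f (chart_inv c x) \<in> fst d) \<and> smooth_on S (\<lambda>x. snd d (f (chart_inv c x)))))"

lemma open_preimage:
  "open S \<Longrightarrow> continuous_on S g \<Longrightarrow> open T \<Longrightarrow> open {x \<in> S. g x \<in> T}"
  using continuous_open_preimage[of S g T] by (simp add: vimage_def Int_def)

text \<open>
  In another pair of charts, the coordinate expression of \<open>f\<close> is the given one composed with two coordinate
  changes, on the part of the domain where all three maps can be composed.
\<close>

lemma smooth_atI:
  assumes A: "smooth_atlas A" and B: "smooth_atlas B"
    and c: "c \<in> A" "p \<in> fst c" and d: "d \<in> B"
    and S: "open S" "snd c p \<in> S" "S \<subseteq> snd c ` fst c" "\<And>x. x \<in> S \<Longrightarrow> f (chart_inv c x) \<in> fst d"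
    and sm: "smooth_on S (\<lambda>x. snd d (f (chart_inv c x)))"
  shows "smooth_at A B f p"
  unfolding smooth_at_def
proof (intro conjI ballI impI)
  have fp: "f p \<in> fst d" using S(4)[OF S(2)] chart_inv_chart[OF A c] by simp
  show "p \<in> points A" using c by (rule points_chart)
  show "f p \<in> points B" using d fp by (rule points_chart)
  fix c' d'
  assume c': "c' \<in> A" and d': "d' \<in> B" and "p \<in> fst c' \<and> f p \<in> fst d'"
  then have p: "p \<in> fst c'" "f p \<in> fst d'" by auto
  define \<tau> where "\<tau> = (\<lambda>x. snd c (chart_inv c' x))"
  define \<phi> where "\<phi> = (\<lambda>x. snd d (f (chart_inv c x)))"
  \<comment> \<open>first the points that \<open>f\<close> maps into the new target chart, then their coordinates in the new source chart\<close>
  define S2 where "S2 = {y \<in> S. \<phi> y \<in> snd d ` (fst d \<inter> fst d')}"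
  define S' where "S' = {x \<in> snd c' ` (fst c' \<inter> fst c). \<tau> x \<in> S2}"
  have \<tau>: "smooth_on (snd c' ` (fst c' \<inter> fst c)) \<tau>"
    unfolding \<tau>_def by (rule transition_smooth[OF A c' c(1)])
  have \<phi>: "smooth_on S \<phi>" using sm by (simp add: \<phi>_def)
  have o2: "open S2"
    unfolding S2_def
    by (intro open_preimage S(1) smooth_on_continuous_on \<phi> transition_open[OF B d d'])
  have o': "open S'"
    unfolding S'_def
    by (intro open_preimage smooth_on_continuous_on \<tau> transition_open[OF A c' c(1)] o2)
  have inv: "chart_inv c' x \<in> fst c" "chart_inv c (\<tau> x) = chart_inv c' x"
    if x: "x \<in> snd c' ` (fst c' \<inter> fst c)" for x
    using x chart_inv_chart[OF A c'] chart_inv_chart[OF A c(1)] by (auto simp: \<tau>_def)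
  have inv2: "f (chart_inv c y) \<in> fst d'" "chart_inv d (\<phi> y) = f (chart_inv c y)"
    if y: "y \<in> S2" for y
  proof -
    from y obtain q where q: "q \<in> fst d" "q \<in> fst d'" "\<phi> y = snd d q" "y \<in> S"
      by (auto simp: S2_def)
    have "f (chart_inv c y) \<in> fst d" using S(4) q by blast
    then have "f (chart_inv c y) = q"
      using q chart_inv_chart[OF B d] by (metis \<phi>_def)
    then show "f (chart_inv c y) \<in> fst d'" "chart_inv d (\<phi> y) = f (chart_inv c y)"
      using q chart_inv_chart[OF B d] by auto
  qed
  have "snd c' p \<in> S'"
    using c c' p S(2) fp chart_inv_chart[OF A c] chart_inv_chart[OF A c' p(1)]
    by (auto simp: S'_def S2_def \<tau>_def \<phi>_def)
  moreover have "S' \<subseteq> snd c' ` fst c'" by (auto simp: S'_def)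
  moreover have "f (chart_inv c' x) \<in> fst d'" if "x \<in> S'" for x
    using that inv(2)[of x] inv2(1)[of "\<tau> x"] by (auto simp: S'_def)
  moreover have "smooth_on S' (\<lambda>x. snd d' (f (chart_inv c' x)))"
  proof -
    have "smooth_on S' (\<lambda>x. \<phi> (\<tau> x))"
      using smooth_on_subset[OF \<tau>, of S']
      by (intro smooth_on_compose[OF o' S(1) _ _ \<phi>]) (auto simp: S'_def S2_def)
    then have "smooth_on S' (\<lambda>x. snd d' (chart_inv d (\<phi> (\<tau> x))))"
      by (intro smooth_on_compose[OF o' transition_open[OF B d d'] _ _ transition_smooth[OF B d d']])
        (auto simp: S'_def S2_def)
    moreover have "snd d' (chart_inv d (\<phi> (\<tau> x))) = snd d' (f (chart_inv c' x))" if "x \<in> S'" for x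
      using that inv(2)[of x] inv2(2)[of "\<tau> x"] by (auto simp: S'_def)
    ultimately show ?thesis by (simp cong: smooth_on_cong[OF o'])
  qed
  ultimately show "\<exists>S. open S \<and> snd c' p \<in> S \<and> S \<subseteq> snd c' ` fst c' \<and>
      (\<forall>x\<in>S. f (chart_inv c' x) \<in> fst d') \<and> smooth_on S (\<lambda>x. snd d' (f (chart_inv c' x)))"
    using o' by blast
qed

lemma smooth_atE:
  assumes "smooth_at A B f p" "c \<in> A" "p \<in> fst c" "d \<in> B" "f p \<in> fst d"
  obtains S where "open S" "snd c p \<in> S" "S \<subseteq> snd c ` fst c" "\<And>x. x \<in> S \<Longrightarrow> f (chart_inv c x) \<in> fst d"
    "smooth_on S (\<lambda>x. snd d (f (chart_inv c x)))"
proof -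
  from assms have "\<exists>S. open S \<and> snd c p \<in> S \<and> S \<subseteq> snd c ` fst c \<and>
           (\<forall>x\<in>S. f (chart_inv c x) \<in> fst d) \<and> smooth_on S (\<lambda>x. snd d (f (chart_inv c x)))"
    unfolding smooth_at_def by blast
  then show thesis using that by blast
qed

lemma smooth_atD: "smooth_at A B f p \<Longrightarrow> p \<in> points A" "smooth_at A B f p \<Longrightarrow> f p \<in> points B"
  by (auto simp: smooth_at_def)

text \<open>
  Coefficients of pulled back forms have to be known in a whole neighbourhood of a point before they can be
  differentiated there. For this the set \<open>S\<close> consists of points at which \<open>f\<close> is smooth again.
\<close>

lemma smooth_at_nearby:
  assumes A: "smooth_atlas A" and B: "smooth_atlas B" and f: "smooth_at A B f p"
    and c: "c \<in> A" "p \<in> fst c" and d: "d \<in> B" "f p \<in> fst d"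
  obtains S where "open S" "snd c p \<in> S" "S \<subseteq> snd c ` fst c" "\<And>x. x \<in> S \<Longrightarrow> f (chart_inv c x) \<in> fst d"
    "smooth_on S (\<lambda>x. snd d (f (chart_inv c x)))" "\<And>x. x \<in> S \<Longrightarrow> smooth_at A B f (chart_inv c x)"
proof -
  obtain S where S: "open S" "snd c p \<in> S" "S \<subseteq> snd c ` fst c" "\<And>x. x \<in> S \<Longrightarrow> f (chart_inv c x) \<in> fst d"
    "smooth_on S (\<lambda>x. snd d (f (chart_inv c x)))"
    using smooth_atE[OF f c d] by metis
  have "smooth_at A B f (chart_inv c x)" if "x \<in> S" for x
  proof (rule smooth_atI[OF A B c(1) _ d(1) S(1) _ S(3) S(4) S(5)])
    have x: "x \<in> snd c ` fst c" using that S by auto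
    show "chart_inv c x \<in> fst c" using chart_inv_in[OF x] .
    show "snd c (chart_inv c x) \<in> S" using chart_chart_inv[OF x] that by simp
  qed
  then show thesis using S that by blast
qed

lemma smooth_at_ident:
  assumes "smooth_atlas A" "p \<in> points A"
  shows "smooth_at A A (\<lambda>q. q) p"
proof (rule smooth_atI)
  let ?c = "chart_at A p"
  show c: "?c \<in> A" "p \<in> fst ?c" "?c \<in> A" using chart_at_mem[OF assms(2)] by auto
  show o: "open (snd ?c ` fst ?c)" using assms c by (simp add: open_chart_image)
  show "smooth_on (snd ?c ` fst ?c) (\<lambda>x. snd ?c (chart_inv ?c x))"
    by (subst smooth_on_cong[OF o, of _ "\<lambda>x. x"]) (auto simp: chart_chart_inv linear_iff intro!: smooth_on_linear)
  show "smooth_atlas A" "smooth_atlas A" by fact+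
  show "snd ?c p \<in> snd ?c ` fst ?c" using c by simp
qed (auto intro: chart_inv_in)

lemma smooth_at_compose:
  assumes A: "smooth_atlas A" and B: "smooth_atlas B" and C: "smooth_atlas C"
    and f: "smooth_at A B f p" and g: "smooth_at B C g (f p)"
  shows "smooth_at A C (\<lambda>q. g (f q)) p"
proof -
  obtain c d e where c: "c \<in> A" "p \<in> fst c" and d: "d \<in> B" "f p \<in> fst d" and e: "e \<in> C" "g (f p) \<in> fst e"
    using smooth_atD[OF f] smooth_atD[OF g] unfolding points_def by blast
  obtain S where S: "open S" "snd c p \<in> S" "S \<subseteq> snd c ` fst c" "\<And>x. x \<in> S \<Longrightarrow> f (chart_inv c x) \<in> fst d"
    "smooth_on S (\<lambda>x. snd d (f (chart_inv c x)))"
    using smooth_atE[OF f c d] by metis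
  obtain T where T: "open T" "snd d (f p) \<in> T" "T \<subseteq> snd d ` fst d" "\<And>x. x \<in> T \<Longrightarrow> g (chart_inv d x) \<in> fst e"
    "smooth_on T (\<lambda>x. snd e (g (chart_inv d x)))"
    using smooth_atE[OF g d e] by metis
  define S' where "S' = {x \<in> S. snd d (f (chart_inv c x)) \<in> T}"
  have o': "open S'" unfolding S'_def
    by (intro open_preimage S(1) smooth_on_continuous_on S(5) T(1))
  have eq: "chart_inv d (snd d (f (chart_inv c x))) = f (chart_inv c x)" if "x \<in> S'" for x
    using that S(4) chart_inv_chart[OF B d(1)] by (auto simp: S'_def)
  have "smooth_on S' (\<lambda>x. snd e (g (chart_inv d (snd d (f (chart_inv c x))))))"
    using smooth_on_subset[OF S(5), of S']
    by (intro smooth_on_compose[OF o' T(1) _ _ T(5)]) (auto simp: S'_def)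
  then have sm: "smooth_on S' (\<lambda>x. snd e (g (f (chart_inv c x))))"
    by (simp add: eq cong: smooth_on_cong[OF o'])
  show ?thesis
  proof (rule smooth_atI[OF A C c e(1) o' _ _ _ sm])
    show "snd c p \<in> S'" using S(2) T(2) chart_inv_chart[OF A c] by (simp add: S'_def)
    show "S' \<subseteq> snd c ` fst c" using S(3) by (auto simp: S'_def)
    show "g (f (chart_inv c x)) \<in> fst e" if "x \<in> S'" for x
      using T(4)[of "snd d (f (chart_inv c x))"] eq[OF that] that by (auto simp: S'_def)
  qed
qed

lemma smooth_map_imp_smooth_at:
  assumes A: "smooth_atlas A" and B: "smooth_atlas B" and f: "smooth_map A B U f" and p: "p \<in> U"
  shows "smooth_at A B f p"
proof -
  from f p have "\<exists>c\<in>A. \<exists>d\<in>B. \<exists>W. openin (manifold_topology A) W \<and> p \<in> W \<and> W \<subseteq> U \<inter> fst c \<and>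
      f ` W \<subseteq> fst d \<and> smooth_on (snd c ` W) (snd d \<circ> f \<circ> chart_inv c)"
    unfolding smooth_map_def by blast
  then obtain c d W where c: "c \<in> A" and d: "d \<in> B" and W: "openin (manifold_topology A) W" "p \<in> W"
    "W \<subseteq> fst c" "f ` W \<subseteq> fst d" "smooth_on (snd c ` W) (snd d \<circ> f \<circ> chart_inv c)"
    by blast
  have o: "open (snd c ` W)"
    using W(1,3) c unfolding openin_manifold_topology[OF A] by (metis Int_absorb2)
  show ?thesis
  proof (rule smooth_atI[OF A B c _ d o])
    show "p \<in> fst c" "snd c p \<in> snd c ` W" "snd c ` W \<subseteq> snd c ` fst c" using W by auto
    show "f (chart_inv c x) \<in> fst d" if "x \<in> snd c ` W" for x
    proof -
      obtain q where q: "q \<in> W" "x = snd c q" using \<open>x \<in> snd c ` W\<close> by blast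
      then have "chart_inv c x = q" using W(3) chart_inv_chart[OF A c, of q] by auto
      then show ?thesis using W(4) q(1) by auto
    qed
    show "smooth_on (snd c ` W) (\<lambda>x. snd d (f (chart_inv c x)))" using W(5) by (simp add: o_def)
  qed
qed

lemma smooth_at_differentiable:
  assumes "smooth_at A B f p" "c \<in> A" "p \<in> fst c" "d \<in> B" "f p \<in> fst d"
  shows "(\<lambda>x. snd d (f (chart_inv c x))) differentiable (at (snd c p))"
  using smooth_atE[OF assms] smooth_on_differentiable by metis

text \<open>
  The form of the chain rule behind every statement on tangent maps below. Taking the identity for
  \<open>f\<close> or \<open>g\<close> gives the rules for changes of coordinates.
\<close>

lemma local_chain_rule:
  assumes A: "smooth_atlas A" and B: "smooth_atlas B"
    and f: "smooth_at A B f p" and g: "smooth_at B C g (f p)"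
    and c: "c \<in> A" "p \<in> fst c" and d: "d \<in> B" "f p \<in> fst d" and e: "e \<in> C" "g (f p) \<in> fst e"
  shows "der (\<lambda>y. snd e (g (chart_inv d y))) (snd d (f p)) (der (\<lambda>x. snd d (f (chart_inv c x))) (snd c p) a) =
    der (\<lambda>x. snd e (g (f (chart_inv c x)))) (snd c p) a"
proof -
  obtain S where S: "open S" "snd c p \<in> S" "\<And>x. x \<in> S \<Longrightarrow> f (chart_inv c x) \<in> fst d"
    using smooth_atE[OF f c d] by metis
  have 1: "der (\<lambda>x. snd e (g (f (chart_inv c x)))) (snd c p) =
      der (\<lambda>x. snd e (g (chart_inv d (snd d (f (chart_inv c x)))))) (snd c p)"
    using S chart_inv_chart[OF B d(1)] by (intro der_cong_open[of S]) auto
  have "(\<lambda>y. snd e (g (chart_inv d y))) differentiable (at (snd d (f (chart_inv c (snd c p)))))"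
    using smooth_at_differentiable[OF g d e] chart_inv_chart[OF A c] by simp
  from der_compose[OF smooth_at_differentiable[OF f c d] this] show ?thesis
    unfolding 1 by (simp add: chart_inv_chart[OF A c])
qed

lemma linear_transition:
  assumes "smooth_atlas A" "c \<in> A" "p \<in> fst c" "d \<in> A" "p \<in> fst d"
  shows "linear (der (\<lambda>x. snd d (chart_inv c x)) (snd c p))"
  using smooth_at_differentiable[OF smooth_at_ident[OF assms(1) points_chart[OF assms(2,3)]] assms(2,3,4,5)]
  by (rule linear_der)

lemma transition_chain:
  assumes A: "smooth_atlas A" and c: "c \<in> A" "p \<in> fst c" and d: "d \<in> A" "p \<in> fst d"
    and e: "e \<in> A" "p \<in> fst e"
  shows "der (\<lambda>y. snd e (chart_inv d y)) (snd d p) (der (\<lambda>x. snd d (chart_inv c x)) (snd c p) a) =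
    der (\<lambda>x. snd e (chart_inv c x)) (snd c p) a"
proof -
  have p: "p \<in> points A" using c by (rule points_chart)
  show ?thesis by (rule local_chain_rule[OF A A smooth_at_ident[OF A p] smooth_at_ident[OF A p] c d e])
qed

lemma transition_self:
  assumes A: "smooth_atlas A" and c: "c \<in> A" "p \<in> fst c"
  shows "der (\<lambda>x. snd c (chart_inv c x)) (snd c p) a = a"
proof -
  have "der (\<lambda>x. snd c (chart_inv c x)) (snd c p) = der (\<lambda>x. x) (snd c p)"
    using c by (intro der_cong_open[OF open_chart_image[OF A c(1)]]) (auto intro!: chart_chart_inv)
  then show ?thesis by simp
qed


section \<open>Tangent vectors and tangent maps\<close>

lemma tangent_space_change:
  "v \<in> tangent_space A p \<Longrightarrow> c \<in> A \<Longrightarrow> p \<in> fst c \<Longrightarrow> d \<in> A \<Longrightarrow> p \<in> fst d \<Longrightarrow>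
    v d = der (\<lambda>x. snd d (chart_inv c x)) (snd c p) (v c)"
  unfolding tangent_space_def o_def by blast

lemma tangent_space_outside: "v \<in> tangent_space A p \<Longrightarrow> \<not> (c \<in> A \<and> p \<in> fst c) \<Longrightarrow> v c = 0"
  unfolding tangent_space_def by blast

lemma tangent_space_combination:
  assumes A: "smooth_atlas A" and u: "u \<in> tangent_space A p" and v: "v \<in> tangent_space A p"
  shows "(\<lambda>c. r *\<^sub>R u c + s *\<^sub>R v c) \<in> tangent_space A p"
proof -
  have "der (\<lambda>x. snd d (chart_inv c x)) (snd c p) (r *\<^sub>R u c + s *\<^sub>R v c) = r *\<^sub>R u d + s *\<^sub>R v d"
    if "c \<in> A" "d \<in> A" "p \<in> fst c" "p \<in> fst d" for c d
    using linear_transition[OF A that(1,3,2,4)] tangent_space_change[OF u that(1,3,2,4)]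
      tangent_space_change[OF v that(1,3,2,4)]
    by (simp add: linear_add linear_cmul)
  then show ?thesis
    using tangent_space_outside[OF u] tangent_space_outside[OF v]
    unfolding tangent_space_def by (auto simp: o_def)
qed

lemma zero_tvec_in:
  assumes A: "smooth_atlas A"
  shows "zero_tvec \<in> tangent_space A p"
proof -
  have "der (\<lambda>x. snd d (chart_inv c x)) (snd c p) 0 = 0"
    if "c \<in> A" "p \<in> fst c" "d \<in> A" "p \<in> fst d" for c d
    using linear_transition[OF A that] by (rule linear_0)
  then show ?thesis unfolding tangent_space_def zero_tvec_def o_def by force
qed

lemma coord_vec_in:
  assumes A: "smooth_atlas A" and c: "c \<in> A" "p \<in> fst c"
  shows "coord_vec A c p a \<in> tangent_space A p"
  using transition_chain[OF A c] by (auto simp: tangent_space_def coord_vec_def o_def)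

lemma coord_vec_chart:
  "e \<in> A \<Longrightarrow> p \<in> fst e \<Longrightarrow>
    coord_vec A c p a e = der (\<lambda>x. snd e (chart_inv c x)) (snd c p) a"
  by (simp add: coord_vec_def o_def)

lemma coord_vec_self:
  assumes "smooth_atlas A" "c \<in> A" "p \<in> fst c"
  shows "coord_vec A c p a c = a"
  using transition_self[OF assms] assms by (simp add: coord_vec_def o_def)

lemma tangent_eq_coord_vec:
  assumes c: "c \<in> A" "p \<in> fst c" and u: "u \<in> tangent_space A p"
  shows "u = coord_vec A c p (u c)"
  using tangent_space_change[OF u c] tangent_space_outside[OF u]
  by (auto simp: coord_vec_def o_def fun_eq_iff)

lemma tangent_eqI:
  assumes "c \<in> A" "p \<in> fst c" "u \<in> tangent_space A p" "v \<in> tangent_space A p" "u c = v c"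
  shows "u = v"
  using tangent_eq_coord_vec[of c A p] assms by metis

lemma coord_vec_combination:
  assumes A: "smooth_atlas A" and c: "c \<in> A" "p \<in> fst c"
  shows "coord_vec A c p (r *\<^sub>R a + s *\<^sub>R b) = (\<lambda>d. r *\<^sub>R coord_vec A c p a d + s *\<^sub>R coord_vec A c p b d)"
  using linear_transition[OF A c]
  by (auto simp: coord_vec_def o_def linear_add linear_cmul fun_eq_iff simp del: split_paired_All)

text \<open>
  Frees \<open>tangent_map\<close> from the chosen chart in its definition: the components of a tangent vector in two charts
  differ by the derivative of the coordinate change, which the chain rule absorbs.
\<close>

lemma tangent_map_chart:
  assumes A: "smooth_atlas A" and B: "smooth_atlas B" and f: "smooth_at A B f p"
    and c: "c \<in> A" "p \<in> fst c" and d: "d \<in> B" "f p \<in> fst d" and u: "u \<in> tangent_space A p"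
  shows "tangent_map A B f p u d = der (\<lambda>x. snd d (f (chart_inv c x))) (snd c p) (u c)"
proof -
  have p: "p \<in> points A" using f by (rule smooth_atD)
  let ?c = "chart_at A p"
  have c0: "?c \<in> A" "p \<in> fst ?c" using chart_at_mem[OF p] by auto
  have "u ?c = der (\<lambda>x. snd ?c (chart_inv c x)) (snd c p) (u c)"
    using tangent_space_change[OF u c c0] .
  then show ?thesis
    using local_chain_rule[OF A A smooth_at_ident[OF A p] f c c0 d, of "u c"] d
    by (simp add: tangent_map_def Let_def o_def)
qed

lemma tangent_map_coord_vec:
  assumes A: "smooth_atlas A" and B: "smooth_atlas B" and f: "smooth_at A B f p"
    and c: "c \<in> A" "p \<in> fst c" and d: "d \<in> B" "f p \<in> fst d"
  shows "tangent_map A B f p (coord_vec A c p a) =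
    coord_vec B d (f p) (der (\<lambda>x. snd d (f (chart_inv c x))) (snd c p) a)"
proof
  fix e
  show "tangent_map A B f p (coord_vec A c p a) e =
    coord_vec B d (f p) (der (\<lambda>x. snd d (f (chart_inv c x))) (snd c p) a) e"
  proof (cases "e \<in> B \<and> f p \<in> fst e")
    case True
    then show ?thesis
      using tangent_map_chart[OF A B f c _ _ coord_vec_in[OF A c], of e] coord_vec_self[OF A c]
        local_chain_rule[OF A B f smooth_at_ident[OF B smooth_atD(2)[OF f]] c d, of e]
        coord_vec_chart[of e B "f p" d] True
      by simp
  next
    case False
    show ?thesis unfolding tangent_map_def coord_vec_def[of B] Let_def if_not_P[OF False] ..
  qed
qed

lemma tangent_map_in:
  assumes A: "smooth_atlas A" and B: "smooth_atlas B" and f: "smooth_at A B f p"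
    and u: "u \<in> tangent_space A p"
  shows "tangent_map A B f p u \<in> tangent_space B (f p)"
proof -
  obtain c d where c: "c \<in> A" "p \<in> fst c" and d: "d \<in> B" "f p \<in> fst d"
    using smooth_atD[OF f] unfolding points_def by blast
  show ?thesis
    using tangent_map_coord_vec[OF A B f c d, of "u c"] tangent_eq_coord_vec[OF c u]
      coord_vec_in[OF B d] by metis
qed

lemma tangent_map_compose:
  assumes A: "smooth_atlas A" and B: "smooth_atlas B" and C: "smooth_atlas C"
    and f: "smooth_at A B f p" and g: "smooth_at B C g (f p)" and u: "u \<in> tangent_space A p"
  shows "tangent_map B C g (f p) (tangent_map A B f p u) = tangent_map A C (\<lambda>q. g (f q)) p u"
proof -
  obtain c d e where c: "c \<in> A" "p \<in> fst c" and d: "d \<in> B" "f p \<in> fst d" and e: "e \<in> C" "g (f p) \<in> fst e"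
    using smooth_atD[OF f] smooth_atD[OF g] unfolding points_def by blast
  have gf: "smooth_at A C (\<lambda>q. g (f q)) p" by (rule smooth_at_compose[OF A B C f g])
  have "u = coord_vec A c p (u c)" by (rule tangent_eq_coord_vec[OF c u])
  then show ?thesis
    using tangent_map_coord_vec[OF A B f c d, of "u c"] tangent_map_coord_vec[OF B C g d e]
      tangent_map_coord_vec[OF A C gf c e, of "u c"] local_chain_rule[OF A B f g c d e, of "u c"]
    by metis
qed

lemma tangent_map_ident:
  assumes A: "smooth_atlas A" and p: "p \<in> points A" and u: "u \<in> tangent_space A p"
  shows "tangent_map A A (\<lambda>q. q) p u = u"
proof -
  obtain c where c: "c \<in> A" "p \<in> fst c" using p unfolding points_def by blast
  show ?thesis
    using tangent_map_coord_vec[OF A A smooth_at_ident[OF A p] c c, of "u c"] transition_self[OF A c]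
      tangent_eq_coord_vec[OF c u] by metis
qed

lemma tangent_map_combination:
  assumes A: "smooth_atlas A" and f: "smooth_at A B f p"
  shows "tangent_map A B f p (\<lambda>c. r *\<^sub>R u c + s *\<^sub>R v c) =
    (\<lambda>d. r *\<^sub>R tangent_map A B f p u d + s *\<^sub>R tangent_map A B f p v d)"
proof -
  let ?c = "chart_at A p"
  have c0: "?c \<in> A" "p \<in> fst ?c" using chart_at_mem[OF smooth_atD(1)[OF f]] by auto
  have "linear (der (\<lambda>x. snd d (f (chart_inv ?c x))) (snd ?c p))" if "d \<in> B" "f p \<in> fst d" for d
    using smooth_at_differentiable[OF f c0 that] by (rule linear_der)
  then show ?thesis 
    by (auto simp: tangent_map_def Let_def o_def linear_add linear_cmul fun_eq_iff simp del: split_paired_All)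
qed

lemma tangent_map_cong:
  fixes A :: "('p, 'e::euclidean_space) atlas" and B :: "('q, 'f::euclidean_space) atlas"
  assumes A: "smooth_atlas A" and W: "openin (manifold_topology A) W" "p \<in> W"
    and eq: "\<And>q. q \<in> W \<Longrightarrow> f q = g q"
  shows "tangent_map A B f p = tangent_map A B g p"
proof -
  let ?c = "chart_at A p"
  have "p \<in> points A" using W by (auto simp: openin_manifold_topology[OF A])
  then have c0: "?c \<in> A" "p \<in> fst ?c" using chart_at_mem[of p A] by auto
  have o: "open (snd ?c ` (W \<inter> fst ?c))" using W c0 by (simp add: openin_manifold_topology[OF A])
  have "der (snd d \<circ> f \<circ> chart_inv ?c) (snd ?c p) = der (snd d \<circ> g \<circ> chart_inv ?c) (snd ?c p)"
    for d :: "('q, 'f) chart"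
    using W(2) c0 chart_inv_chart[OF A c0(1)] eq by (intro der_cong_open[OF o]) auto
  then show ?thesis unfolding tangent_map_def Let_def eq[OF W(2)] by (simp cong: if_cong)
qed


section \<open>Differential forms, pullback and exterior derivative\<close>

text \<open>
  The coefficients of a form in a chart, as functions of the coordinates; these are the functions that occur in
  the definitions of smoothness and of the exterior derivatives.
\<close>

definition coeff1 ::
    "('p, 'e::euclidean_space) atlas \<Rightarrow> ('p, 'e) chart \<Rightarrow> ('p, 'e) form1 \<Rightarrow> 'e \<Rightarrow> 'e \<Rightarrow> real" where
  "coeff1 A c \<alpha> a x = \<alpha> (chart_inv c x) (coord_vec A c (chart_inv c x) a)"

definition coeff2 ::
    "('p, 'e::euclidean_space) atlas \<Rightarrow> ('p, 'e) chart \<Rightarrow> ('p, 'e) form2 \<Rightarrow> 'e \<Rightarrow> 'e \<Rightarrow> 'e \<Rightarrow> real" where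
  "coeff2 A c \<omega> a b x =
     \<omega> (chart_inv c x) (coord_vec A c (chart_inv c x) a) (coord_vec A c (chart_inv c x) b)"

definition pullback1 ::
    "('p, 'e::euclidean_space) atlas \<Rightarrow> ('q, 'f::euclidean_space) atlas \<Rightarrow> ('p \<Rightarrow> 'q) \<Rightarrow>
     ('q, 'f) form1 \<Rightarrow> ('p, 'e) form1" where
  "pullback1 A B f \<alpha> p u = \<alpha> (f p) (tangent_map A B f p u)"

text \<open>
  The formula of \<open>ext_deriv1\<close> with the chart as a parameter. It agrees with \<open>ext_deriv1\<close> in every chart by
  \<open>ext_deriv1_chart\<close>.
\<close>

definition chart_ext_deriv1 ::
    "('p, 'e::euclidean_space) atlas \<Rightarrow> ('p, 'e) chart \<Rightarrow> ('p, 'e) form1 \<Rightarrow> ('p, 'e) form2" where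
  "chart_ext_deriv1 A c \<alpha> p u v =
     der (coeff1 A c \<alpha> (v c)) (snd c p) (u c) - der (coeff1 A c \<alpha> (u c)) (snd c p) (v c)"

lemma ext_deriv1_chart_at: "ext_deriv1 A \<alpha> p u v = chart_ext_deriv1 A (chart_at A p) \<alpha> p u v"
  by (simp add: ext_deriv1_def chart_ext_deriv1_def Let_def coeff1_def[abs_def])

lemma ext_deriv2_chart_at:
  "ext_deriv2 A \<omega> p u v w = (let c = chart_at A p in
     der (coeff2 A c \<omega> (v c) (w c)) (snd c p) (u c) -
     der (coeff2 A c \<omega> (u c) (w c)) (snd c p) (v c) +
     der (coeff2 A c \<omega> (u c) (v c)) (snd c p) (w c))"
  by (simp add: ext_deriv2_def Let_def coeff2_def[abs_def])

lemma one_form_iff: "one_form A \<alpha> \<longleftrightarrow> (\<forall>p\<in>points A. linear_on_tangent A p (\<alpha> p)) \<and>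
    (\<forall>c\<in>A. \<forall>a. smooth_on (snd c ` fst c) (coeff1 A c \<alpha> a))"
  by (simp add: one_form_def coeff1_def[abs_def])

lemma two_form_iff: "two_form A \<omega> \<longleftrightarrow>
    (\<forall>p\<in>points A. \<forall>u\<in>tangent_space A p.
       linear_on_tangent A p (\<lambda>v. \<omega> p u v) \<and> linear_on_tangent A p (\<lambda>v. \<omega> p v u) \<and> \<omega> p u u = 0) \<and>
    (\<forall>c\<in>A. \<forall>a b. smooth_on (snd c ` fst c) (coeff2 A c \<omega> a b))"
  by (simp add: two_form_def coeff2_def[abs_def])

lemma linear_on_tangentD:
  "linear_on_tangent A p \<alpha> \<Longrightarrow> u \<in> tangent_space A p \<Longrightarrow> v \<in> tangent_space A p \<Longrightarrow>
    \<alpha> (\<lambda>c. r *\<^sub>R u c + s *\<^sub>R v c) = r * \<alpha> u + s * \<alpha> v"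
  by (simp add: linear_on_tangent_def)

lemma linear_on_tangent_zero:
  assumes A: "smooth_atlas A" and \<alpha>: "linear_on_tangent A p \<alpha>"
  shows "\<alpha> zero_tvec = 0"
  using linear_on_tangentD[OF \<alpha> zero_tvec_in[OF A] zero_tvec_in[OF A], of 0 0]
  by (simp add: zero_tvec_def)

lemma linear_on_tangent_coord_vec:
  assumes A: "smooth_atlas A" and c: "c \<in> A" "p \<in> fst c" and \<alpha>: "linear_on_tangent A p \<alpha>"
  shows "linear (\<lambda>a. \<alpha> (coord_vec A c p a))"
proof -
  have *: "\<alpha> (coord_vec A c p (r *\<^sub>R a + s *\<^sub>R b)) = r * \<alpha> (coord_vec A c p a) + s * \<alpha> (coord_vec A c p b)"
    for a b r s
    unfolding coord_vec_combination[OF A c]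
    by (rule linear_on_tangentD[OF \<alpha> coord_vec_in[OF A c] coord_vec_in[OF A c]])
  show ?thesis
  proof (rule linearI)
    show "\<alpha> (coord_vec A c p (a + b)) = \<alpha> (coord_vec A c p a) + \<alpha> (coord_vec A c p b)" for a b
      using *[of 1 a 1 b] by simp
    show "\<alpha> (coord_vec A c p (r *\<^sub>R a)) = r *\<^sub>R \<alpha> (coord_vec A c p a)" for r a
      using *[of r a 0 a] by simp
  qed
qed

lemma coeff1_linear:
  assumes A: "smooth_atlas A" and \<alpha>: "one_form A \<alpha>" and c: "c \<in> A" and x: "x \<in> snd c ` fst c"
  shows "linear (\<lambda>a. coeff1 A c \<alpha> a x)"
proof -
  have p: "chart_inv c x \<in> fst c" by (rule chart_inv_in[OF x])
  have "linear_on_tangent A (chart_inv c x) (\<alpha> (chart_inv c x))"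
    using \<alpha> points_chart[OF c p] by (simp add: one_form_def)
  from linear_on_tangent_coord_vec[OF A c p this] show ?thesis by (simp add: coeff1_def)
qed

lemma coeff1_smooth: "one_form A \<alpha> \<Longrightarrow> c \<in> A \<Longrightarrow> smooth_on (snd c ` fst c) (coeff1 A c \<alpha> a)"
  by (simp add: one_form_iff)

lemma coeff2_smooth: "two_form A \<omega> \<Longrightarrow> c \<in> A \<Longrightarrow> smooth_on (snd c ` fst c) (coeff2 A c \<omega> a b)"
  by (simp add: two_form_iff)

lemma coeff2_linear:
  assumes A: "smooth_atlas A" and \<omega>: "two_form A \<omega>" and c: "c \<in> A" and x: "x \<in> snd c ` fst c"
  shows "linear (\<lambda>a. coeff2 A c \<omega> a b x)" "linear (\<lambda>b. coeff2 A c \<omega> a b x)"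
proof -
  have p: "chart_inv c x \<in> fst c" by (rule chart_inv_in[OF x])
  let ?p = "chart_inv c x"
  have "linear_on_tangent A ?p (\<lambda>u. \<omega> ?p u (coord_vec A c ?p b))"
    "linear_on_tangent A ?p (\<lambda>u. \<omega> ?p (coord_vec A c ?p a) u)"
    using \<omega> points_chart[OF c p] coord_vec_in[OF A c p] by (simp_all add: two_form_def)
  from linear_on_tangent_coord_vec[OF A c p this(1)] linear_on_tangent_coord_vec[OF A c p this(2)]
  show "linear (\<lambda>a. coeff2 A c \<omega> a b x)" "linear (\<lambda>b. coeff2 A c \<omega> a b x)"
    by (simp_all add: coeff2_def)
qed

lemma coeff1_cong:
  assumes A: "smooth_atlas A" and c: "c \<in> A"
    and eq: "\<And>p u. p \<in> points A \<Longrightarrow> u \<in> tangent_space A p \<Longrightarrow> \<alpha> p u = \<beta> p u"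
    and x: "x \<in> snd c ` fst c"
  shows "coeff1 A c \<alpha> a x = coeff1 A c \<beta> a x"
  unfolding coeff1_def
  by (intro eq points_chart[OF c] coord_vec_in[OF A c] chart_inv_in[OF x])

lemma coeff2_cong:
  assumes A: "smooth_atlas A" and c: "c \<in> A"
    and eq: "\<And>p u v. p \<in> points A \<Longrightarrow> u \<in> tangent_space A p \<Longrightarrow> v \<in> tangent_space A p \<Longrightarrow> \<omega> p u v = \<eta> p u v"
    and x: "x \<in> snd c ` fst c"
  shows "coeff2 A c \<omega> a b x = coeff2 A c \<eta> a b x"
  unfolding coeff2_def
  by (intro eq points_chart[OF c] coord_vec_in[OF A c] chart_inv_in[OF x])

lemma chart_ext_deriv1_cong:
  assumes A: "smooth_atlas A" and c: "c \<in> A" "p \<in> fst c"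
    and eq: "\<And>p u. p \<in> points A \<Longrightarrow> u \<in> tangent_space A p \<Longrightarrow> \<alpha> p u = \<beta> p u"
  shows "chart_ext_deriv1 A c \<alpha> p u v = chart_ext_deriv1 A c \<beta> p u v"
proof -
  have "der (coeff1 A c \<alpha> a) (snd c p) = der (coeff1 A c \<beta> a) (snd c p)" for a
    using c by (intro der_cong_open[OF open_chart_image[OF A c(1)]] coeff1_cong[OF A c(1) eq]) auto
  then show ?thesis by (simp add: chart_ext_deriv1_def)
qed

lemma ext_deriv1_cong:
  assumes A: "smooth_atlas A" and p: "p \<in> points A"
    and eq: "\<And>p u. p \<in> points A \<Longrightarrow> u \<in> tangent_space A p \<Longrightarrow> \<alpha> p u = \<beta> p u"
  shows "ext_deriv1 A \<alpha> p u v = ext_deriv1 A \<beta> p u v"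
  unfolding ext_deriv1_chart_at using chart_at_mem[OF p] eq by (intro chart_ext_deriv1_cong[OF A]) auto

text \<open>
  Here \<open>F\<close> and \<open>G\<close> are the coefficients of a one-form and of its pullback along \<open>\<phi>\<close>. By the product rule the
  derivative of \<open>G b\<close> along \<open>a\<close> has a term in the derivative of \<open>F\<close> and a term in which \<open>F\<close> is applied to the
  second derivative of \<open>\<phi>\<close>. The latter is symmetric in \<open>a\<close> and \<open>b\<close> and cancels.
\<close>

lemma ext_deriv1_pullback_euclidean:
  fixes \<phi> :: "'a::euclidean_space \<Rightarrow> 'b::euclidean_space" and F :: "'b \<Rightarrow> 'b \<Rightarrow> real"
  assumes S: "open S" "x \<in> S" and T: "open T" "\<phi> ` S \<subseteq> T" and \<phi>: "smooth_on S \<phi>"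
    and F: "\<And>w. smooth_on T (F w)" "\<And>y. y \<in> T \<Longrightarrow> linear (\<lambda>w. F w y)"
    and G: "\<And>v y. y \<in> S \<Longrightarrow> G v y = F (der \<phi> y v) (\<phi> y)"
  shows "der (G b) x a - der (G a) x b =
    der (F (der \<phi> x b)) (\<phi> x) (der \<phi> x a) - der (F (der \<phi> x a)) (\<phi> x) (der \<phi> x b)"
proof -
  have \<phi>x: "\<phi> x \<in> T" using S T by auto
  have "der (G b) x a = der (F (der \<phi> x b)) (\<phi> x) (der \<phi> x a) + F (der (\<lambda>y. der \<phi> y b) x a) (\<phi> x)"
    for a b
  proof -
    \<comment> \<open>linearity in the index allows differentiating \<open>F\<close> for the fixed indices in \<open>Basis\<close> only\<close>
    have e1: "G b y = (\<Sum>i\<in>Basis. (der \<phi> y b \<bullet> i) * F i (\<phi> y))" if "y \<in> S" for y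
      using linear_sum_Basis[OF F(2), of "\<phi> y" "der \<phi> y b"] G[OF that] T that by auto
    have e2: "F w y = (\<Sum>i\<in>Basis. (w \<bullet> i) * F i y)" if "y \<in> T" for w y
      using linear_sum_Basis[OF F(2)[OF that], of w] by simp
    have Fd: "(F i has_derivative der (F i) (\<phi> x)) (at (\<phi> x))" for i
      by (rule smooth_on_has_derivative[OF F(1) \<phi>x])
    have d1: "((\<lambda>y. F i (\<phi> y)) has_derivative (\<lambda>v. der (F i) (\<phi> x) (der \<phi> x v))) (at x)" for i
      using diff_chain_at[OF smooth_on_has_derivative[OF \<phi> S(2)] Fd] by (simp add: o_def)
    have d2: "((\<lambda>y. der \<phi> y b \<bullet> i) has_derivative (\<lambda>v. der (\<lambda>y. der \<phi> y b) x v \<bullet> i)) (at x)" for i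
      by (intro has_derivative_inner_left smooth_on_has_derivative[OF smooth_on_der[OF \<phi>] S(2)])
    have "((\<lambda>y. \<Sum>i\<in>Basis. (der \<phi> y b \<bullet> i) * F i (\<phi> y)) has_derivative
        (\<lambda>v. \<Sum>i\<in>Basis. (der \<phi> x b \<bullet> i) * der (F i) (\<phi> x) (der \<phi> x v) +
          (der (\<lambda>y. der \<phi> y b) x v \<bullet> i) * F i (\<phi> x))) (at x)"
      by (intro has_derivative_sum has_derivative_mult d1 d2)
    then have Gd: "(G b has_derivative
        (\<lambda>v. \<Sum>i\<in>Basis. (der \<phi> x b \<bullet> i) * der (F i) (\<phi> x) (der \<phi> x v) +
          (der (\<lambda>y. der \<phi> y b) x v \<bullet> i) * F i (\<phi> x))) (at x)"
      by (subst has_derivative_cong_open[OF S e1])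
    have "((\<lambda>y. \<Sum>i\<in>Basis. (w \<bullet> i) * F i y) has_derivative
        (\<lambda>v. \<Sum>i\<in>Basis. (w \<bullet> i) * der (F i) (\<phi> x) v)) (at (\<phi> x))" for w
      by (intro has_derivative_sum has_derivative_mult_right Fd)
    then have Fw: "(F w has_derivative (\<lambda>v. \<Sum>i\<in>Basis. (w \<bullet> i) * der (F i) (\<phi> x) v)) (at (\<phi> x))" for w
      by (subst has_derivative_cong_open[OF T(1) \<phi>x e2])
    show ?thesis
      unfolding der_eqI[OF Gd] der_eqI[OF Fw[of "der \<phi> x b"]] sum.distrib
        e2[OF \<phi>x, of "der (\<lambda>y. der \<phi> y b) x a"] ..
  qed
  moreover have "der (\<lambda>y. der \<phi> y b) x a = der (\<lambda>y. der \<phi> y a) x b"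
    by (rule symmetric_second_derivative[OF S \<phi>])
  ultimately show ?thesis by simp
qed

lemma coeff1_pullback:
  assumes A: "smooth_atlas A" and B: "smooth_atlas B" and c: "c \<in> A" and d: "d \<in> B"
    and x: "x \<in> snd c ` fst c" "f (chart_inv c x) \<in> fst d" "smooth_at A B f (chart_inv c x)"
  shows "coeff1 A c (pullback1 A B f \<alpha>) a x =
    coeff1 B d \<alpha> (der (\<lambda>x. snd d (f (chart_inv c x))) x a) (snd d (f (chart_inv c x)))"
  using tangent_map_coord_vec[OF A B x(3) c chart_inv_in[OF x(1)] d x(2)]
    chart_inv_chart[OF B d x(2)] chart_chart_inv[OF x(1)]
  by (simp add: coeff1_def pullback1_def)

lemma coeff2_pullback:
  assumes A: "smooth_atlas A" and B: "smooth_atlas B" and c: "c \<in> A" and d: "d \<in> B"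
    and x: "x \<in> snd c ` fst c" "f (chart_inv c x) \<in> fst d" "smooth_at A B f (chart_inv c x)"
  shows "coeff2 A c (pullback2 A B f \<omega>) a b x =
    coeff2 B d \<omega> (der (\<lambda>x. snd d (f (chart_inv c x))) x a) (der (\<lambda>x. snd d (f (chart_inv c x))) x b)
      (snd d (f (chart_inv c x)))"
  using tangent_map_coord_vec[OF A B x(3) c chart_inv_in[OF x(1)] d x(2)]
    chart_inv_chart[OF B d x(2)] chart_chart_inv[OF x(1)]
  by (simp add: coeff2_def pullback2_def)

lemma chart_ext_deriv1_pullback:
  assumes A: "smooth_atlas A" and B: "smooth_atlas B" and f: "smooth_at A B f p"
    and c: "c \<in> A" "p \<in> fst c" and d: "d \<in> B" "f p \<in> fst d" and \<alpha>: "one_form B \<alpha>"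
    and u: "u \<in> tangent_space A p" and v: "v \<in> tangent_space A p"
  shows "chart_ext_deriv1 A c (pullback1 A B f \<alpha>) p u v =
    chart_ext_deriv1 B d \<alpha> (f p) (tangent_map A B f p u) (tangent_map A B f p v)"
proof -
  define \<phi> where "\<phi> = (\<lambda>x. snd d (f (chart_inv c x)))"
  obtain S where S: "open S" "snd c p \<in> S" "S \<subseteq> snd c ` fst c" "\<And>x. x \<in> S \<Longrightarrow> f (chart_inv c x) \<in> fst d"
    "smooth_on S \<phi>" "\<And>x. x \<in> S \<Longrightarrow> smooth_at A B f (chart_inv c x)"
    unfolding \<phi>_def using smooth_at_nearby[OF A B f c d] by metis
  have "der (coeff1 A c (pullback1 A B f \<alpha>) (v c)) (snd c p) (u c) -
      der (coeff1 A c (pullback1 A B f \<alpha>) (u c)) (snd c p) (v c) =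
    der (coeff1 B d \<alpha> (der \<phi> (snd c p) (v c))) (\<phi> (snd c p)) (der \<phi> (snd c p) (u c)) -
      der (coeff1 B d \<alpha> (der \<phi> (snd c p) (u c))) (\<phi> (snd c p)) (der \<phi> (snd c p) (v c))"
  proof (rule ext_deriv1_pullback_euclidean[OF S(1,2) open_chart_image[OF B d(1)] _ S(5)])
    show "\<phi> ` S \<subseteq> snd d ` fst d" using S(4) by (auto simp: \<phi>_def)
    show "smooth_on (snd d ` fst d) (coeff1 B d \<alpha> w)" for w by (rule coeff1_smooth[OF \<alpha> d(1)])
    show "linear (\<lambda>w. coeff1 B d \<alpha> w y)" if "y \<in> snd d ` fst d" for y
      by (rule coeff1_linear[OF B \<alpha> d(1) that])
    show "coeff1 A c (pullback1 A B f \<alpha>) a y = coeff1 B d \<alpha> (der \<phi> y a) (\<phi> y)" if "y \<in> S" for a y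
      unfolding \<phi>_def using S that by (intro coeff1_pullback[OF A B c(1) d(1)]) auto
  qed
  moreover have "\<phi> (snd c p) = snd d (f p)" by (simp add: \<phi>_def chart_inv_chart[OF A c])
  moreover have "tangent_map A B f p w d = der \<phi> (snd c p) (w c)" if "w \<in> tangent_space A p" for w
    unfolding \<phi>_def by (rule tangent_map_chart[OF A B f c d that])
  ultimately show ?thesis using u v by (simp add: chart_ext_deriv1_def)
qed

lemma ext_deriv1_pullback:
  assumes A: "smooth_atlas A" and B: "smooth_atlas B" and f: "smooth_at A B f p" and \<alpha>: "one_form B \<alpha>"
    and u: "u \<in> tangent_space A p" and v: "v \<in> tangent_space A p"
  shows "ext_deriv1 A (pullback1 A B f \<alpha>) p u v =
    ext_deriv1 B \<alpha> (f p) (tangent_map A B f p u) (tangent_map A B f p v)"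
  unfolding ext_deriv1_chart_at
  using chart_at_mem[OF smooth_atD(1)[OF f]] chart_at_mem[OF smooth_atD(2)[OF f]]
  by (intro chart_ext_deriv1_pullback[OF A B f _ _ _ _ \<alpha> u v]) auto

text \<open>
  A one-form is its own pullback along the identity, computed with the chosen chart in the source and an
  arbitrary chart in the target.
\<close>

lemma ext_deriv1_chart:
  assumes A: "smooth_atlas A" and c: "c \<in> A" "p \<in> fst c" and \<alpha>: "one_form A \<alpha>"
    and u: "u \<in> tangent_space A p" and v: "v \<in> tangent_space A p"
  shows "ext_deriv1 A \<alpha> p u v = chart_ext_deriv1 A c \<alpha> p u v"
proof -
  have p: "p \<in> points A" using c by (rule points_chart)
  let ?c = "chart_at A p"
  have c0: "?c \<in> A" "p \<in> fst ?c" using chart_at_mem[OF p] by auto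
  have "ext_deriv1 A \<alpha> p u v = chart_ext_deriv1 A ?c (pullback1 A A (\<lambda>q. q) \<alpha>) p u v"
    unfolding ext_deriv1_chart_at
    by (rule chart_ext_deriv1_cong[OF A c0]) (simp add: pullback1_def tangent_map_ident[OF A])
  then show ?thesis
    using chart_ext_deriv1_pullback[OF A A smooth_at_ident[OF A p] c0 c \<alpha> u v]
    by (simp add: tangent_map_ident[OF A p] u v)
qed

lemma coeff2_ext_deriv1:
  assumes A: "smooth_atlas A" and c: "c \<in> A" and \<alpha>: "one_form A \<alpha>" and x: "x \<in> snd c ` fst c"
  shows "coeff2 A c (ext_deriv1 A \<alpha>) a b x = der (coeff1 A c \<alpha> b) x a - der (coeff1 A c \<alpha> a) x b"
proof -
  have p: "chart_inv c x \<in> fst c" by (rule chart_inv_in[OF x])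
  show ?thesis
    using ext_deriv1_chart[OF A c p \<alpha> coord_vec_in[OF A c p] coord_vec_in[OF A c p]]
    by (simp add: coeff2_def chart_ext_deriv1_def coord_vec_self[OF A c p] chart_chart_inv[OF x])
qed

lemma der_combination:
  assumes "f differentiable (at x)" "g differentiable (at x)"
  shows "der (\<lambda>y. r * f y + s * g y) x v = r * der f x v + (s::real) * der g x v"
proof -
  have "((\<lambda>y. r * f y + s * g y) has_derivative (\<lambda>v. r * der f x v + s * der g x v)) (at x)"
    using assms by (intro has_derivative_add has_derivative_mult_right has_derivative_der)
  from der_eqI[OF this] show ?thesis by simp
qed

lemma linear_real_combination:
  "linear (h :: 'a::real_vector \<Rightarrow> real) \<Longrightarrow> h (r *\<^sub>R a + s *\<^sub>R b) = r * h a + s * h b"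
  by (simp add: linear_add linear_cmul)

text \<open>
  Smoothness concerns the coefficients in a fixed chart, whereas the values of \<open>ext_deriv1\<close> at neighbouring
  points come from possibly different chosen charts; chart independence reconciles the two.
\<close>

lemma two_form_ext_deriv1:
  assumes A: "smooth_atlas A" and \<alpha>: "one_form A \<alpha>"
  shows "two_form A (ext_deriv1 A \<alpha>)"
  unfolding two_form_iff
proof (intro conjI ballI allI)
  fix p u assume p: "p \<in> points A" and "u \<in> tangent_space A p"
  let ?c = "chart_at A p"
  have c0: "?c \<in> A" "p \<in> fst ?c" using chart_at_mem[OF p] by auto
  let ?x = "snd ?c p"
  have o: "open (snd ?c ` fst ?c)" "?x \<in> snd ?c ` fst ?c"
    using c0 by (auto intro: open_chart_image[OF A])
  have d: "coeff1 A ?c \<alpha> a differentiable (at ?x)" for a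
    by (rule smooth_on_differentiable[OF coeff1_smooth[OF \<alpha> c0(1)] o(2)])
  have "der (coeff1 A ?c \<alpha> (r *\<^sub>R a + s *\<^sub>R b)) ?x =
      der (\<lambda>y. r * coeff1 A ?c \<alpha> a y + s * coeff1 A ?c \<alpha> b y) ?x" for r s a b
    by (intro der_cong_open[OF o] linear_real_combination[OF coeff1_linear[OF A \<alpha> c0(1)]])
  then have l: "der (coeff1 A ?c \<alpha> (r *\<^sub>R a + s *\<^sub>R b)) ?x v =
      r * der (coeff1 A ?c \<alpha> a) ?x v + s * der (coeff1 A ?c \<alpha> b) ?x v" for r s a b v
    by (simp add: der_combination[OF d d])
  note l' = linear_real_combination[OF linear_der[OF d]]
  show "linear_on_tangent A p (\<lambda>v. ext_deriv1 A \<alpha> p u v)" "linear_on_tangent A p (\<lambda>v. ext_deriv1 A \<alpha> p v u)"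
    unfolding linear_on_tangent_def ext_deriv1_chart_at chart_ext_deriv1_def l l'
    by (auto simp: algebra_simps)
  show "ext_deriv1 A \<alpha> p u u = 0" by (simp add: ext_deriv1_chart_at chart_ext_deriv1_def)
next
  fix c a b assume c: "c \<in> A"
  note o = open_chart_image[OF A c]
  have "smooth_on (snd c ` fst c) (\<lambda>x. der (coeff1 A c \<alpha> b) x a - der (coeff1 A c \<alpha> a) x b)"
    by (intro smooth_on_diff o smooth_on_der coeff1_smooth[OF \<alpha> c])
  then show "smooth_on (snd c ` fst c) (coeff2 A c (ext_deriv1 A \<alpha>) a b)"
    by (subst smooth_on_cong[OF o coeff2_ext_deriv1[OF A c \<alpha>]])
qed

lemma der_diff:
  assumes "f differentiable (at x)" "g differentiable (at x)"
  shows "der (\<lambda>y. f y - g y) x v = der f x v - der g x v"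
  using der_eqI[OF has_derivative_diff[OF has_derivative_der[OF assms(1)] has_derivative_der[OF assms(2)]]]
  by simp

text \<open>
  In a chart, the six second derivatives of the coefficients cancel in pairs by symmetry.
\<close>

lemma closed2_ext_deriv1:
  assumes A: "smooth_atlas A" and \<alpha>: "one_form A \<alpha>"
  shows "closed2 A (ext_deriv1 A \<alpha>)"
  unfolding closed2_def
proof (intro ballI)
  fix p u v w assume p: "p \<in> points A"
  let ?c = "chart_at A p"
  have c0: "?c \<in> A" "p \<in> fst ?c" using chart_at_mem[OF p] by auto
  let ?x = "snd ?c p"
  have o: "open (snd ?c ` fst ?c)" "?x \<in> snd ?c ` fst ?c"
    using c0 by (auto intro: open_chart_image[OF A])
  have sm: "smooth_on (snd ?c ` fst ?c) (coeff1 A ?c \<alpha> a)" for a by (rule coeff1_smooth[OF \<alpha> c0(1)])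
  have "der (coeff2 A ?c (ext_deriv1 A \<alpha>) a b) ?x e =
      der (\<lambda>x. der (coeff1 A ?c \<alpha> b) x a - der (coeff1 A ?c \<alpha> a) x b) ?x e" for a b e
    by (simp add: der_cong_open[OF o coeff2_ext_deriv1[OF A c0(1) \<alpha>]])
  also have "\<dots> a b e = der (\<lambda>x. der (coeff1 A ?c \<alpha> b) x a) ?x e - der (\<lambda>x. der (coeff1 A ?c \<alpha> a) x b) ?x e"
    for a b e
    by (intro der_diff smooth_on_differentiable[OF smooth_on_der[OF sm] o(2)])
  finally have 1: "der (coeff2 A ?c (ext_deriv1 A \<alpha>) a b) ?x e =
      der (\<lambda>x. der (coeff1 A ?c \<alpha> b) x a) ?x e - der (\<lambda>x. der (coeff1 A ?c \<alpha> a) x b) ?x e" for a b e .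
  have sym: "der (\<lambda>x. der (coeff1 A ?c \<alpha> k) x a) ?x b = der (\<lambda>x. der (coeff1 A ?c \<alpha> k) x b) ?x a" for a b k
    by (rule symmetric_second_derivative[OF o sm])
  show "ext_deriv2 A (ext_deriv1 A \<alpha>) p u v w = 0"
    unfolding ext_deriv2_chart_at Let_def 1
    using sym[of "w ?c" "u ?c" "v ?c"] sym[of "v ?c" "u ?c" "w ?c"] sym[of "u ?c" "v ?c" "w ?c"]
    by linarith
qed

lemma two_form_combination:
  assumes A: "smooth_atlas A" and \<omega>: "two_form A \<omega>" and \<eta>: "two_form A \<eta>"
  shows "two_form A (\<lambda>p u v. r * \<omega> p u v + s * \<eta> p u v)"
  unfolding two_form_iff
proof (intro conjI ballI allI)
  fix p u assume p: "p \<in> points A" and u: "u \<in> tangent_space A p"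
  have l: "linear_on_tangent A p (\<lambda>v. \<omega> p u v)" "linear_on_tangent A p (\<lambda>v. \<omega> p v u)"
    "linear_on_tangent A p (\<lambda>v. \<eta> p u v)" "linear_on_tangent A p (\<lambda>v. \<eta> p v u)"
    using \<omega> \<eta> p u by (auto simp: two_form_def)
  show "linear_on_tangent A p (\<lambda>v. r * \<omega> p u v + s * \<eta> p u v)"
    using l unfolding linear_on_tangent_def by (simp add: algebra_simps)
  show "linear_on_tangent A p (\<lambda>v. r * \<omega> p v u + s * \<eta> p v u)"
    using l unfolding linear_on_tangent_def by (simp add: algebra_simps)
  show "r * \<omega> p u u + s * \<eta> p u u = 0" using \<omega> \<eta> p u by (auto simp: two_form_def)
next
  fix c a b assume c: "c \<in> A"
  have "smooth_on (snd c ` fst c) (\<lambda>x. r * coeff2 A c \<omega> a b x + s * coeff2 A c \<eta> a b x)"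
    using open_chart_image[OF A c] coeff2_smooth[OF \<omega> c] coeff2_smooth[OF \<eta> c]
    by (intro smooth_on_add smooth_on_mult smooth_on_const)
  then show "smooth_on (snd c ` fst c) (coeff2 A c (\<lambda>p u v. r * \<omega> p u v + s * \<eta> p u v) a b)"
    by (simp add: coeff2_def[abs_def])
qed

lemma ext_deriv2_combination:
  assumes A: "smooth_atlas A" and p: "p \<in> points A" and \<omega>: "two_form A \<omega>" and \<eta>: "two_form A \<eta>"
  shows "ext_deriv2 A (\<lambda>p u v. r * \<omega> p u v + s * \<eta> p u v) p u v w =
    r * ext_deriv2 A \<omega> p u v w + s * ext_deriv2 A \<eta> p u v w"
proof -
  let ?c = "chart_at A p"
  have c0: "?c \<in> A" "p \<in> fst ?c" using chart_at_mem[OF p] by auto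
  have x: "snd ?c p \<in> snd ?c ` fst ?c" using c0 by auto
  have c: "coeff2 A ?c (\<lambda>p u v. r * \<omega> p u v + s * \<eta> p u v) a b =
      (\<lambda>x. r * coeff2 A ?c \<omega> a b x + s * coeff2 A ?c \<eta> a b x)" for a b
    by (simp add: coeff2_def[abs_def])
  have "der (\<lambda>x. r * coeff2 A ?c \<omega> a b x + s * coeff2 A ?c \<eta> a b x) (snd ?c p) e =
      r * der (coeff2 A ?c \<omega> a b) (snd ?c p) e + s * der (coeff2 A ?c \<eta> a b) (snd ?c p) e" for a b e
    by (intro der_combination smooth_on_differentiable[OF coeff2_smooth[OF \<omega> c0(1)] x]
        smooth_on_differentiable[OF coeff2_smooth[OF \<eta> c0(1)] x])
  then show ?thesis unfolding ext_deriv2_chart_at Let_def c by (simp add: algebra_simps)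
qed

lemma ext_deriv2_cong:
  assumes A: "smooth_atlas A" and p: "p \<in> points A"
    and eq: "\<And>p u v. p \<in> points A \<Longrightarrow> u \<in> tangent_space A p \<Longrightarrow> v \<in> tangent_space A p \<Longrightarrow> \<omega> p u v = \<eta> p u v"
  shows "ext_deriv2 A \<omega> p u v w = ext_deriv2 A \<eta> p u v w"
proof -
  let ?c = "chart_at A p"
  have c0: "?c \<in> A" "p \<in> fst ?c" using chart_at_mem[OF p] by auto
  have "der (coeff2 A ?c \<omega> a b) (snd ?c p) = der (coeff2 A ?c \<eta> a b) (snd ?c p)" for a b
    using c0 by (intro der_cong_open[OF open_chart_image[OF A c0(1)]] coeff2_cong[OF A c0(1) eq]) auto
  then show ?thesis unfolding ext_deriv2_chart_at Let_def by simp
qed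

text \<open>
  Near each point, the coefficients of the pullback are finite sums of products of smooth functions, after the
  derivative of the coordinate expression of \<open>f\<close> is expanded in the standard basis.
\<close>

lemma pullback1_one_form:
  assumes A: "smooth_atlas A" and B: "smooth_atlas B" and \<alpha>: "one_form B \<alpha>"
    and f: "\<And>p. p \<in> points A \<Longrightarrow> smooth_at A B f p"
  shows "one_form A (pullback1 A B f \<alpha>)"
  unfolding one_form_iff
proof (intro conjI ballI allI)
  fix p assume p: "p \<in> points A"
  have "linear_on_tangent B (f p) (\<alpha> (f p))"
    using \<alpha> smooth_atD(2)[OF f[OF p]] by (simp add: one_form_def)
  then show "linear_on_tangent A p (pullback1 A B f \<alpha> p)"
    using tangent_map_in[OF A B f[OF p]]
    by (simp add: linear_on_tangent_def pullback1_def tangent_map_combination[OF A f[OF p]])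
next
  fix c a assume c: "c \<in> A"
  show "smooth_on (snd c ` fst c) (coeff1 A c (pullback1 A B f \<alpha>) a)"
  proof (rule smooth_on_local)
    fix x assume "x \<in> snd c ` fst c"
    then obtain p where p: "p \<in> fst c" "x = snd c p" by auto
    have fp: "smooth_at A B f p" using f points_chart[OF c p(1)] by blast
    obtain d where d: "d \<in> B" "f p \<in> fst d" using smooth_atD(2)[OF fp] unfolding points_def by blast
    define \<phi> where "\<phi> = (\<lambda>x. snd d (f (chart_inv c x)))"
    obtain S where S: "open S" "snd c p \<in> S" "S \<subseteq> snd c ` fst c" "\<And>x. x \<in> S \<Longrightarrow> f (chart_inv c x) \<in> fst d"
      "smooth_on S \<phi>" "\<And>x. x \<in> S \<Longrightarrow> smooth_at A B f (chart_inv c x)"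
      unfolding \<phi>_def using smooth_at_nearby[OF A B fp c p(1) d] by metis
    have \<phi>S: "\<phi> ` S \<subseteq> snd d ` fst d" using S(4) by (auto simp: \<phi>_def)
    have "coeff1 A c (pullback1 A B f \<alpha>) a y = (\<Sum>i\<in>Basis. (der \<phi> y a \<bullet> i) * coeff1 B d \<alpha> i (\<phi> y))"
      if y: "y \<in> S" for y
    proof -
      have "\<phi> y \<in> snd d ` fst d" using \<phi>S y by auto
      from linear_sum_Basis[OF coeff1_linear[OF B \<alpha> d(1) this], of "der \<phi> y a"] show ?thesis
        using coeff1_pullback[OF A B c d(1) _ S(4)[OF y] S(6)[OF y]] S(3) y by (auto simp: \<phi>_def)
    qed
    moreover have "smooth_on S (\<lambda>y. \<Sum>i\<in>Basis. (der \<phi> y a \<bullet> i) * coeff1 B d \<alpha> i (\<phi> y))"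
      by (intro smooth_on_sum smooth_on_mult S(1) smooth_on_inner smooth_on_der S(5) smooth_on_const
          smooth_on_compose[OF S(1) open_chart_image[OF B d(1)] \<phi>S S(5)] coeff1_smooth[OF \<alpha> d(1)])
    ultimately have "smooth_on S (coeff1 A c (pullback1 A B f \<alpha>) a)"
      by (subst smooth_on_cong[OF S(1)])
    then show "\<exists>T. open T \<and> x \<in> T \<and> smooth_on T (coeff1 A c (pullback1 A B f \<alpha>) a)"
      using S(1,2) p by blast
  qed
qed

lemma pullback2_two_form:
  assumes A: "smooth_atlas A" and B: "smooth_atlas B" and \<omega>: "two_form B \<omega>"
    and f: "\<And>p. p \<in> points A \<Longrightarrow> smooth_at A B f p"
  shows "two_form A (pullback2 A B f \<omega>)"
  unfolding two_form_iff
proof (intro conjI ballI allI)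
  fix p u assume p: "p \<in> points A" and u: "u \<in> tangent_space A p"
  note fp = f[OF p]
  have *: "linear_on_tangent B (f p) (\<lambda>v. \<omega> (f p) (tangent_map A B f p u) v)"
    "linear_on_tangent B (f p) (\<lambda>v. \<omega> (f p) v (tangent_map A B f p u))"
    "\<omega> (f p) (tangent_map A B f p u) (tangent_map A B f p u) = 0"
    using \<omega> smooth_atD(2)[OF fp] tangent_map_in[OF A B fp u] by (simp_all add: two_form_def)
  show "linear_on_tangent A p (\<lambda>v. pullback2 A B f \<omega> p u v)"
    "linear_on_tangent A p (\<lambda>v. pullback2 A B f \<omega> p v u)"
    using *(1,2) tangent_map_in[OF A B fp]
    by (simp_all add: linear_on_tangent_def pullback2_def tangent_map_combination[OF A fp])
  show "pullback2 A B f \<omega> p u u = 0" using *(3) by (simp add: pullback2_def)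
next
  fix c a b assume c: "c \<in> A"
  show "smooth_on (snd c ` fst c) (coeff2 A c (pullback2 A B f \<omega>) a b)"
  proof (rule smooth_on_local)
    fix x assume "x \<in> snd c ` fst c"
    then obtain p where p: "p \<in> fst c" "x = snd c p" by auto
    have fp: "smooth_at A B f p" using f points_chart[OF c p(1)] by blast
    obtain d where d: "d \<in> B" "f p \<in> fst d" using smooth_atD(2)[OF fp] unfolding points_def by blast
    define \<phi> where "\<phi> = (\<lambda>x. snd d (f (chart_inv c x)))"
    obtain S where S: "open S" "snd c p \<in> S" "S \<subseteq> snd c ` fst c" "\<And>x. x \<in> S \<Longrightarrow> f (chart_inv c x) \<in> fst d"
      "smooth_on S \<phi>" "\<And>x. x \<in> S \<Longrightarrow> smooth_at A B f (chart_inv c x)"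
      unfolding \<phi>_def using smooth_at_nearby[OF A B fp c p(1) d] by metis
    have \<phi>S: "\<phi> ` S \<subseteq> snd d ` fst d" using S(4) by (auto simp: \<phi>_def)
    have "coeff2 A c (pullback2 A B f \<omega>) a b y =
        (\<Sum>i\<in>Basis. (der \<phi> y a \<bullet> i) * (\<Sum>j\<in>Basis. (der \<phi> y b \<bullet> j) * coeff2 B d \<omega> i j (\<phi> y)))"
      if y: "y \<in> S" for y
    proof -
      have z: "\<phi> y \<in> snd d ` fst d" using \<phi>S y by auto
      have "coeff2 A c (pullback2 A B f \<omega>) a b y = coeff2 B d \<omega> (der \<phi> y a) (der \<phi> y b) (\<phi> y)"
        using coeff2_pullback[OF A B c d(1) _ S(4)[OF y] S(6)[OF y]] S(3) y by (auto simp: \<phi>_def)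
      also have "\<dots> = (\<Sum>i\<in>Basis. (der \<phi> y a \<bullet> i) * coeff2 B d \<omega> i (der \<phi> y b) (\<phi> y))"
        using linear_sum_Basis[OF coeff2_linear(1)[OF B \<omega> d(1) z], of "der \<phi> y a"] by simp
      also have "\<dots> = (\<Sum>i\<in>Basis. (der \<phi> y a \<bullet> i) * (\<Sum>j\<in>Basis. (der \<phi> y b \<bullet> j) * coeff2 B d \<omega> i j (\<phi> y)))"
        using linear_sum_Basis[OF coeff2_linear(2)[OF B \<omega> d(1) z], of _ "der \<phi> y b"] by simp
      finally show ?thesis .
    qed
    moreover have "smooth_on S (\<lambda>y. \<Sum>i\<in>Basis. (der \<phi> y a \<bullet> i) *
        (\<Sum>j\<in>Basis. (der \<phi> y b \<bullet> j) * coeff2 B d \<omega> i j (\<phi> y)))"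
      by (intro smooth_on_sum smooth_on_mult S(1) smooth_on_inner smooth_on_der S(5) smooth_on_const
          smooth_on_compose[OF S(1) open_chart_image[OF B d(1)] \<phi>S S(5)] coeff2_smooth[OF \<omega> d(1)])
    ultimately have "smooth_on S (coeff2 A c (pullback2 A B f \<omega>) a b)"
      by (subst smooth_on_cong[OF S(1)])
    then show "\<exists>T. open T \<and> x \<in> T \<and> smooth_on T (coeff2 A c (pullback2 A B f \<omega>) a b)"
      using S(1,2) p by blast
  qed
qed

lemma one_form_combination:
  assumes A: "smooth_atlas A" and \<alpha>: "one_form A \<alpha>" and \<beta>: "one_form A \<beta>"
  shows "one_form A (\<lambda>p u. r * \<alpha> p u + s * \<beta> p u)"
  unfolding one_form_iff
proof (intro conjI ballI allI)
  fix p assume "p \<in> points A"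
  then have "linear_on_tangent A p (\<alpha> p)" "linear_on_tangent A p (\<beta> p)"
    using \<alpha> \<beta> by (simp_all add: one_form_def)
  then show "linear_on_tangent A p (\<lambda>u. r * \<alpha> p u + s * \<beta> p u)"
    unfolding linear_on_tangent_def by (simp add: algebra_simps)
next
  fix c a assume c: "c \<in> A"
  have "smooth_on (snd c ` fst c) (\<lambda>x. r * coeff1 A c \<alpha> a x + s * coeff1 A c \<beta> a x)"
    using open_chart_image[OF A c] coeff1_smooth[OF \<alpha> c] coeff1_smooth[OF \<beta> c]
    by (intro smooth_on_add smooth_on_mult smooth_on_const)
  then show "smooth_on (snd c ` fst c) (coeff1 A c (\<lambda>p u. r * \<alpha> p u + s * \<beta> p u) a)"
    by (simp add: coeff1_def[abs_def])
qed

lemma ext_deriv1_combination: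
  assumes A: "smooth_atlas A" and p: "p \<in> points A" and \<alpha>: "one_form A \<alpha>" and \<beta>: "one_form A \<beta>"
  shows "ext_deriv1 A (\<lambda>p u. r * \<alpha> p u + s * \<beta> p u) p u v = r * ext_deriv1 A \<alpha> p u v + s * ext_deriv1 A \<beta> p u v"
proof -
  let ?c = "chart_at A p"
  have c0: "?c \<in> A" "p \<in> fst ?c" using chart_at_mem[OF p] by auto
  have x: "snd ?c p \<in> snd ?c ` fst ?c" using c0 by auto
  have c: "coeff1 A ?c (\<lambda>p u. r * \<alpha> p u + s * \<beta> p u) a =
      (\<lambda>x. r * coeff1 A ?c \<alpha> a x + s * coeff1 A ?c \<beta> a x)" for a
    by (simp add: coeff1_def[abs_def])
  have "der (\<lambda>x. r * coeff1 A ?c \<alpha> a x + s * coeff1 A ?c \<beta> a x) (snd ?c p) e =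
      r * der (coeff1 A ?c \<alpha> a) (snd ?c p) e + s * der (coeff1 A ?c \<beta> a) (snd ?c p) e" for a e
    by (intro der_combination smooth_on_differentiable[OF coeff1_smooth[OF \<alpha> c0(1)] x]
        smooth_on_differentiable[OF coeff1_smooth[OF \<beta> c0(1)] x])
  then show ?thesis unfolding ext_deriv1_chart_at chart_ext_deriv1_def c by (simp add: algebra_simps)
qed

lemma closed2_combination:
  assumes A: "smooth_atlas A" and \<omega>: "two_form A \<omega>" "closed2 A \<omega>" and \<eta>: "two_form A \<eta>" "closed2 A \<eta>"
    and eq: "\<And>p u v. p \<in> points A \<Longrightarrow> u \<in> tangent_space A p \<Longrightarrow> v \<in> tangent_space A p \<Longrightarrow>
      \<rho> p u v = r * \<omega> p u v + s * \<eta> p u v"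
  shows "closed2 A \<rho>"
  unfolding closed2_def
proof (intro ballI)
  fix p u v w assume p: "p \<in> points A" and "u \<in> tangent_space A p" "v \<in> tangent_space A p" "w \<in> tangent_space A p"
  then have "ext_deriv2 A \<omega> p u v w = 0" "ext_deriv2 A \<eta> p u v w = 0"
    using \<omega>(2) \<eta>(2) by (simp_all add: closed2_def)
  moreover have "ext_deriv2 A \<rho> p u v w = ext_deriv2 A (\<lambda>p u v. r * \<omega> p u v + s * \<eta> p u v) p u v w"
    by (rule ext_deriv2_cong[OF A p eq])
  ultimately show "ext_deriv2 A \<rho> p u v w = 0"
    using ext_deriv2_combination[OF A p \<omega>(1) \<eta>(1), of r s u v w] by simp
qed

text \<open>
  Analogue of \<open>tangent_map_chart\<close> for \<open>differential\<close>, which also refers to the chosen chart.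
\<close>

lemma differential_chart:
  assumes A: "smooth_atlas A" and h: "smooth_fun A h" and c: "c \<in> A" "p \<in> fst c" and u: "u \<in> tangent_space A p"
  shows "differential A h p u = der (\<lambda>x. h (chart_inv c x)) (snd c p) (u c)"
proof -
  have p: "p \<in> points A" using c by (rule points_chart)
  let ?c = "chart_at A p"
  have c0: "?c \<in> A" "p \<in> fst ?c" using chart_at_mem[OF p] by auto
  let ?S = "snd c ` (fst c \<inter> fst ?c)"
  have S: "open ?S" "snd c p \<in> ?S" using c c0 by (auto intro: transition_open[OF A])
  have eq: "h (chart_inv c x) = h (chart_inv ?c (snd ?c (chart_inv c x)))" if "x \<in> ?S" for x
    using that chart_inv_chart[OF A c(1)] chart_inv_chart[OF A c0(1)] by auto
  have "(\<lambda>y. h (chart_inv ?c y)) differentiable (at (snd ?c p))"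
    using h c0 smooth_on_differentiable[of "snd ?c ` fst ?c" "\<lambda>y. h (chart_inv ?c y)" "snd ?c p"]
    by (simp add: smooth_fun_def o_def)
  then have d2: "(\<lambda>y. h (chart_inv ?c y)) differentiable (at (snd ?c (chart_inv c (snd c p))))"
    by (simp add: chart_inv_chart[OF A c])
  have d1: "(\<lambda>x. snd ?c (chart_inv c x)) differentiable (at (snd c p))"
    by (rule smooth_at_differentiable[OF smooth_at_ident[OF A p] c c0])
  have "der (\<lambda>x. h (chart_inv c x)) (snd c p) = der (\<lambda>x. h (chart_inv ?c (snd ?c (chart_inv c x)))) (snd c p)"
    by (rule der_cong_open[OF S eq])
  then have "der (\<lambda>x. h (chart_inv c x)) (snd c p) (u c) =
      der (\<lambda>y. h (chart_inv ?c y)) (snd ?c p) (der (\<lambda>x. snd ?c (chart_inv c x)) (snd c p) (u c))"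
    using der_compose[OF d1 d2] by (simp add: chart_inv_chart[OF A c])
  then show ?thesis
    using tangent_space_change[OF u c c0] by (simp add: differential_def Let_def o_def)
qed

lemma coeff1_differential:
  assumes A: "smooth_atlas A" and h: "smooth_fun A h" and c: "c \<in> A" and x: "x \<in> snd c ` fst c"
  shows "coeff1 A c (differential A h) a x = der (\<lambda>x. h (chart_inv c x)) x a"
proof -
  have p: "chart_inv c x \<in> fst c" by (rule chart_inv_in[OF x])
  show ?thesis
    using differential_chart[OF A h c p coord_vec_in[OF A c p]]
    by (simp add: coeff1_def coord_vec_self[OF A c p] chart_chart_inv[OF x])
qed

lemma smooth_fun_chart: "smooth_fun A h \<Longrightarrow> c \<in> A \<Longrightarrow> smooth_on (snd c ` fst c) (\<lambda>x. h (chart_inv c x))"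
  by (simp add: smooth_fun_def o_def)

lemma one_form_differential:
  assumes A: "smooth_atlas A" and h: "smooth_fun A h"
  shows "one_form A (differential A h)"
  unfolding one_form_iff
proof (intro conjI ballI allI)
  fix p assume p: "p \<in> points A"
  let ?c = "chart_at A p"
  have c0: "?c \<in> A" "p \<in> fst ?c" using chart_at_mem[OF p] by auto
  have "linear (der (\<lambda>x. h (chart_inv ?c x)) (snd ?c p))"
    using c0 by (intro smooth_on_linear_der[OF smooth_fun_chart[OF h]]) auto
  then show "linear_on_tangent A p (differential A h p)"
    by (simp add: linear_on_tangent_def differential_def Let_def o_def linear_add linear_cmul)
next
  fix c a assume c: "c \<in> A"
  show "smooth_on (snd c ` fst c) (coeff1 A c (differential A h) a)"
    by (subst smooth_on_cong[OF open_chart_image[OF A c] coeff1_differential[OF A h c]])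
      (auto intro: smooth_on_der smooth_fun_chart[OF h c])
qed

lemma ext_deriv1_differential:
  assumes A: "smooth_atlas A" and h: "smooth_fun A h" and p: "p \<in> points A"
  shows "ext_deriv1 A (differential A h) p u v = 0"
proof -
  let ?c = "chart_at A p"
  have c0: "?c \<in> A" "p \<in> fst ?c" using chart_at_mem[OF p] by auto
  have o: "open (snd ?c ` fst ?c)" "snd ?c p \<in> snd ?c ` fst ?c" using c0 by (auto intro: open_chart_image[OF A])
  have "der (coeff1 A ?c (differential A h) a) (snd ?c p) =
      der (\<lambda>x. der (\<lambda>x. h (chart_inv ?c x)) x a) (snd ?c p)" for a
    by (rule der_cong_open[OF o coeff1_differential[OF A h c0(1)]])
  then show ?thesis
    using symmetric_second_derivative[OF o smooth_fun_chart[OF h c0(1)], of "v ?c" "u ?c"]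
    by (simp add: ext_deriv1_chart_at chart_ext_deriv1_def)
qed


section \<open>Local diffeomorphisms\<close>

text \<open>
  The composites of \<open>f\<close> and its inverse are the identity only on \<open>U\<close> and on \<open>V\<close>. That is enough, because these
  sets are open and tangent maps depend on the germ of a map (\<open>tangent_map_cong\<close>).
\<close>

lemma diffeo_tangent_map_inverse:
  assumes A: "smooth_atlas A" and B: "smooth_atlas B" and f: "diffeo A B f U V" and p: "p \<in> U"
  shows "u \<in> tangent_space A p \<Longrightarrow> tangent_map B A (inv_into U f) (f p) (tangent_map A B f p u) = u"
    and "w \<in> tangent_space B (f p) \<Longrightarrow> tangent_map A B f p (tangent_map B A (inv_into U f) (f p) w) = w"
    and "smooth_at A B f p" and "smooth_at B A (inv_into U f) (f p)"
proof -
  let ?g = "inv_into U f"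
  have U: "openin (manifold_topology A) U" and V: "openin (manifold_topology B) V" and bij: "bij_betw f U V"
    and sf: "smooth_map A B U f" and sg: "smooth_map B A V ?g"
    using f by (auto simp: diffeo_def)
  have gf: "?g (f q) = q" if "q \<in> U" for q
    using bij that by (simp add: bij_betw_def)
  have fg: "f (?g y) = y" if "y \<in> V" for y
    using bij that by (metis bij_betw_inv_into_right)
  have fp: "f p \<in> V" using bij p by (auto simp: bij_betw_def)
  show 1: "smooth_at A B f p" by (rule smooth_map_imp_smooth_at[OF A B sf p])
  show 2: "smooth_at B A ?g (f p)" by (rule smooth_map_imp_smooth_at[OF B A sg fp])
  show "tangent_map B A ?g (f p) (tangent_map A B f p u) = u" if "u \<in> tangent_space A p"
  proof -
    have "tangent_map A A (\<lambda>q. ?g (f q)) p = tangent_map A A (\<lambda>q. q) p"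
      by (rule tangent_map_cong[OF A U p gf])
    then show ?thesis
      using tangent_map_compose[OF A B A 1 2 that] tangent_map_ident[OF A smooth_atD(1)[OF 1] that] by simp
  qed
  show "tangent_map A B f p (tangent_map B A ?g (f p) w) = w" if "w \<in> tangent_space B (f p)"
  proof -
    have "tangent_map B B (\<lambda>y. f (?g y)) (f p) = tangent_map B B (\<lambda>q. q) (f p)"
      by (rule tangent_map_cong[OF B V fp fg])
    moreover have "smooth_at A B f (?g (f p))" using 1 gf[OF p] by simp
    ultimately show ?thesis
      using tangent_map_compose[OF B A B 2 _ that, of f] tangent_map_ident[OF B smooth_atD(2)[OF 1] that]
        gf[OF p] by simp
  qed
qed

lemma tangent_map_zero:
  assumes A: "smooth_atlas A" and f: "smooth_at A B f p"
  shows "tangent_map A B f p zero_tvec = zero_tvec"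
  using tangent_map_combination[OF A f, of 0 zero_tvec 0 zero_tvec] by (simp add: zero_tvec_def)

lemma local_diffeo_smooth_at:
  assumes A: "smooth_atlas A" and B: "smooth_atlas B" and f: "local_diffeo A B f" and p: "p \<in> points A"
  shows "smooth_at A B f p"
proof -
  obtain U where U: "p \<in> U" "diffeo A B f U (f ` U)" using f p unfolding local_diffeo_def by blast
  show ?thesis by (rule diffeo_tangent_map_inverse(3)[OF A B U(2,1)])
qed

text \<open>
  The tangent maps of a local diffeomorphism are bijective: surjectivity makes the image of a degenerate vector
  degenerate, hence zero, and injectivity gives back that the vector itself is zero.
\<close>

lemma nondegenerate2_pullback:
  assumes A: "smooth_atlas A" and B: "smooth_atlas B" and f: "local_diffeo A B f"
    and \<omega>: "nondegenerate2 B \<omega>"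
  shows "nondegenerate2 A (pullback2 A B f \<omega>)"
  unfolding nondegenerate2_def
proof (intro ballI impI)
  fix p u assume p: "p \<in> points A" and u: "u \<in> tangent_space A p"
    and 0: "\<forall>v\<in>tangent_space A p. pullback2 A B f \<omega> p u v = 0"
  obtain U where U: "p \<in> U" "diffeo A B f U (f ` U)" using f p unfolding local_diffeo_def by blast
  note T = diffeo_tangent_map_inverse[OF A B U(2,1)]
  let ?g = "inv_into U f"
  have gp: "?g (f p) = p" using U by (simp add: diffeo_def bij_betw_def)
  have "\<omega> (f p) (tangent_map A B f p u) w = 0" if w: "w \<in> tangent_space B (f p)" for w
  proof -
    have "tangent_map B A ?g (f p) w \<in> tangent_space A p" using tangent_map_in[OF B A T(4) w] gp by simp
    then have "pullback2 A B f \<omega> p u (tangent_map B A ?g (f p) w) = 0" using 0 by blast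
    then show ?thesis using T(2)[OF w] by (simp add: pullback2_def)
  qed
  then have "tangent_map A B f p u = zero_tvec"
    using \<omega> smooth_atD(2)[OF T(3)] tangent_map_in[OF A B T(3) u] unfolding nondegenerate2_def by blast
  then have "tangent_map B A ?g (f p) zero_tvec = u" using T(1)[OF u] by simp
  then show "u = zero_tvec" using tangent_map_zero[OF B T(4)] by simp
qed


section \<open>Product manifolds\<close>

lemma fst_prod_chart [simp]: "fst (prod_chart c d) = fst c \<times> fst d"
  and snd_prod_chart [simp]: "snd (prod_chart c d) = map_prod (snd c) (snd d)"
  by (simp_all add: prod_chart_def)

lemma prod_chart_in: "c \<in> A \<Longrightarrow> d \<in> B \<Longrightarrow> prod_chart c d \<in> prod_atlas A B"
  unfolding prod_atlas_def by blast

lemma points_prod_atlas: "points (prod_atlas A B) = points A \<times> points B"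
proof -
  have "(\<exists>e\<in>prod_atlas A B. (p, q) \<in> fst e) \<longleftrightarrow> (\<exists>c\<in>A. p \<in> fst c) \<and> (\<exists>d\<in>B. q \<in> fst d)" for p q
  proof
    assume "\<exists>e\<in>prod_atlas A B. (p, q) \<in> fst e"
    then obtain c d where "c \<in> A" "d \<in> B" "(p, q) \<in> fst (prod_chart c d)"
      unfolding prod_atlas_def by blast
    then show "(\<exists>c\<in>A. p \<in> fst c) \<and> (\<exists>d\<in>B. q \<in> fst d)"
      unfolding fst_prod_chart by blast
  next
    assume "(\<exists>c\<in>A. p \<in> fst c) \<and> (\<exists>d\<in>B. q \<in> fst d)"
    then obtain c d where "c \<in> A" "p \<in> fst c" "d \<in> B" "q \<in> fst d" by blast
    then show "\<exists>e\<in>prod_atlas A B. (p, q) \<in> fst e"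
      by (intro bexI[of _ "prod_chart c d"] prod_chart_in) auto
  qed
  then show ?thesis unfolding points_def by (intro set_eqI) (simp add: split_paired_all)
qed

lemma map_prod_image: "map_prod f g ` (S \<times> T) = f ` S \<times> g ` T"
  by auto

lemma chart_inv_prod_chart:
  assumes A: "smooth_atlas A" and B: "smooth_atlas B" and c: "c \<in> A" and d: "d \<in> B"
    and x: "x \<in> snd c ` fst c" and y: "y \<in> snd d ` fst d"
  shows "chart_inv (prod_chart c d) (x, y) = (chart_inv c x, chart_inv d y)"
proof -
  have "inj_on (map_prod (snd c) (snd d)) (fst c \<times> fst d)"
    using A B c d by (intro map_prod_inj_on) (auto simp: smooth_atlas_def)
  moreover have "(x, y) = map_prod (snd c) (snd d) (chart_inv c x, chart_inv d y)"
    by (simp add: chart_chart_inv[OF x] chart_chart_inv[OF y])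
  ultimately show ?thesis
    using chart_inv_in[OF x] chart_inv_in[OF y]
    by (simp add: chart_inv_def[of "prod_chart c d"] inv_into_f_eq)
qed

lemma smooth_atlas_prod:
  assumes A: "smooth_atlas A" and B: "smooth_atlas B"
  shows "smooth_atlas (prod_atlas A B)"
  unfolding smooth_atlas_def
proof (intro conjI ballI)
  fix e assume "e \<in> prod_atlas A B"
  then obtain c d where e: "e = prod_chart c d" and c: "c \<in> A" and d: "d \<in> B"
    by (auto simp: prod_atlas_def)
  show "inj_on (snd e) (fst e)"
    using A B c d unfolding e by (auto simp: smooth_atlas_def intro!: map_prod_inj_on)
  show "open (snd e ` fst e)"
    unfolding e using open_chart_image[OF A c] open_chart_image[OF B d]
    by (simp add: map_prod_image open_Times)
  fix e' assume "e' \<in> prod_atlas A B"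
  then obtain c' d' where e': "e' = prod_chart c' d'" and c': "c' \<in> A" and d': "d' \<in> B"
    by (auto simp: prod_atlas_def)
  let ?C = "snd c ` (fst c \<inter> fst c')" and ?D = "snd d ` (fst d \<inter> fst d')"
  have im: "snd e ` (fst e \<inter> fst e') = ?C \<times> ?D"
    by (simp add: e e' Times_Int_Times map_prod_image)
  have oC: "open ?C" and oD: "open ?D"
    by (rule transition_open[OF A c c'], rule transition_open[OF B d d'])
  show o: "open (snd e ` (fst e \<inter> fst e'))" unfolding im by (rule open_Times[OF oC oD])
  have "smooth_on (?C \<times> ?D) (\<lambda>z. (snd c' (chart_inv c (fst z)), snd d' (chart_inv d (snd z))))"
    by (intro smooth_on_Pair open_Times oC oD
        smooth_on_compose[OF _ oC _ smooth_on_fst transition_smooth[OF A c c']]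
        smooth_on_compose[OF _ oD _ smooth_on_snd transition_smooth[OF B d d']]) auto
  moreover have "(snd e' \<circ> chart_inv e) z = (snd c' (chart_inv c (fst z)), snd d' (chart_inv d (snd z)))"
    if "z \<in> ?C \<times> ?D" for z
    using that chart_inv_prod_chart[OF A B c d, of "fst z" "snd z"] by (auto simp: e e')
  ultimately show "smooth_on (snd e ` (fst e \<inter> fst e')) (snd e' \<circ> chart_inv e)"
    unfolding im by (subst smooth_on_cong[OF open_Times[OF oC oD]])
qed

lemma prod_chart_fst:
  assumes A: "smooth_atlas A" and B: "smooth_atlas B" and c: "c \<in> A" and d: "d \<in> B"
    and z: "z \<in> snd c ` fst c \<times> snd d ` fst d"
  shows "fst (chart_inv (prod_chart c d) z) = chart_inv c (fst z)"
    and "snd (chart_inv (prod_chart c d) z) = chart_inv d (snd z)"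
  using chart_inv_prod_chart[OF A B c d, of "fst z" "snd z"] z by auto

lemma projection_charts:
  assumes A: "smooth_atlas A" and B: "smooth_atlas B" and c: "c \<in> A" and d: "d \<in> B"
    and z: "z \<in> snd c ` fst c \<times> snd d ` fst d"
  shows "snd c (fst (chart_inv (prod_chart c d) z)) = fst z"
    and "snd d (snd (chart_inv (prod_chart c d) z)) = snd z"
proof -
  have "fst z \<in> snd c ` fst c" "snd z \<in> snd d ` fst d" using z by (simp_all add: mem_Times_iff)
  then show "snd c (fst (chart_inv (prod_chart c d) z)) = fst z"
    "snd d (snd (chart_inv (prod_chart c d) z)) = snd z"
    by (simp_all only: prod_chart_fst[OF A B c d z] chart_chart_inv)
qed

lemma der_fst [simp]: "der fst x = fst" and der_snd [simp]: "der snd x = snd"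
  by (auto intro!: der_eqI bounded_linear_imp_has_derivative bounded_linear_fst bounded_linear_snd)

lemma der_projection_charts:
  assumes A: "smooth_atlas A" and B: "smooth_atlas B" and c: "c \<in> A" and d: "d \<in> B"
    and z: "z \<in> snd c ` fst c \<times> snd d ` fst d"
  shows "der (\<lambda>z. snd c (fst (chart_inv (prod_chart c d) z))) z = fst"
    and "der (\<lambda>z. snd d (snd (chart_inv (prod_chart c d) z))) z = snd"
proof -
  have o: "open (snd c ` fst c \<times> snd d ` fst d)"
    by (intro open_Times open_chart_image[OF A c] open_chart_image[OF B d])
  show "der (\<lambda>z. snd c (fst (chart_inv (prod_chart c d) z))) z = fst"
    using der_cong_open[OF o z projection_charts(1)[OF A B c d]] by simp
  show "der (\<lambda>z. snd d (snd (chart_inv (prod_chart c d) z))) z = snd"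
    using der_cong_open[OF o z projection_charts(2)[OF A B c d]] by simp
qed

lemma smooth_at_projections:
  assumes A: "smooth_atlas A" and B: "smooth_atlas B" and z: "z \<in> points (prod_atlas A B)"
  shows "smooth_at (prod_atlas A B) A fst z" and "smooth_at (prod_atlas A B) B snd z"
proof -
  obtain c d where c: "c \<in> A" "fst z \<in> fst c" and d: "d \<in> B" "snd z \<in> fst d"
    using z unfolding points_prod_atlas by (auto simp: points_def)
  let ?S = "snd c ` fst c \<times> snd d ` fst d"
  note P = smooth_atlas_prod[OF A B] and cd = prod_chart_in[OF c(1) d(1)]
  have o: "open ?S"
    by (intro open_Times open_chart_image[OF A c(1)] open_chart_image[OF B d(1)])
  have zcd: "z \<in> fst (prod_chart c d)" using c d by (cases z) auto
  have S: "snd (prod_chart c d) z \<in> ?S" "?S \<subseteq> snd (prod_chart c d) ` fst (prod_chart c d)"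
    using c d by (cases z) (auto simp: map_prod_image)
  have s1: "smooth_on ?S (\<lambda>x. snd c (fst (chart_inv (prod_chart c d) x)))"
    by (subst smooth_on_cong[OF o projection_charts(1)[OF A B c(1) d(1)]]) (auto intro: smooth_on_fst)
  have s2: "smooth_on ?S (\<lambda>x. snd d (snd (chart_inv (prod_chart c d) x)))"
    by (subst smooth_on_cong[OF o projection_charts(2)[OF A B c(1) d(1)]]) (auto intro: smooth_on_snd)
  show "smooth_at (prod_atlas A B) A fst z"
    using prod_chart_fst(1)[OF A B c(1) d(1)] chart_inv_in[of _ c]
    by (intro smooth_atI[OF P A cd zcd c(1) o S _ s1]) (simp add: mem_Times_iff)
  show "smooth_at (prod_atlas A B) B snd z"
    using prod_chart_fst(2)[OF A B c(1) d(1)] chart_inv_in[of _ d]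
    by (intro smooth_atI[OF P B cd zcd d(1) o S _ s2]) (simp add: mem_Times_iff)
qed

lemma tangent_map_projections:
  assumes A: "smooth_atlas A" and B: "smooth_atlas B" and c: "c \<in> A" "p \<in> fst c" and d: "d \<in> B" "q \<in> fst d"
    and u: "u \<in> tangent_space (prod_atlas A B) (p, q)"
  shows "tangent_map (prod_atlas A B) A fst (p, q) u c = fst (u (prod_chart c d))"
    and "tangent_map (prod_atlas A B) B snd (p, q) u d = snd (u (prod_chart c d))"
proof -
  have z: "(p, q) \<in> points (prod_atlas A B)"
    using points_chart[OF c] points_chart[OF d] by (simp add: points_prod_atlas)
  have S: "snd (prod_chart c d) (p, q) \<in> snd c ` fst c \<times> snd d ` fst d" using c d by simp
  note P = smooth_atlas_prod[OF A B] and cd = prod_chart_in[OF c(1) d(1)]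
  have pq: "(p, q) \<in> fst (prod_chart c d)" using c d by simp
  show "tangent_map (prod_atlas A B) A fst (p, q) u c = fst (u (prod_chart c d))"
    using tangent_map_chart[OF P A smooth_at_projections(1)[OF A B z] cd pq c(1) _ u]
      der_projection_charts(1)[OF A B c(1) d(1) S] c by simp
  show "tangent_map (prod_atlas A B) B snd (p, q) u d = snd (u (prod_chart c d))"
    using tangent_map_chart[OF P B smooth_at_projections(2)[OF A B z] cd pq d(1) _ u]
      der_projection_charts(2)[OF A B c(1) d(1) S] d by simp
qed

text \<open>
  The uniqueness part of the description operator in \<open>tvec_pair\<close>.
\<close>

lemma prod_tangent_eqI:
  assumes A: "smooth_atlas A" and B: "smooth_atlas B" and p: "p \<in> points A" and q: "q \<in> points B"
    and u: "u \<in> tangent_space (prod_atlas A B) (p, q)" and u': "u' \<in> tangent_space (prod_atlas A B) (p, q)"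
    and eq: "tangent_map (prod_atlas A B) A fst (p, q) u = tangent_map (prod_atlas A B) A fst (p, q) u'"
      "tangent_map (prod_atlas A B) B snd (p, q) u = tangent_map (prod_atlas A B) B snd (p, q) u'"
  shows "u = u'"
proof -
  obtain c d where c: "c \<in> A" "p \<in> fst c" and d: "d \<in> B" "q \<in> fst d"
    using p q by (auto simp: points_def)
  have pq: "(p, q) \<in> fst (prod_chart c d)" using c d by simp
  show ?thesis
    using tangent_map_projections[OF A B c d u] tangent_map_projections[OF A B c d u'] eq
    by (intro tangent_eqI[OF prod_chart_in[OF c(1) d(1)] pq u u']) (simp add: prod_eq_iff)
qed

lemma tvec_pair_eqI:
  assumes A: "smooth_atlas A" and B: "smooth_atlas B" and p: "p \<in> points A" and q: "q \<in> points B"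
    and u: "u \<in> tangent_space (prod_atlas A B) (p, q)"
    and "tangent_map (prod_atlas A B) A fst (p, q) u = v" "tangent_map (prod_atlas A B) B snd (p, q) u = w"
  shows "tvec_pair A B p q v w = u"
  unfolding tvec_pair_def
proof (rule the_equality)
  show "u \<in> tangent_space (prod_atlas A B) (p, q) \<and> tangent_map (prod_atlas A B) A fst (p, q) u = v \<and>
    tangent_map (prod_atlas A B) B snd (p, q) u = w" using assms by simp
qed (use prod_tangent_eqI[OF A B p q] assms in auto)

lemma tvec_pair_projections:
  assumes A: "smooth_atlas A" and B: "smooth_atlas B" and p: "p \<in> points A" and q: "q \<in> points B"
    and v: "v \<in> tangent_space A p" and w: "w \<in> tangent_space B q"
  shows "tvec_pair A B p q v w \<in> tangent_space (prod_atlas A B) (p, q)"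
    and "tangent_map (prod_atlas A B) A fst (p, q) (tvec_pair A B p q v w) = v"
    and "tangent_map (prod_atlas A B) B snd (p, q) (tvec_pair A B p q v w) = w"
proof -
  obtain c d where c: "c \<in> A" "p \<in> fst c" and d: "d \<in> B" "q \<in> fst d"
    using p q by (auto simp: points_def)
  have z: "(p, q) \<in> points (prod_atlas A B)" using p q by (simp add: points_prod_atlas)
  have pq: "(p, q) \<in> fst (prod_chart c d)" using c d by simp
  note P = smooth_atlas_prod[OF A B] and cd = prod_chart_in[OF c(1) d(1)]
  let ?u = "coord_vec (prod_atlas A B) (prod_chart c d) (p, q) (v c, w d)"
  have u: "?u \<in> tangent_space (prod_atlas A B) (p, q)" by (rule coord_vec_in[OF P cd pq])
  note uc = coord_vec_self[OF P cd pq, of "(v c, w d)"]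
  have v': "tangent_map (prod_atlas A B) A fst (p, q) ?u = v"
    using tangent_map_in[OF P A smooth_at_projections(1)[OF A B z] u] tangent_map_projections(1)[OF A B c d u] uc
    by (intro tangent_eqI[OF c _ v]) auto
  have w': "tangent_map (prod_atlas A B) B snd (p, q) ?u = w"
    using tangent_map_in[OF P B smooth_at_projections(2)[OF A B z] u] tangent_map_projections(2)[OF A B c d u] uc
    by (intro tangent_eqI[OF d _ w]) auto
  have "tvec_pair A B p q v w = ?u" by (rule tvec_pair_eqI[OF A B p q u v' w'])
  then show "tvec_pair A B p q v w \<in> tangent_space (prod_atlas A B) (p, q)"
    "tangent_map (prod_atlas A B) A fst (p, q) (tvec_pair A B p q v w) = v"
    "tangent_map (prod_atlas A B) B snd (p, q) (tvec_pair A B p q v w) = w"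
    using u v' w' by simp_all
qed

text \<open>
  Splits a one-form on a product into its two partial forms. It recombines \<open>D1\<close> with \<open>D2\<close>, and \<open>force_minus\<close>
  with \<open>force_plus\<close>.
\<close>

lemma tvec_pair_decomposition:
  assumes A: "smooth_atlas A" and B: "smooth_atlas B" and p: "p \<in> points A" and q: "q \<in> points B"
    and u: "u \<in> tangent_space (prod_atlas A B) (p, q)" and \<alpha>: "linear_on_tangent (prod_atlas A B) (p, q) \<alpha>"
  shows "\<alpha> (tvec_pair A B p q (tangent_map (prod_atlas A B) A fst (p, q) u) zero_tvec) +
    \<alpha> (tvec_pair A B p q zero_tvec (tangent_map (prod_atlas A B) B snd (p, q) u)) = \<alpha> u"
proof -
  have z: "(p, q) \<in> points (prod_atlas A B)" using p q by (simp add: points_prod_atlas)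
  note P = smooth_atlas_prod[OF A B] and s = smooth_at_projections[OF A B z]
  let ?v = "tangent_map (prod_atlas A B) A fst (p, q) u" and ?w = "tangent_map (prod_atlas A B) B snd (p, q) u"
  have v: "?v \<in> tangent_space A p" and w: "?w \<in> tangent_space B q"
    using tangent_map_in[OF P A s(1) u] tangent_map_in[OF P B s(2) u] by simp_all
  let ?a = "tvec_pair A B p q ?v zero_tvec" and ?b = "tvec_pair A B p q zero_tvec ?w"
  note a = tvec_pair_projections[OF A B p q v zero_tvec_in[OF B]] and b = tvec_pair_projections[OF A B p q zero_tvec_in[OF A] w]
  have "(\<lambda>c. 1 *\<^sub>R ?a c + 1 *\<^sub>R ?b c) = u"
  proof (rule prod_tangent_eqI[OF A B p q _ u])
    show "(\<lambda>c. 1 *\<^sub>R ?a c + 1 *\<^sub>R ?b c) \<in> tangent_space (prod_atlas A B) (p, q)"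
      by (rule tangent_space_combination[OF P a(1) b(1)])
    show "tangent_map (prod_atlas A B) A fst (p, q) (\<lambda>c. 1 *\<^sub>R ?a c + 1 *\<^sub>R ?b c) = ?v"
      unfolding tangent_map_combination[OF P s(1)] a(2) b(2) by (simp add: zero_tvec_def)
    show "tangent_map (prod_atlas A B) B snd (p, q) (\<lambda>c. 1 *\<^sub>R ?a c + 1 *\<^sub>R ?b c) = ?w"
      unfolding tangent_map_combination[OF P s(2)] a(3) b(3) by (simp add: zero_tvec_def)
  qed
  then show ?thesis using linear_on_tangentD[OF \<alpha> a(1) b(1), of 1 1] by simp
qed

text \<open>
  The formula of \<open>ext_deriv2\<close>, as a function of the point and the vectors in coordinates, so that components
  belonging to the factors of a product can be substituted.
\<close>

definition chart_ext_deriv2 ::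
    "('p, 'e::euclidean_space) atlas \<Rightarrow> ('p, 'e) chart \<Rightarrow> ('p, 'e) form2 \<Rightarrow> 'e \<Rightarrow> 'e \<Rightarrow> 'e \<Rightarrow> 'e \<Rightarrow> real"
  where
  "chart_ext_deriv2 A c \<omega> x a b e =
     der (coeff2 A c \<omega> b e) x a - der (coeff2 A c \<omega> a e) x b + der (coeff2 A c \<omega> a b) x e"

lemma ext_deriv2_eq_chart_ext_deriv2:
  "ext_deriv2 A \<omega> p u v w = chart_ext_deriv2 A (chart_at A p) \<omega> (snd (chart_at A p) p)
     (u (chart_at A p)) (v (chart_at A p)) (w (chart_at A p))"
  by (simp add: ext_deriv2_chart_at chart_ext_deriv2_def Let_def)

lemma der_compose_projections:
  fixes h :: "'a::euclidean_space \<Rightarrow> real" and k :: "'b::euclidean_space \<Rightarrow> real"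
  assumes "h differentiable (at (fst z))" "k differentiable (at (snd z))"
  shows "der (\<lambda>z. h (fst z)) z v = der h (fst z) (fst v)" and "der (\<lambda>z. k (snd z)) z v = der k (snd z) (snd v)"
proof -
  have "fst differentiable (at z)" "snd differentiable (at z)"
    using smooth_on_differentiable[OF smooth_on_fst[of UNIV], of z]
      smooth_on_differentiable[OF smooth_on_snd[of UNIV], of z] by auto
  then show "der (\<lambda>z. h (fst z)) z v = der h (fst z) (fst v)" "der (\<lambda>z. k (snd z)) z v = der k (snd z) (snd v)"
    using der_compose[of fst z h v] der_compose[of snd z k v] assms by auto
qed

text \<open>
  In a product chart, the pullback of a form along a projection has the same coefficients as the form, composed
  with the projection. So no coordinate of the other factor enters its derivative.
\<close>

lemma chart_ext_deriv2_pullback_projections: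
  assumes A: "smooth_atlas A" and B: "smooth_atlas B" and c: "c \<in> A" "p \<in> fst c" and d: "d \<in> B" "q \<in> fst d"
    and \<omega>: "two_form A \<omega>" and \<eta>: "two_form B \<eta>"
  shows "chart_ext_deriv2 (prod_atlas A B) (prod_chart c d) (pullback2 (prod_atlas A B) A fst \<omega>) (snd c p, snd d q) u v w =
      chart_ext_deriv2 A c \<omega> (snd c p) (fst u) (fst v) (fst w)" (is ?T1)
    and "chart_ext_deriv2 (prod_atlas A B) (prod_chart c d) (pullback2 (prod_atlas A B) B snd \<eta>) (snd c p, snd d q) u v w =
      chart_ext_deriv2 B d \<eta> (snd d q) (snd u) (snd v) (snd w)" (is ?T2)
proof -
  let ?S = "snd c ` fst c \<times> snd d ` fst d" and ?P = "prod_atlas A B"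
  note P = smooth_atlas_prod[OF A B] and cd = prod_chart_in[OF c(1) d(1)]
  have o: "open ?S"
    by (intro open_Times open_chart_image[OF A c(1)] open_chart_image[OF B d(1)])
  have z0: "(snd c p, snd d q) \<in> ?S" using c d by simp
  have inP: "z \<in> snd (prod_chart c d) ` fst (prod_chart c d)" if "z \<in> ?S" for z
    using that by (simp add: map_prod_image)
  have pts: "chart_inv (prod_chart c d) z \<in> points ?P" if "z \<in> ?S" for z
    by (rule points_chart[OF cd chart_inv_in[OF inP[OF that]]])
  have in1: "fst (chart_inv (prod_chart c d) z) \<in> fst c" and in2: "snd (chart_inv (prod_chart c d) z) \<in> fst d"
    if "z \<in> ?S" for z
    using chart_inv_in[OF inP[OF that]] by auto
  have e1: "coeff2 ?P (prod_chart c d) (pullback2 ?P A fst \<omega>) a b z = coeff2 A c \<omega> (fst a) (fst b) (fst z)"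
    if "z \<in> ?S" for a b z
    using coeff2_pullback[OF P A cd c(1) inP[OF that] in1[OF that] smooth_at_projections(1)[OF A B pts[OF that]]]
      der_projection_charts(1)[OF A B c(1) d(1) that] projection_charts(1)[OF A B c(1) d(1) that] by simp
  have e2: "coeff2 ?P (prod_chart c d) (pullback2 ?P B snd \<eta>) a b z = coeff2 B d \<eta> (snd a) (snd b) (snd z)"
    if "z \<in> ?S" for a b z
    using coeff2_pullback[OF P B cd d(1) inP[OF that] in2[OF that] smooth_at_projections(2)[OF A B pts[OF that]]]
      der_projection_charts(2)[OF A B c(1) d(1) that] projection_charts(2)[OF A B c(1) d(1) that] by simp
  have x: "snd c p \<in> snd c ` fst c" "snd d q \<in> snd d ` fst d" using c d by auto
  have d1: "coeff2 A c \<omega> a b differentiable (at (fst (snd c p, snd d q)))" for a b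
    using smooth_on_differentiable[OF coeff2_smooth[OF \<omega> c(1)] x(1)] by simp
  have d2: "coeff2 B d \<eta> a b differentiable (at (snd (snd c p, snd d q)))" for a b
    using smooth_on_differentiable[OF coeff2_smooth[OF \<eta> d(1)] x(2)] by simp
  have 1: "der (coeff2 ?P (prod_chart c d) (pullback2 ?P A fst \<omega>) a b) (snd c p, snd d q) k =
      der (coeff2 A c \<omega> (fst a) (fst b)) (snd c p) (fst k)" for a b k
    using der_compose_projections(1)[OF d1 d2] by (simp add: der_cong_open[OF o z0 e1])
  have 2: "der (coeff2 ?P (prod_chart c d) (pullback2 ?P B snd \<eta>) a b) (snd c p, snd d q) k =
      der (coeff2 B d \<eta> (snd a) (snd b)) (snd d q) (snd k)" for a b k
    using der_compose_projections(2)[OF d1 d2] by (simp add: der_cong_open[OF o z0 e2])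
  show ?T1 ?T2 unfolding chart_ext_deriv2_def 1 2 by simp_all
qed

lemma chart_ext_deriv2_zero:
  assumes "two_form A \<omega>" "c \<in> A" "p \<in> fst c"
  shows "chart_ext_deriv2 A c \<omega> (snd c p) 0 0 0 = 0"
proof -
  have "coeff2 A c \<omega> a b differentiable (at (snd c p))" for a b
    using assms by (intro smooth_on_differentiable[OF coeff2_smooth]) auto
  from linear_0[OF linear_der[OF this]] show ?thesis by (simp add: chart_ext_deriv2_def)
qed

text \<open>
  If the difference is closed, the derivatives of the two pullbacks agree on every triple of tangent vectors.
  On triples tangent to the first factor the derivative of the second pullback is zero, hence so is that of the
  first one, and since the latter depends only on first components, it vanishes identically. The same
  argument applies with the factors exchanged.
\<close>

lemma closed2_pullback_difference_imp:
  assumes A: "smooth_atlas A" and B: "smooth_atlas B" and \<omega>: "two_form A \<omega>" and \<eta>: "two_form B \<eta>"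
    and cl: "closed2 (prod_atlas A B) (\<lambda>z u v. pullback2 (prod_atlas A B) B snd \<eta> z u v -
      pullback2 (prod_atlas A B) A fst \<omega> z u v)" (is "closed2 ?P _")
  shows "closed2 (prod_atlas A B) (pullback2 (prod_atlas A B) A fst \<omega>)"
    and "closed2 (prod_atlas A B) (pullback2 (prod_atlas A B) B snd \<eta>)"
proof -
  note P = smooth_atlas_prod[OF A B] and s = smooth_at_projections[OF A B]
  have f: "two_form ?P (pullback2 ?P A fst \<omega>)" "two_form ?P (pullback2 ?P B snd \<eta>)"
    by (auto intro!: pullback2_two_form[OF P A \<omega> s(1)] pullback2_two_form[OF P B \<eta> s(2)])
  have "ext_deriv2 ?P (pullback2 ?P A fst \<omega>) z u v w = 0 \<and> ext_deriv2 ?P (pullback2 ?P B snd \<eta>) z u v w = 0"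
    if z: "z \<in> points ?P" for z u v w
  proof -
    let ?e = "chart_at ?P z"
    have e: "?e \<in> ?P" "z \<in> fst ?e" using chart_at_mem[OF z] by auto
    then obtain c d where cd: "?e = prod_chart c d" "c \<in> A" "d \<in> B" by (auto simp: prod_atlas_def)
    then have c: "c \<in> A" "fst z \<in> fst c" and d: "d \<in> B" "snd z \<in> fst d" using e by auto
    have sz: "snd ?e z = (snd c (fst z), snd d (snd z))" unfolding cd by (cases z) simp
    note K = chart_ext_deriv2_pullback_projections[OF A B c d \<omega> \<eta>]
    have E: "chart_ext_deriv2 B d \<eta> (snd d (snd z)) (snd a) (snd b) (snd k) =
        chart_ext_deriv2 A c \<omega> (snd c (fst z)) (fst a) (fst b) (fst k)" for a b k
    proof -
      let ?t = "\<lambda>a. coord_vec ?P ?e z a"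
      have "ext_deriv2 ?P (\<lambda>z u v. pullback2 ?P B snd \<eta> z u v - pullback2 ?P A fst \<omega> z u v) z (?t a) (?t b) (?t k) = 0"
        using cl z coord_vec_in[OF P e] by (simp add: closed2_def)
      then have "ext_deriv2 ?P (pullback2 ?P B snd \<eta>) z (?t a) (?t b) (?t k) =
          ext_deriv2 ?P (pullback2 ?P A fst \<omega>) z (?t a) (?t b) (?t k)"
        using ext_deriv2_combination[OF P z f(2) f(1), of 1 "-1"] by simp
      then show ?thesis
        unfolding ext_deriv2_eq_chart_ext_deriv2 coord_vec_self[OF P e] sz
        unfolding cd(1) K .
    qed
    have "chart_ext_deriv2 A c \<omega> (snd c (fst z)) a b k = 0" for a b k
      \<comment> \<open>vectors tangent to the first factor\<close>
      using E[of "(a, 0)" "(b, 0)" "(k, 0)"] chart_ext_deriv2_zero[OF \<eta> d] by simp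
    moreover have "chart_ext_deriv2 B d \<eta> (snd d (snd z)) a b k = 0" for a b k
      using E[of "(0, a)" "(0, b)" "(0, k)"] chart_ext_deriv2_zero[OF \<omega> c] by simp
    ultimately show ?thesis
      unfolding ext_deriv2_eq_chart_ext_deriv2 sz unfolding cd(1) K by simp
  qed
  then show "closed2 ?P (pullback2 ?P A fst \<omega>)" "closed2 ?P (pullback2 ?P B snd \<eta>)"
    by (auto simp: closed2_def)
qed


section \<open>Cotangent bundle and magnetic symplectic form\<close>

lemma restrict_covec_in:
  assumes A: "smooth_atlas A" and \<alpha>: "linear_on_tangent A p \<alpha>"
  shows "restrict_covec A p \<alpha> \<in> cotangent_space A p"
  using \<alpha> tangent_space_combination[OF A]
  by (simp add: cotangent_space_def restrict_covec_def linear_on_tangent_def)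

text \<open>
  The second coordinate of a cotangent chart represents the covector by the Euclidean inner product.
\<close>

lemma covec_coordinates:
  assumes A: "smooth_atlas A" and c: "c \<in> A" "p \<in> fst c" and \<alpha>: "\<alpha> \<in> cotangent_space A p"
  shows "\<alpha> (coord_vec A c p a) = snd (snd (cotangent_chart A c) (p, \<alpha>)) \<bullet> a"
proof -
  have "linear_on_tangent A p \<alpha>" using \<alpha> by (simp add: cotangent_space_def)
  from linear_sum_Basis[OF linear_on_tangent_coord_vec[OF A c this], of a]
  show ?thesis by (simp add: cotangent_chart_def inner_sum_left inner_commute[of a] mult.commute)
qed

lemma cotangent_chart_mem [simp]:
  "(p, \<alpha>) \<in> fst (cotangent_chart A c) \<longleftrightarrow> p \<in> fst c \<and> \<alpha> \<in> cotangent_space A p"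
  by (simp add: cotangent_chart_def)

lemma fst_cotangent_chart_apply [simp]: "fst (snd (cotangent_chart A c) z) = snd c (fst z)"
  by (simp add: cotangent_chart_def case_prod_beta)

text \<open>
  The covector at \<open>p\<close> with fibre coordinate \<open>\<xi>\<close> in the cotangent chart of \<open>c\<close>.
\<close>

definition covec_of ::
    "('p, 'e::euclidean_space) atlas \<Rightarrow> ('p, 'e) chart \<Rightarrow> 'p \<Rightarrow> 'e \<Rightarrow> ('p, 'e) covec" where
  "covec_of A c p \<xi> = restrict_covec A p (\<lambda>v. \<xi> \<bullet> v c)"

lemma covec_of_in:
  assumes A: "smooth_atlas A"
  shows "covec_of A c p \<xi> \<in> cotangent_space A p"
  unfolding covec_of_def
  by (rule restrict_covec_in[OF A]) (simp add: linear_on_tangent_def inner_add_right)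

lemma covec_of_coord_vec:
  assumes A: "smooth_atlas A" and d: "d \<in> A" "p \<in> fst d"
  shows "covec_of A c p \<xi> (coord_vec A d p a) = \<xi> \<bullet> coord_vec A d p a c"
  by (simp add: covec_of_def restrict_covec_def coord_vec_in[OF A d])

lemma cotangent_chart_covec_of:
  assumes A: "smooth_atlas A" and c: "c \<in> A" "p \<in> fst c"
  shows "snd (cotangent_chart A c) (p, covec_of A c p \<xi>) = (snd c p, \<xi>)"
  by (simp add: cotangent_chart_def covec_of_coord_vec[OF A c] coord_vec_self[OF A c]
      euclidean_representation)

lemma inj_on_cotangent_chart:
  assumes A: "smooth_atlas A" and c: "c \<in> A"
  shows "inj_on (snd (cotangent_chart A c)) (fst (cotangent_chart A c))"
proof (rule inj_onI)
  fix z z' assume z: "z \<in> fst (cotangent_chart A c)" and z': "z' \<in> fst (cotangent_chart A c)"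
    and eq: "snd (cotangent_chart A c) z = snd (cotangent_chart A c) z'"
  obtain p \<alpha> p' \<alpha>' where zz: "z = (p, \<alpha>)" "z' = (p', \<alpha>')" by (cases z, cases z') auto
  have p: "p \<in> fst c" "p' \<in> fst c" and \<alpha>: "\<alpha> \<in> cotangent_space A p" "\<alpha>' \<in> cotangent_space A p'"
    using z z' by (simp_all add: zz)
  have "snd c p = snd c p'" using arg_cong[OF eq, of fst] by (simp add: zz)
  then have pp: "p' = p" using chart_inv_chart[OF A c p(1)] chart_inv_chart[OF A c p(2)] by metis
  have \<alpha>': "\<alpha>' \<in> cotangent_space A p" using \<alpha>(2) unfolding pp .
  have "\<alpha> v = \<alpha>' v" for v
  proof (cases "v \<in> tangent_space A p")
    case True
    have "\<alpha> (coord_vec A c p (v c)) = \<alpha>' (coord_vec A c p (v c))"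
      using covec_coordinates[OF A c p(1) \<alpha>(1), of "v c"] covec_coordinates[OF A c p(1) \<alpha>', of "v c"]
        eq unfolding zz pp by simp
    then show ?thesis using tangent_eq_coord_vec[OF c p(1) True] by simp
  next
    case False
    then show ?thesis using \<alpha>(1) \<alpha>' by (simp add: cotangent_space_def)
  qed
  then show "z = z'" by (auto simp: zz pp)
qed

lemma cotangent_chart_image:
  assumes A: "smooth_atlas A" and c: "c \<in> A"
  shows "snd (cotangent_chart A c) ` (fst (cotangent_chart A c) \<inter> fst (cotangent_chart A d)) =
    snd c ` (fst c \<inter> fst d) \<times> UNIV"
proof (intro set_eqI iffI)
  fix y assume "y \<in> snd (cotangent_chart A c) ` (fst (cotangent_chart A c) \<inter> fst (cotangent_chart A d))"
  then obtain z where "y = snd (cotangent_chart A c) z" "z \<in> fst (cotangent_chart A c)"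
    "z \<in> fst (cotangent_chart A d)" by blast
  then show "y \<in> snd c ` (fst c \<inter> fst d) \<times> UNIV" by (cases z) (auto simp: mem_Times_iff)
next
  fix y assume "y \<in> snd c ` (fst c \<inter> fst d) \<times> (UNIV :: 'b set)"
  then obtain p \<xi> where p: "p \<in> fst c" "p \<in> fst d" "y = (snd c p, \<xi>)" by auto
  then have "y = snd (cotangent_chart A c) (p, covec_of A c p \<xi>)"
    using cotangent_chart_covec_of[OF A c p(1)] by simp
  moreover have "(p, covec_of A c p \<xi>) \<in> fst (cotangent_chart A c) \<inter> fst (cotangent_chart A d)"
    using p covec_of_in[OF A] by simp
  ultimately show "y \<in> snd (cotangent_chart A c) ` (fst (cotangent_chart A c) \<inter> fst (cotangent_chart A d))"
    by blast
qed

lemma cotangent_chart_image_self: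
  assumes A: "smooth_atlas A" and c: "c \<in> A"
  shows "snd (cotangent_chart A c) ` fst (cotangent_chart A c) = snd c ` fst c \<times> UNIV"
  using cotangent_chart_image[OF A c, of c] by simp

lemma chart_inv_cotangent_chart:
  assumes A: "smooth_atlas A" and c: "c \<in> A" and x: "x \<in> snd c ` fst c"
  shows "chart_inv (cotangent_chart A c) (x, \<xi>) = (chart_inv c x, covec_of A c (chart_inv c x) \<xi>)"
proof -
  have "snd (cotangent_chart A c) (chart_inv c x, covec_of A c (chart_inv c x) \<xi>) = (x, \<xi>)"
    using cotangent_chart_covec_of[OF A c chart_inv_in[OF x]] chart_chart_inv[OF x] by simp
  moreover have "(chart_inv c x, covec_of A c (chart_inv c x) \<xi>) \<in> fst (cotangent_chart A c)"
    using chart_inv_in[OF x] covec_of_in[OF A] by simp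
  ultimately show ?thesis
    unfolding chart_inv_def[of "cotangent_chart A c"]
    using inj_on_cotangent_chart[OF A c] by (intro inv_into_f_eq)
qed

text \<open>
  If the coordinates of the base change by \<open>\<tau>\<close> with inverse \<open>\<sigma>\<close>, those of the fibre change by the transpose of
  the derivative of \<open>\<sigma>\<close>, taken at the new base point. Both are smooth functions of the old coordinates.
\<close>

lemma smooth_atlas_cotangent_bundle:
  assumes A: "smooth_atlas A"
  shows "smooth_atlas (cotangent_bundle A)"
  unfolding smooth_atlas_def
proof (intro conjI ballI)
  fix e assume "e \<in> cotangent_bundle A"
  then obtain c where e: "e = cotangent_chart A c" and c: "c \<in> A" by (auto simp: cotangent_bundle_def)
  show "inj_on (snd e) (fst e)" unfolding e by (rule inj_on_cotangent_chart[OF A c])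
  show "open (snd e ` fst e)"
    unfolding e cotangent_chart_image_self[OF A c]
    by (intro open_Times open_UNIV open_chart_image[OF A c])
  fix e' assume "e' \<in> cotangent_bundle A"
  then obtain d where e': "e' = cotangent_chart A d" and d: "d \<in> A" by (auto simp: cotangent_bundle_def)
  let ?C = "snd c ` (fst c \<inter> fst d)" and ?D = "snd d ` (fst d \<inter> fst c)"
  have im: "snd e ` (fst e \<inter> fst e') = ?C \<times> UNIV" unfolding e e' by (rule cotangent_chart_image[OF A c])
  have o: "open (?C \<times> (UNIV :: 'b set))" by (intro open_Times open_UNIV transition_open[OF A c d])
  show "open (snd e ` (fst e \<inter> fst e'))" unfolding im by (rule o)
  define \<tau> where "\<tau> = (\<lambda>x. snd d (chart_inv c x))"
  define \<sigma> where "\<sigma> = (\<lambda>y. snd c (chart_inv d y))"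
  have \<tau>: "smooth_on ?C \<tau>" unfolding \<tau>_def by (rule transition_smooth[OF A c d])
  have \<sigma>: "smooth_on ?D \<sigma>" unfolding \<sigma>_def by (rule transition_smooth[OF A d c])
  have \<tau>C: "\<tau> ` ?C \<subseteq> ?D" using chart_inv_chart[OF A c] by (auto simp: \<tau>_def)
  have s1: "smooth_on (?C \<times> (UNIV :: 'b set)) (\<lambda>y. \<tau> (fst y))"
    by (rule smooth_on_compose[OF o transition_open[OF A c d] _ smooth_on_fst \<tau>]) auto
  have s2: "smooth_on (?C \<times> (UNIV :: 'b set)) (\<lambda>y. der \<sigma> (\<tau> (fst y)) b)" for b
    by (rule smooth_on_compose[OF o transition_open[OF A d c] _ s1 smooth_on_der[OF \<sigma>]]) (use \<tau>C in auto)
  have "smooth_on (?C \<times> UNIV) (\<lambda>y. (\<tau> (fst y), \<Sum>b\<in>Basis. (snd y \<bullet> der \<sigma> (\<tau> (fst y)) b) *\<^sub>R b))"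
    by (intro smooth_on_Pair smooth_on_sum smooth_on_scaleR smooth_on_inner smooth_on_const smooth_on_snd o s1 s2)
  moreover have "(snd e' \<circ> chart_inv e) y = (\<tau> (fst y), \<Sum>b\<in>Basis. (snd y \<bullet> der \<sigma> (\<tau> (fst y)) b) *\<^sub>R b)"
    if y: "y \<in> ?C \<times> UNIV" for y
  proof -
    obtain p \<xi> where p: "p \<in> fst c" "p \<in> fst d" and y: "y = (snd c p, \<xi>)" using y by auto
    have "chart_inv e y = (p, covec_of A c p \<xi>)"
      using chart_inv_cotangent_chart[OF A c, of "snd c p" \<xi>] p chart_inv_chart[OF A c p(1)] by (simp add: e y)
    moreover have "coord_vec A d p b c = der \<sigma> (snd d p) b" for b
      unfolding \<sigma>_def by (rule coord_vec_chart[OF c p(1)])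
    ultimately show ?thesis
      by (simp add: y e' \<tau>_def chart_inv_chart[OF A c p(1)] cotangent_chart_def covec_of_coord_vec[OF A d p(2)])
  qed
  ultimately show "smooth_on (snd e ` (fst e \<inter> fst e')) (snd e' \<circ> chart_inv e)"
    unfolding im by (subst smooth_on_cong[OF o])
qed

lemma cotangent_chart_in: "c \<in> A \<Longrightarrow> cotangent_chart A c \<in> cotangent_bundle A"
  by (simp add: cotangent_bundle_def)

lemma points_cotangent_bundle:
  "(p, \<alpha>) \<in> points (cotangent_bundle A) \<longleftrightarrow> p \<in> points A \<and> \<alpha> \<in> cotangent_space A p"
  by (auto simp: points_def cotangent_bundle_def)

lemma cotangent_projection_chart:
  assumes A: "smooth_atlas A" and c: "c \<in> A" and y: "y \<in> snd c ` fst c \<times> (UNIV :: 'e::euclidean_space set)"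
  shows "fst (chart_inv (cotangent_chart A c) y) = chart_inv c (fst y)"
    and "snd c (fst (chart_inv (cotangent_chart A c) y)) = fst y"
    and "der (\<lambda>y. snd c (fst (chart_inv (cotangent_chart A c) y))) y = fst"
proof -
  have *: "fst (chart_inv (cotangent_chart A c) y) = chart_inv c (fst y)"
    "snd c (fst (chart_inv (cotangent_chart A c) y)) = fst y"
    if y: "y \<in> snd c ` fst c \<times> (UNIV :: 'e set)" for y
  proof -
    have x: "fst y \<in> snd c ` fst c" using y by (simp add: mem_Times_iff)
    show "fst (chart_inv (cotangent_chart A c) y) = chart_inv c (fst y)"
      using chart_inv_cotangent_chart[OF A c x, of "snd y"] by simp
    then show "snd c (fst (chart_inv (cotangent_chart A c) y)) = fst y"
      using chart_chart_inv[OF x] by simp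
  qed
  have o: "open (snd c ` fst c \<times> (UNIV :: 'e set))" by (intro open_Times open_UNIV open_chart_image[OF A c])
  show "fst (chart_inv (cotangent_chart A c) y) = chart_inv c (fst y)"
    "snd c (fst (chart_inv (cotangent_chart A c) y)) = fst y" using *[OF y] by auto
  show "der (\<lambda>y. snd c (fst (chart_inv (cotangent_chart A c) y))) y = fst"
    using der_cong_open[OF o y *(2)] by simp
qed

lemma smooth_at_cotangent_projection:
  assumes A: "smooth_atlas A" and z: "z \<in> points (cotangent_bundle A)"
  shows "smooth_at (cotangent_bundle A) A fst z"
proof -
  obtain c where c: "c \<in> A" "fst z \<in> fst c" and \<alpha>: "snd z \<in> cotangent_space A (fst z)"
    using z points_cotangent_bundle[of "fst z" "snd z" A] by (auto simp: points_def)
  let ?S = "snd c ` fst c \<times> (UNIV :: 'b set)" and ?e = "cotangent_chart A c"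
  have o: "open ?S" by (intro open_Times open_UNIV open_chart_image[OF A c(1)])
  have ze: "z \<in> fst ?e" using c \<alpha> by (cases z) simp
  note im = cotangent_chart_image_self[OF A c(1)]
  have s1: "smooth_on ?S (\<lambda>y. snd c (fst (chart_inv ?e y)))"
    by (subst smooth_on_cong[OF o cotangent_projection_chart(2)[OF A c(1)]]) (auto intro: smooth_on_fst)
  show ?thesis
  proof (rule smooth_atI[OF smooth_atlas_cotangent_bundle[OF A] A cotangent_chart_in[OF c(1)] ze c(1) o _ _ _ s1])
    show "snd ?e z \<in> ?S" "?S \<subseteq> snd ?e ` fst ?e" using ze im by auto
    show "fst (chart_inv ?e y) \<in> fst c" if "y \<in> ?S" for y
      using cotangent_projection_chart(1)[OF A c(1) that] chart_inv_in[of "fst y" c] that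
      by (simp add: mem_Times_iff)
  qed
qed

lemma tangent_map_cotangent_projection:
  assumes A: "smooth_atlas A" and c: "c \<in> A" and z: "z \<in> fst (cotangent_chart A c)"
    and w: "w \<in> tangent_space (cotangent_bundle A) z"
  shows "tangent_map (cotangent_bundle A) A fst z w c = fst (w (cotangent_chart A c))"
proof -
  let ?e = "cotangent_chart A c"
  note e = cotangent_chart_in[OF c] and B = smooth_atlas_cotangent_bundle[OF A]
  have fz: "fst z \<in> fst c" using z by (cases z) simp
  have y: "snd ?e z \<in> snd c ` fst c \<times> (UNIV :: 'b set)"
    using z cotangent_chart_image_self[OF A c] by auto
  show ?thesis
    using tangent_map_chart[OF B A smooth_at_cotangent_projection[OF A points_chart[OF e z]] e z c fz w]
      cotangent_projection_chart(3)[OF A c y] by simp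
qed

text \<open>
  In coordinates \<open>(x, \<xi>)\<close> this is the familiar expression \<open>\<theta> = \<xi> \<bullet> dx\<close>.
\<close>

lemma coeff1_canonical_1form:
  assumes A: "smooth_atlas A" and c: "c \<in> A" and y: "y \<in> snd c ` fst c \<times> UNIV"
  shows "coeff1 (cotangent_bundle A) (cotangent_chart A c) (canonical_1form A) a y = snd y \<bullet> fst a"
proof -
  let ?e = "cotangent_chart A c" and ?z = "chart_inv (cotangent_chart A c) y"
  note e = cotangent_chart_in[OF c] and B = smooth_atlas_cotangent_bundle[OF A]
  have y': "y \<in> snd ?e ` fst ?e" using y cotangent_chart_image_self[OF A c] by simp
  have z: "?z \<in> fst ?e" by (rule chart_inv_in[OF y'])
  have fz: "fst ?z \<in> fst c" and sz: "snd ?z \<in> cotangent_space A (fst ?z)"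
    using z cotangent_chart_mem[of "fst ?z" "snd ?z" A c] by simp_all
  let ?w = "coord_vec (cotangent_bundle A) ?e ?z a"
  have w: "?w \<in> tangent_space (cotangent_bundle A) ?z" by (rule coord_vec_in[OF B e z])
  let ?v = "tangent_map (cotangent_bundle A) A fst ?z ?w"
  have v: "?v \<in> tangent_space A (fst ?z)"
    by (rule tangent_map_in[OF B A smooth_at_cotangent_projection[OF A points_chart[OF e z]] w])
  have "?v c = fst a"
    using tangent_map_cotangent_projection[OF A c z w] coord_vec_self[OF B e z] by simp
  then have "?v = coord_vec A c (fst ?z) (fst a)" using tangent_eq_coord_vec[OF c fz v] by simp
  then show ?thesis
    using covec_coordinates[OF A c fz sz] chart_chart_inv[OF y']
    by (simp add: coeff1_def canonical_1form_def)
qed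

lemma one_form_canonical_1form:
  assumes A: "smooth_atlas A"
  shows "one_form (cotangent_bundle A) (canonical_1form A)"
  unfolding one_form_iff
proof (intro conjI ballI allI)
  note B = smooth_atlas_cotangent_bundle[OF A]
  fix z assume z: "z \<in> points (cotangent_bundle A)"
  note s = smooth_at_cotangent_projection[OF A z]
  have "snd z \<in> cotangent_space A (fst z)"
    using z points_cotangent_bundle[of "fst z" "snd z" A] by simp
  then have "linear_on_tangent A (fst z) (snd z)" by (simp add: cotangent_space_def)
  then show "linear_on_tangent (cotangent_bundle A) z (canonical_1form A z)"
    using tangent_map_in[OF B A s]
    by (simp add: linear_on_tangent_def canonical_1form_def tangent_map_combination[OF B s])
next
  fix e and a :: "'b \<times> 'b" assume "e \<in> cotangent_bundle A"
  then obtain c where e: "e = cotangent_chart A c" and c: "c \<in> A" by (auto simp: cotangent_bundle_def)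
  have o: "open (snd c ` fst c \<times> (UNIV :: 'b set))" by (intro open_Times open_UNIV open_chart_image[OF A c])
  have "smooth_on (snd c ` fst c \<times> (UNIV :: 'b set)) (\<lambda>y. snd y \<bullet> fst a)"
    by (intro smooth_on_inner o smooth_on_snd smooth_on_const)
  then show "smooth_on (snd e ` fst e) (coeff1 (cotangent_bundle A) e (canonical_1form A) a)"
    unfolding e cotangent_chart_image_self[OF A c]
    by (subst smooth_on_cong[OF o coeff1_canonical_1form[OF A c]])
qed

text \<open>
  In coordinates \<open>(x, \<xi>)\<close> this is \<open>- d\<theta> = dx \<and> d\<xi>\<close>.
\<close>

lemma canonical_2form_chart:
  assumes A: "smooth_atlas A" and c: "c \<in> A" and z: "z \<in> fst (cotangent_chart A c)"
    and u: "u \<in> tangent_space (cotangent_bundle A) z" and v: "v \<in> tangent_space (cotangent_bundle A) z"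
  shows "canonical_2form A z u v =
    fst (u (cotangent_chart A c)) \<bullet> snd (v (cotangent_chart A c)) -
    snd (u (cotangent_chart A c)) \<bullet> fst (v (cotangent_chart A c))"
proof -
  let ?e = "cotangent_chart A c" and ?S = "snd c ` fst c \<times> (UNIV :: 'b set)"
  note e = cotangent_chart_in[OF c] and B = smooth_atlas_cotangent_bundle[OF A]
  have o: "open ?S" by (intro open_Times open_UNIV open_chart_image[OF A c])
  have y: "snd ?e z \<in> ?S" using z cotangent_chart_image_self[OF A c] by auto
  have "der (coeff1 (cotangent_bundle A) ?e (canonical_1form A) a) (snd ?e z) b = snd b \<bullet> fst a" for a b
  proof -
    have *: "der (coeff1 (cotangent_bundle A) ?e (canonical_1form A) a) (snd ?e z) = der (\<lambda>y. snd y \<bullet> fst a) (snd ?e z)"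
      by (rule der_cong_open[OF o y coeff1_canonical_1form[OF A c]])
    show ?thesis
      unfolding * using der_inner[OF smooth_on_differentiable[OF smooth_on_snd[of UNIV]]] by simp
  qed
  then show ?thesis
    using ext_deriv1_chart[OF B e z one_form_canonical_1form[OF A] u v]
    by (simp add: canonical_2form_def chart_ext_deriv1_def inner_commute)
qed

lemma two_form_magnetic:
  assumes A: "smooth_atlas A" and \<beta>: "two_form A \<beta>"
  shows "two_form (cotangent_bundle A) (magnetic_2form A \<beta>)"
proof -
  note B = smooth_atlas_cotangent_bundle[OF A]
  have "two_form (cotangent_bundle A) (\<lambda>z u v. (-1) * ext_deriv1 (cotangent_bundle A) (canonical_1form A) z u v +
      (-1) * pullback2 (cotangent_bundle A) A fst \<beta> z u v)"
    by (intro two_form_combination two_form_ext_deriv1 pullback2_two_form A B \<beta> one_form_canonical_1form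
        smooth_at_cotangent_projection)
  then show ?thesis by (simp add: magnetic_2form_def[abs_def] canonical_2form_def)
qed

text \<open>
  The term from \<open>\<beta>\<close> vanishes as soon as one argument is tangent to the fibre. Testing a degenerate vector
  against fibre vectors shows that its base component is zero. It is then tangent to the fibre itself, and
  testing it against arbitrary base components shows that its fibre component is zero as well.
\<close>

lemma nondegenerate2_magnetic:
  assumes A: "smooth_atlas A" and \<beta>: "two_form A \<beta>"
  shows "nondegenerate2 (cotangent_bundle A) (magnetic_2form A \<beta>)"
  unfolding nondegenerate2_def
proof (intro ballI impI)
  note B = smooth_atlas_cotangent_bundle[OF A]
  fix z u assume z: "z \<in> points (cotangent_bundle A)" and u: "u \<in> tangent_space (cotangent_bundle A) z"
    and 0: "\<forall>v\<in>tangent_space (cotangent_bundle A) z. magnetic_2form A \<beta> z u v = 0"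
  obtain c where c: "c \<in> A" and ze: "z \<in> fst (cotangent_chart A c)"
    using z by (auto simp: points_def cotangent_bundle_def)
  let ?e = "cotangent_chart A c" and ?T = "cotangent_bundle A"
  let ?v = "coord_vec ?T ?e z"
  note e = cotangent_chart_in[OF c] and s = smooth_at_cotangent_projection[OF A z]
  have fz: "fst z \<in> fst c" using ze by (cases z) simp
  have fp: "fst z \<in> points A" by (rule points_chart[OF c fz])
  note ve = coord_vec_self[OF B e ze] and v = coord_vec_in[OF B e ze]
  have T0: "tangent_map ?T A fst z w = zero_tvec" if w: "w \<in> tangent_space ?T z" and "fst (w ?e) = 0" for w
    using tangent_map_cotangent_projection[OF A c ze w] that(2)
    by (intro tangent_eqI[OF c fz tangent_map_in[OF B A s w] zero_tvec_in[OF A]]) (simp add: zero_tvec_def)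
  have \<beta>0: "\<beta> (fst z) a zero_tvec = 0" "\<beta> (fst z) zero_tvec a = 0" if "a \<in> tangent_space A (fst z)" for a
  proof -
    have "linear_on_tangent A (fst z) (\<lambda>v. \<beta> (fst z) a v)" "linear_on_tangent A (fst z) (\<lambda>v. \<beta> (fst z) v a)"
      using \<beta> fp that by (simp_all add: two_form_def)
    from linear_on_tangent_zero[OF A this(1)] linear_on_tangent_zero[OF A this(2)]
    show "\<beta> (fst z) a zero_tvec = 0" "\<beta> (fst z) zero_tvec a = 0" by simp_all
  qed
  have "fst (u ?e) \<bullet> b = 0" for b
  proof -
    have "\<beta> (fst z) (tangent_map ?T A fst z u) (tangent_map ?T A fst z (?v (0, b))) = 0"
      using T0[OF v] \<beta>0(1)[OF tangent_map_in[OF B A s u]] ve by simp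
    moreover have "magnetic_2form A \<beta> z u (?v (0, b)) = 0" using 0 v by blast
    ultimately show ?thesis
      using canonical_2form_chart[OF A c ze u v, of "(0, b)"] ve by (simp add: magnetic_2form_def pullback2_def)
  qed
  then have 1: "fst (u ?e) = 0" using inner_eq_zero_iff by blast
  have "snd (u ?e) \<bullet> a = 0" for a
  proof -
    have "\<beta> (fst z) (tangent_map ?T A fst z u) (tangent_map ?T A fst z (?v (a, 0))) = 0"
      using T0[OF u 1] \<beta>0(2)[OF tangent_map_in[OF B A s v]] by simp
    moreover have "magnetic_2form A \<beta> z u (?v (a, 0)) = 0" using 0 v by blast
    ultimately show ?thesis
      using canonical_2form_chart[OF A c ze u v, of "(a, 0)"] ve by (simp add: magnetic_2form_def pullback2_def)
  qed
  then have 2: "snd (u ?e) = 0" using inner_eq_zero_iff by blast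
  show "u = zero_tvec"
    using 1 2 by (intro tangent_eqI[OF e ze u zero_tvec_in[OF B]]) (simp add: zero_tvec_def prod_eq_iff)
qed


section \<open>Discrete Legendre transforms and the flow\<close>

text \<open>
  The defining property of the canonical one-form: the tangent map of the bundle projection that it contains is
  composed with that of \<open>F\<close>, which leaves the tangent map of the base point of \<open>F\<close>.
\<close>

lemma pullback1_canonical_1form:
  assumes A: "smooth_atlas A" and Q: "smooth_atlas Q" and F: "smooth_at A (cotangent_bundle Q) F z"
    and u: "u \<in> tangent_space A z"
  shows "pullback1 A (cotangent_bundle Q) F (canonical_1form Q) z u =
    snd (F z) (tangent_map A Q (\<lambda>q. fst (F q)) z u)"
  using tangent_map_compose[OF A smooth_atlas_cotangent_bundle[OF Q] Q F
      smooth_at_cotangent_projection[OF Q smooth_atD(2)[OF F]] u]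
  by (simp add: pullback1_def canonical_1form_def)

lemma pullback2_magnetic_2form:
  assumes A: "smooth_atlas A" and Q: "smooth_atlas Q" and F: "smooth_at A (cotangent_bundle Q) F z"
    and u: "u \<in> tangent_space A z" and v: "v \<in> tangent_space A z"
  shows "pullback2 A (cotangent_bundle Q) F (magnetic_2form Q \<beta>) z u v =
    - ext_deriv1 A (pullback1 A (cotangent_bundle Q) F (canonical_1form Q)) z u v -
    pullback2 A Q (\<lambda>q. fst (F q)) \<beta> z u v"
proof -
  note T = smooth_atlas_cotangent_bundle[OF Q]
  note c = tangent_map_compose[OF A T Q F smooth_at_cotangent_projection[OF Q smooth_atD(2)[OF F]]]
  show ?thesis
    using ext_deriv1_pullback[OF A T F one_form_canonical_1form[OF Q] u v] c[OF u] c[OF v]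
    by (simp add: pullback2_def magnetic_2form_def canonical_2form_def)
qed

lemma fst_legendre [simp]:
  "fst (legendre_plus Q L f z) = snd z" "fst (legendre_minus Q L f z) = fst z"
  by (simp_all add: legendre_plus_def legendre_minus_def case_prod_beta)

text \<open>
  The two pullbacks are the partial forms of \<open>dL + f\<close>, the one along the first factor with the
  opposite sign, so that their difference reassembles the whole form.
\<close>

lemma legendre_canonical_difference:
  assumes Q: "smooth_atlas Q" and L: "smooth_fun (prod_atlas Q Q) L" and f: "one_form (prod_atlas Q Q) f"
    and reg: "regular_system Q L f"
    and z: "z \<in> points (prod_atlas Q Q)" and u: "u \<in> tangent_space (prod_atlas Q Q) z"
  shows "pullback1 (prod_atlas Q Q) (cotangent_bundle Q) (legendre_plus Q L f) (canonical_1form Q) z u -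
      pullback1 (prod_atlas Q Q) (cotangent_bundle Q) (legendre_minus Q L f) (canonical_1form Q) z u =
    differential (prod_atlas Q Q) L z u + f z u"
proof -
  let ?P = "prod_atlas Q Q" and ?T = "cotangent_bundle Q"
  note P = smooth_atlas_prod[OF Q Q] and T = smooth_atlas_cotangent_bundle[OF Q]
  obtain p q where zpq: "z = (p, q)" by (cases z)
  have p: "p \<in> points Q" and q: "q \<in> points Q" using z by (simp_all add: zpq points_prod_atlas)
  have s: "smooth_at ?P ?T (legendre_plus Q L f) z" "smooth_at ?P ?T (legendre_minus Q L f) z"
    using local_diffeo_smooth_at[OF P T _ z] reg by (auto simp: regular_system_def)
  note pr = smooth_at_projections[OF Q Q z]
  have v: "tangent_map ?P Q fst z u \<in> tangent_space Q p" "tangent_map ?P Q snd z u \<in> tangent_space Q q"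
    using tangent_map_in[OF P Q pr(1) u] tangent_map_in[OF P Q pr(2) u] by (simp_all add: zpq)
  have g: "one_form ?P (\<lambda>z u. 1 * differential ?P L z u + 1 * f z u)"
    by (rule one_form_combination[OF P one_form_differential[OF P L] f])
  then have l: "linear_on_tangent ?P (p, q) (\<lambda>u. differential ?P L (p, q) u + f (p, q) u)"
    using z by (simp add: one_form_def zpq)
  have 1: "pullback1 ?P ?T (legendre_plus Q L f) (canonical_1form Q) z u =
      D2 Q L p q (tangent_map ?P Q snd z u) + force_plus Q f p q (tangent_map ?P Q snd z u)"
    using v pullback1_canonical_1form[OF P Q s(1) u]
    by (simp add: zpq) (simp add: legendre_plus_def restrict_covec_def)
  have 2: "pullback1 ?P ?T (legendre_minus Q L f) (canonical_1form Q) z u =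
      - D1 Q L p q (tangent_map ?P Q fst z u) - force_minus Q f p q (tangent_map ?P Q fst z u)"
    using v pullback1_canonical_1form[OF P Q s(2) u]
    by (simp add: zpq) (simp add: legendre_minus_def restrict_covec_def)
  show ?thesis
    using tvec_pair_decomposition[OF Q Q p q _ l, of u] u
    unfolding 1 2 by (simp add: zpq D1_def D2_def force_plus_def force_minus_def)
qed

text \<open>
  The trajectory equation, read as an equality of momenta at \<open>q\<^sub>1\<close>.
\<close>

lemma legendre_flow:
  assumes "local_flow Q L f F U V" "z \<in> U"
  shows "legendre_minus Q L f (F z) = legendre_plus Q L f z"
proof -
  obtain q0 q1 where z: "z = (q0, q1)" by (cases z)
  obtain q2 where q2: "F (q0, q1) = (q1, q2)" "trajectory Q L f q0 q1 q2"
    using assms unfolding local_flow_def z by blast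
  have "- D1 Q L q1 q2 v - force_minus Q f q1 q2 v = D2 Q L q0 q1 v + force_plus Q f q0 q1 v"
    if "v \<in> tangent_space Q q1" for v
  proof -
    have "D2 Q L q0 q1 v + D1 Q L q1 q2 v + force_plus Q f q0 q1 v + force_minus Q f q1 q2 v = 0"
      using q2(2) that unfolding trajectory_def by blast
    then show ?thesis by linarith
  qed
  then show ?thesis by (auto simp: z q2(1) legendre_plus_def legendre_minus_def restrict_covec_def)
qed

text \<open>
  The exterior derivative of \<open>legendre_canonical_difference\<close> loses its \<open>dL\<close> part. What remains, \<open>df\<close>, is by the
  Routh condition exactly compensated by the difference of the two pullbacks of \<open>\<beta>\<close>.
\<close>

lemma omega_plus_eq_omega_minus:
  assumes sys: "forced_discrete_system Q L f" and reg: "regular_system Q L f" and routh: "routh_type Q f \<beta>"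
    and z: "z \<in> points (prod_atlas Q Q)"
    and u: "u \<in> tangent_space (prod_atlas Q Q) z" and v: "v \<in> tangent_space (prod_atlas Q Q) z"
  shows "omega_plus Q L f \<beta> z u v = omega_minus Q L f \<beta> z u v"
proof -
  let ?P = "prod_atlas Q Q" and ?T = "cotangent_bundle Q"
  have Q: "smooth_atlas Q" and L: "smooth_fun ?P L" and f: "one_form ?P f"
    using sys by (auto simp: forced_discrete_system_def smooth_manifold_def)
  note P = smooth_atlas_prod[OF Q Q] and T = smooth_atlas_cotangent_bundle[OF Q]
  have s: "smooth_at ?P ?T (legendre_plus Q L f) z" "smooth_at ?P ?T (legendre_minus Q L f) z"
    if "z \<in> points ?P" for z
    using local_diffeo_smooth_at[OF P T _ that] reg by (auto simp: regular_system_def)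
  let ?p = "pullback1 ?P ?T (legendre_plus Q L f) (canonical_1form Q)"
  let ?m = "pullback1 ?P ?T (legendre_minus Q L f) (canonical_1form Q)"
  have pm: "one_form ?P ?p" "one_form ?P ?m"
    using s by (auto intro!: pullback1_one_form[OF P T one_form_canonical_1form[OF Q]])
  have "ext_deriv1 ?P ?p z u v - ext_deriv1 ?P ?m z u v = ext_deriv1 ?P (\<lambda>z u. 1 * ?p z u + (-1) * ?m z u) z u v"
    unfolding ext_deriv1_combination[OF P z pm] by simp
  also have "\<dots> = ext_deriv1 ?P (\<lambda>z u. 1 * differential ?P L z u + 1 * f z u) z u v"
    using legendre_canonical_difference[OF Q L f reg] by (intro ext_deriv1_cong[OF P z]) simp
  also have "\<dots> = ext_deriv1 ?P f z u v"
    unfolding ext_deriv1_combination[OF P z one_form_differential[OF P L] f] ext_deriv1_differential[OF P L z]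
    by simp
  finally have "ext_deriv1 ?P ?p z u v - ext_deriv1 ?P ?m z u v = ext_deriv1 ?P f z u v" .
  moreover have "- ext_deriv1 ?P f z u v = pullback2 ?P Q snd \<beta> z u v - pullback2 ?P Q fst \<beta> z u v"
    using routh z u v by (simp add: routh_type_def forms2_eq_on_def)
  ultimately show ?thesis
    using pullback2_magnetic_2form[OF P Q s(1)[OF z] u v, of \<beta>] pullback2_magnetic_2form[OF P Q s(2)[OF z] u v, of \<beta>]
    by (simp add: omega_plus_def omega_minus_def)
qed

text \<open>
  The difference of the two pullbacks of \<open>\<beta>\<close> equals \<open>- df\<close> and is therefore closed.
\<close>

lemma routh_potential_closed:
  assumes Q: "smooth_atlas Q" and f: "one_form (prod_atlas Q Q) f" and routh: "routh_type Q f \<beta>"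
  shows "closed2 (prod_atlas Q Q) (pullback2 (prod_atlas Q Q) Q fst \<beta>)"
    and "closed2 (prod_atlas Q Q) (pullback2 (prod_atlas Q Q) Q snd \<beta>)"
proof -
  let ?P = "prod_atlas Q Q"
  note P = smooth_atlas_prod[OF Q Q]
  have \<beta>: "two_form Q \<beta>" using routh by (simp add: routh_type_def)
  note e = two_form_ext_deriv1[OF P f] closed2_ext_deriv1[OF P f]
  have "closed2 ?P (\<lambda>z u v. pullback2 ?P Q snd \<beta> z u v - pullback2 ?P Q fst \<beta> z u v)"
    using routh
    \<comment> \<open>a multiple of the single form \<open>df\<close>, written as a combination with coefficients \<open>-1\<close> and \<open>0\<close>\<close>
    by (intro closed2_combination[OF P e e, of _ "-1" 0]) (simp add: routh_type_def forms2_eq_on_def)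
  then show "closed2 ?P (pullback2 ?P Q fst \<beta>)" "closed2 ?P (pullback2 ?P Q snd \<beta>)"
    by (fact closed2_pullback_difference_imp[OF Q Q \<beta> \<beta>])+
qed

text \<open>
  Closedness of \<open>\<beta>\<close> itself is replaced by closedness of its pullback along the base point map of \<open>F\<close>, as this
  is what the Routh condition provides on \<open>Q \<times> Q\<close>.
\<close>

lemma symplectic_form_pullback_magnetic:
  assumes A: "smooth_atlas A" and Q: "smooth_atlas Q" and F: "local_diffeo A (cotangent_bundle Q) F"
    and \<beta>: "two_form Q \<beta>" and cl: "closed2 A (pullback2 A Q (\<lambda>q. fst (F q)) \<beta>)"
  shows "symplectic_form A (pullback2 A (cotangent_bundle Q) F (magnetic_2form Q \<beta>))"
  unfolding symplectic_form_def
proof (intro conjI)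
  let ?T = "cotangent_bundle Q"
  note T = smooth_atlas_cotangent_bundle[OF Q]
  note s = local_diffeo_smooth_at[OF A T F]
  have t: "one_form A (pullback1 A ?T F (canonical_1form Q))"
    by (rule pullback1_one_form[OF A T one_form_canonical_1form[OF Q] s])
  have b: "two_form A (pullback2 A Q (\<lambda>q. fst (F q)) \<beta>)"
    by (intro pullback2_two_form[OF A Q \<beta>] smooth_at_compose[OF A T Q s] smooth_at_cotangent_projection[OF Q]
        smooth_atD(2)[OF s])
  show "two_form A (pullback2 A ?T F (magnetic_2form Q \<beta>))"
    by (rule pullback2_two_form[OF A T two_form_magnetic[OF Q \<beta>] s])
  show "closed2 A (pullback2 A ?T F (magnetic_2form Q \<beta>))"
    by (rule closed2_combination[OF A two_form_ext_deriv1[OF A t] closed2_ext_deriv1[OF A t] b cl, of _ "-1" "-1"])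
      (simp add: pullback2_magnetic_2form[OF A Q s])
  show "nondegenerate2 A (pullback2 A ?T F (magnetic_2form Q \<beta>))"
    by (rule nondegenerate2_pullback[OF A T F nondegenerate2_magnetic[OF Q \<beta>]])
qed

text \<open>
  Both sides are pullbacks of the magnetic form, along the composite of \<open>F\<close> with the minus transform and along
  the plus transform, and these maps coincide on the open set \<open>U\<close>.
\<close>

lemma flow_pulls_back_omega_minus_to_omega_plus:
  assumes Q: "smooth_atlas Q" and reg: "regular_system Q L f" and flow: "local_flow Q L f F U V" and z: "z \<in> U"
    and u: "u \<in> tangent_space (prod_atlas Q Q) z" and v: "v \<in> tangent_space (prod_atlas Q Q) z"
  shows "pullback2 (prod_atlas Q Q) (prod_atlas Q Q) F (omega_minus Q L f \<beta>) z u v = omega_plus Q L f \<beta> z u v"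
proof -
  let ?P = "prod_atlas Q Q" and ?T = "cotangent_bundle Q"
  note P = smooth_atlas_prod[OF Q Q] and T = smooth_atlas_cotangent_bundle[OF Q]
  have F: "diffeo ?P ?P F U V" using flow by (simp add: local_flow_def)
  then have U: "openin (manifold_topology ?P) U" by (simp add: diffeo_def)
  note sF = diffeo_tangent_map_inverse(3)[OF P P F z]
  have sm: "smooth_at ?P ?T (legendre_minus Q L f) (F z)"
    using local_diffeo_smooth_at[OF P T _ smooth_atD(2)[OF sF]] reg by (auto simp: regular_system_def)
  have "tangent_map ?P ?T (\<lambda>q. legendre_minus Q L f (F q)) z = tangent_map ?P ?T (legendre_plus Q L f) z"
    by (rule tangent_map_cong[OF P U z legendre_flow[OF flow]])
  then have "tangent_map ?P ?T (legendre_minus Q L f) (F z) (tangent_map ?P ?P F z w) =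
      tangent_map ?P ?T (legendre_plus Q L f) z w" if "w \<in> tangent_space ?P z" for w
    using tangent_map_compose[OF P P T sF sm that] by simp
  then show ?thesis
    using u v legendre_flow[OF flow z] by (simp add: omega_plus_def omega_minus_def pullback2_def)
qed

theorem theorem2p28:
  fixes Q :: "('q, 'e::euclidean_space) atlas"
    and L :: "'q \<times> 'q \<Rightarrow> real"
    and f :: "('q \<times> 'q, 'e \<times> 'e) form1"
    and \<beta> :: "('q, 'e) form2"
  assumes "forced_discrete_system Q L f"
    and "regular_system Q L f"
    and "routh_type Q f \<beta>"
  shows "symplectic_form (prod_atlas Q Q) (omega_plus Q L f \<beta>) \<and>
    symplectic_form (prod_atlas Q Q) (omega_minus Q L f \<beta>) \<and>
    (\<forall>F U V. local_flow Q L f F U V \<longrightarrow>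
      forms2_eq_on (prod_atlas Q Q) U
        (pullback2 (prod_atlas Q Q) (prod_atlas Q Q) F (omega_plus Q L f \<beta>))
        (omega_plus Q L f \<beta>) \<and>
      forms2_eq_on (prod_atlas Q Q) U
        (pullback2 (prod_atlas Q Q) (prod_atlas Q Q) F (omega_minus Q L f \<beta>))
        (omega_minus Q L f \<beta>))"
proof (intro conjI allI impI)
  let ?P = "prod_atlas Q Q"
  have Q: "smooth_atlas Q" and f: "one_form ?P f"
    using assms(1) by (auto simp: forced_discrete_system_def smooth_manifold_def)
  have \<beta>: "two_form Q \<beta>" using assms(3) by (simp add: routh_type_def)
  note P = smooth_atlas_prod[OF Q Q] and cl = routh_potential_closed[OF Q f assms(3)]
  have reg: "local_diffeo ?P (cotangent_bundle Q) (legendre_plus Q L f)"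
    "local_diffeo ?P (cotangent_bundle Q) (legendre_minus Q L f)"
    using assms(2) by (auto simp: regular_system_def)
  show "symplectic_form ?P (omega_plus Q L f \<beta>)"
    unfolding omega_plus_def
    by (rule symplectic_form_pullback_magnetic[OF P Q reg(1) \<beta>]) (simp add: cl(2))
  show "symplectic_form ?P (omega_minus Q L f \<beta>)"
    unfolding omega_minus_def
    by (rule symplectic_form_pullback_magnetic[OF P Q reg(2) \<beta>]) (simp add: cl(1))
  fix F U V assume flow: "local_flow Q L f F U V"
  then have F: "diffeo ?P ?P F U V" by (simp add: local_flow_def)
  note pm = omega_plus_eq_omega_minus[OF assms]
    and fl = flow_pulls_back_omega_minus_to_omega_plus[OF Q assms(2) flow]
  have "pullback2 ?P ?P F (omega_plus Q L f \<beta>) z u v = omega_plus Q L f \<beta> z u v \<and>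
      pullback2 ?P ?P F (omega_minus Q L f \<beta>) z u v = omega_minus Q L f \<beta> z u v"
    if z: "z \<in> U" and u: "u \<in> tangent_space ?P z" and v: "v \<in> tangent_space ?P z" for z u v
  proof -
    note s = diffeo_tangent_map_inverse(3)[OF P P F z]
    have "pullback2 ?P ?P F (omega_plus Q L f \<beta>) z u v = pullback2 ?P ?P F (omega_minus Q L f \<beta>) z u v"
      unfolding pullback2_def
      by (rule pm[OF smooth_atD(2)[OF s] tangent_map_in[OF P P s u] tangent_map_in[OF P P s v]])
    then show ?thesis using fl[OF z u v] pm[OF smooth_atD(1)[OF s] u v] by simp
  qed
  then show "forms2_eq_on ?P U (pullback2 ?P ?P F (omega_plus Q L f \<beta>)) (omega_plus Q L f \<beta>)"
    "forms2_eq_on ?P U (pullback2 ?P ?P F (omega_minus Q L f \<beta>)) (omega_minus Q L f \<beta>)"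
    by (simp_all add: forms2_eq_on_def)
qed

end
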